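(* Let $U,V$ be separable Hilbert spaces, $T>0$, $L$ a Lévy process in $U$, $G\in\mathcal{L}(U,V)$ a bounded linear operator, and let $A$ be the generator of a strongly continuous semigroup $(S(t))_{t\ge0}$ in $V$. For $\gamma>0$ let $Y_\gamma(t)=\int_0^tS(\gamma(t-s))G\,dL(s)$, $t\in[0,T]$, be the unique weak solution of $dY_\gamma(t)=\gamma AY_\gamma(t)\,dt+G\,dL(t)$, $Y_\gamma(0)=0$, assumed to have càdlàg trajectories, and let $X_\gamma(t):=\gamma\int_0^tY_\gamma(s)\,ds$, $t\in[0,T]$, be the integrated Ornstein–Uhlenbeck process. Assume that the semigroup is diagonalisable, i.e. there exists an orthonormal basis $e=(e_k)_{k\in\mathbb{N}}$ of $V$ such that $$S(t)e_k=e^{-\lambda_kt}e_k\qquad\text{for all }t\ge0,\ k\in\mathbb{N},$$ for some $\lambda_k>0$ with $\lambda_k\to\infty$ as $k\to\infty$. Then $$\lim_{\gamma\to\infty}\big(AX_\gamma(t)\colon t\in[0,T]\big)=\big(-GL(t)\colon t\in[0,T]\big)$$ in probability in the product topology $(D([0,T];V),d_M^{\,e})$, i.e. $\lim_{\gamma\to\infty}P(d_M^{\,e}(AX_\gamma,-GL)\ge\varepsilon)=0$ for all $\varepsilon>0$.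
   Context: Skorokhod space. For a separable Banach space $E$, $D([0,T];E)$ is the space of càdlàg functions $[0,T]\to E$. For $f\in D([0,T];\mathbb{R})$ the extended graph is $\Gamma(f):=\{(t,v)\in[0,T]\times\mathbb{R}\colon v=\alpha f(t-)+(1-\alpha)f(t)\text{ for some }\alpha\in[0,1]\}$, $f(0-):=f(0)$, ordered by $(t_1,v_1)\le(t_2,v_2)$ iff $t_1<t_2$, or $t_1=t_2$ and $|f(t_1-)-v_1|\le|f(t_1-)-v_2|$. $\Pi(f)$ is the set of continuous, non-decreasing, surjective maps $(r,u)\colon[0,1]\to\Gamma(f)$ with $(r,u)(0)=(0,f(0))$, $(r,u)(1)=(T,f(T))$. The $M_1$ metric on $D([0,T];\mathbb{R})$ is $d_M(f_1,f_2):=\inf\{|r_1-r_2|_\infty\vee|u_1-u_2|_\infty\colon(r_i,u_i)\in\Pi(f_i)\}$. The product metric on $D([0,T];V)$ is $d_M^{\,e}(f,g):=\sum_{k=1}^\infty2^{-k}\frac{d_M(\langle f,e_k\rangle,\langle g,e_k\rangle)}{1+d_M(\langle f,e_k\rangle,\langle g,e_k\rangle)}$. A Lévy process $L$ in $U$ is an adapted $U$-valued càdlàg process with $L(0)=0$ a.s., independent and stationary increments, continuous in probability. For measurable $F\colon[0,T]\to\mathcal{L}(U,V)$ with $\int_0^T\|F(s)\|_{U\to V}^2ds<\infty$ the integral $\int_0^TF(s)\,dL(s)$ is the limit in probability of the natural integrals of step functions (Chojnowska-Michalik). A weak solution of the equation for $Y_\gamma$ is a progressively measurable process $Y_\gamma$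 with, for every $v\in\mathcal{D}(A^* )$ and $t\in[0,T]$, $P$-a.s. $\langle Y_\gamma(t),v\rangle=\int_0^t\langle Y_\gamma(s),\gamma A^*v\rangle\,ds+\langle L(t),G^*v\rangle$. *)

theory Defs
  imports "HOL-Probability.Probability"
begin

text \<open>A path on \<open>[0, T]\<close> is a total function on the reals of which only the values
  on \<open>{0..T}\<close> matter.\<close>

definition cadlag_on :: "real \<Rightarrow> (real \<Rightarrow> 'e::topological_space) \<Rightarrow> bool" where
  "cadlag_on T f \<longleftrightarrow>
     (\<forall>t\<in>{0..<T}. (f \<longlongrightarrow> f t) (at_right t)) \<and>
     (\<forall>t\<in>{0<..T}. \<exists>l. (f \<longlongrightarrow> l) (at_left t))"

definition left_lim :: "(real \<Rightarrow> real) \<Rightarrow> real \<Rightarrow> real" where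
  "left_lim f t = (if t \<le> 0 then f 0 else Lim (at_left t) f)"

definition ext_graph :: "real \<Rightarrow> (real \<Rightarrow> real) \<Rightarrow> (real \<times> real) set" where
  "ext_graph T f =
     {(t, v). t \<in> {0..T} \<and> (\<exists>\<alpha>\<in>{0..1}. v = \<alpha> * left_lim f t + (1 - \<alpha>) * f t)}"

definition graph_le :: "(real \<Rightarrow> real) \<Rightarrow> real \<times> real \<Rightarrow> real \<times> real \<Rightarrow> bool" where
  "graph_le f p q \<longleftrightarrow>
     fst p < fst q \<or>
     fst p = fst q \<and> \<bar>left_lim f (fst p) - snd p\<bar> \<le> \<bar>left_lim f (fst p) - snd q\<bar>"

definition param_reps :: "real \<Rightarrow> (real \<Rightarrow> real) \<Rightarrow> (real \<Rightarrow> real \<times> real) set" where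
  "param_reps T f =
     {p. continuous_on {0..1} p \<and> p ` {0..1} = ext_graph T f \<and>
         (\<forall>a\<in>{0..1}. \<forall>b\<in>{0..1}. a \<le> b \<longrightarrow> graph_le f (p a) (p b)) \<and>
         p 0 = (0, f 0) \<and> p 1 = (T, f T)}"

definition dist_M1 :: "real \<Rightarrow> (real \<Rightarrow> real) \<Rightarrow> (real \<Rightarrow> real) \<Rightarrow> real" where
  "dist_M1 T f g =
     (INF (p, q) \<in> param_reps T f \<times> param_reps T g.
        max (SUP x\<in>{0..1}. \<bar>fst (p x) - fst (q x)\<bar>)
            (SUP x\<in>{0..1}. \<bar>snd (p x) - snd (q x)\<bar>))"

text \<open>The basis is enumerated from \<open>0\<close>, so the weight of \<open>e k\<close> is \<open>2\<^bsup>-(k+1)\<^esup>\<close>.\<close>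

definition dist_M1_prod ::
  "real \<Rightarrow> (nat \<Rightarrow> 'v::real_inner) \<Rightarrow> (real \<Rightarrow> 'v) \<Rightarrow> (real \<Rightarrow> 'v) \<Rightarrow> real" where
  "dist_M1_prod T e f g =
     (\<Sum>k. (1 / 2) ^ Suc k *
        (dist_M1 T (\<lambda>t. f t \<bullet> e k) (\<lambda>t. g t \<bullet> e k) /
         (1 + dist_M1 T (\<lambda>t. f t \<bullet> e k) (\<lambda>t. g t \<bullet> e k))))"

definition orthonormal_basis :: "(nat \<Rightarrow> 'v::real_inner) \<Rightarrow> bool" where
  "orthonormal_basis e \<longleftrightarrow>
     (\<forall>i j. e i \<bullet> e j = (if i = j then 1 else 0)) \<and> closure (span (range e)) = UNIV"

text \<open>Only the values \<open>S t\<close> with \<open>t \<ge> 0\<close> matter.\<close>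

definition C0_semigroup :: "(real \<Rightarrow> 'v::real_normed_vector \<Rightarrow>\<^sub>L 'v) \<Rightarrow> bool" where
  "C0_semigroup S \<longleftrightarrow>
     S 0 = id_blinfun \<and>
     (\<forall>s\<ge>0. \<forall>t\<ge>0. S (s + t) = S s o\<^sub>L S t) \<and>
     (\<forall>x. ((\<lambda>t. S t x) \<longlongrightarrow> x) (at_right 0))"

text \<open>An unbounded operator is a pair of a domain and a function that is meaningful only
  on that domain.\<close>

definition gen_dom :: "(real \<Rightarrow> 'v::real_normed_vector \<Rightarrow>\<^sub>L 'v) \<Rightarrow> 'v set" where
  "gen_dom S = {x. \<exists>y. ((\<lambda>h. (S h x - x) /\<^sub>R h) \<longlongrightarrow> y) (at_right 0)}"

definition gen :: "(real \<Rightarrow> 'v::real_normed_vector \<Rightarrow>\<^sub>L 'v) \<Rightarrow> 'v \<Rightarrow> 'v" where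
  "gen S x = Lim (at_right 0) (\<lambda>h. (S h x - x) /\<^sub>R h)"

definition adj_dom :: "'v::real_inner set \<Rightarrow> ('v \<Rightarrow> 'v) \<Rightarrow> 'v set" where
  "adj_dom D A = {v. \<exists>w. \<forall>x\<in>D. A x \<bullet> v = x \<bullet> w}"

text \<open>The representing vector is unique when \<open>D\<close> is dense.\<close>

definition adj_op :: "'v::real_inner set \<Rightarrow> ('v \<Rightarrow> 'v) \<Rightarrow> 'v \<Rightarrow> 'v" where
  "adj_op D A v = (THE w. \<forall>x\<in>D. A x \<bullet> v = x \<bullet> w)"

text \<open>Only meaningful for measurable \<open>X i\<close> and \<open>Z\<close>: \<open>measure\<close> is \<open>0\<close> off the \<open>\<sigma>\<close>-algebra.\<close>

definition tendsto_in_prob ::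
  "'w measure \<Rightarrow> ('i \<Rightarrow> 'w \<Rightarrow> 'e::metric_space) \<Rightarrow> ('w \<Rightarrow> 'e) \<Rightarrow> 'i filter \<Rightarrow> bool" where
  "tendsto_in_prob M X Z F \<longleftrightarrow>
     (\<forall>\<epsilon>>0. ((\<lambda>i. measure M {\<omega> \<in> space M. dist (X i \<omega>) (Z \<omega>) \<ge> \<epsilon>}) \<longlongrightarrow> 0) F)"

text \<open>Increments over successive intervals are mutually independent; independence of the past
  \<open>F s\<close> is not required. A process indexed by \<open>[0,\<infinity>)\<close> is covered through its restriction.\<close>

definition levy_process ::
  "'w measure \<Rightarrow> (real \<Rightarrow> 'w measure) \<Rightarrow> real \<Rightarrow>
   (real \<Rightarrow> 'w \<Rightarrow> 'u::{real_normed_vector, second_countable_topology}) \<Rightarrow> bool" where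
  "levy_process M F T L \<longleftrightarrow>
     (\<forall>t\<in>{0..T}. L t \<in> borel_measurable (F t)) \<and>
     (\<forall>\<omega>\<in>space M. cadlag_on T (\<lambda>t. L t \<omega>)) \<and>
     (AE \<omega> in M. L 0 \<omega> = 0) \<and>
     (\<forall>n (\<tau> :: nat \<Rightarrow> real).
        (\<forall>i\<le>n. \<tau> i \<in> {0..T}) \<and> (\<forall>i<n. \<tau> i < \<tau> (Suc i)) \<longrightarrow>
        prob_space.indep_vars M (\<lambda>_. borel) (\<lambda>i \<omega>. L (\<tau> (Suc i)) \<omega> - L (\<tau> i) \<omega>) {..<n}) \<and>
     (\<forall>s t h. 0 \<le> s \<and> 0 \<le> t \<and> 0 \<le> h \<and> s + h \<le> T \<and> t + h \<le> T \<longrightarrow>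
        distr M borel (\<lambda>\<omega>. L (s + h) \<omega> - L s \<omega>) = distr M borel (\<lambda>\<omega>. L (t + h) \<omega> - L t \<omega>)) \<and>
     (\<forall>t\<in>{0..T}. tendsto_in_prob M L (L t) (at t within {0..T}))"

text \<open>A list of triples \<open>(a, b, \<Phi>)\<close> encodes the step function \<open>\<Sum> 1\<^bsub>(a,b]\<^esub> \<Phi>\<close>;
  overlapping intervals are harmless.\<close>

type_synonym ('u, 'v) steps = "(real \<times> real \<times> ('u \<Rightarrow>\<^sub>L 'v)) list"

definition steps_on :: "real \<Rightarrow> ('u::real_normed_vector, 'v::real_normed_vector) steps \<Rightarrow> bool" where
  "steps_on t \<phi> \<longleftrightarrow> (\<forall>(a, b, \<Phi>)\<in>set \<phi>. 0 \<le> a \<and> a \<le> b \<and> b \<le> t)"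

definition step_fun ::
  "('u::real_normed_vector, 'v::real_normed_vector) steps \<Rightarrow> real \<Rightarrow> 'u \<Rightarrow>\<^sub>L 'v" where
  "step_fun \<phi> s = (\<Sum>(a, b, \<Phi>)\<leftarrow>\<phi>. indicator {a<..b} s *\<^sub>R \<Phi>)"

definition step_integral ::
  "('u::real_normed_vector, 'v::real_normed_vector) steps \<Rightarrow> (real \<Rightarrow> 'w \<Rightarrow> 'u) \<Rightarrow> 'w \<Rightarrow> 'v" where
  "step_integral \<phi> L \<omega> = (\<Sum>(a, b, \<Phi>)\<leftarrow>\<phi>. \<Phi> (L b \<omega> - L a \<omega>))"

definition L2_approx ::
  "real \<Rightarrow> (real \<Rightarrow> 'u::real_normed_vector \<Rightarrow>\<^sub>L 'v::real_normed_vector) \<Rightarrow>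
   (nat \<Rightarrow> ('u, 'v) steps) \<Rightarrow> bool" where
  "L2_approx t f \<phi> \<longleftrightarrow>
     (\<forall>n. steps_on t (\<phi> n)) \<and>
     (\<lambda>n. \<integral>\<^sup>+s\<in>{0..t}. ennreal ((norm (step_fun (\<phi> n) s - f s))\<^sup>2) \<partial>lborel) \<longlonglongrightarrow> 0"

text \<open>\<open>Z\<close> is a version of \<open>\<integral>\<^sub>0\<^sup>t f dL\<close>: the common limit in probability of the integrals of all
  sequences of step functions converging to \<open>f\<close> in \<open>L\<^sup>2([0,t]; \<L>(U,V))\<close>. The existence of such a
  sequence is part of measurability of \<open>f\<close> (in the sense of Bochner).\<close>

definition has_levy_integral ::
  "'w measure \<Rightarrow> (real \<Rightarrow> 'w \<Rightarrow> 'u::real_normed_vector) \<Rightarrow> real \<Rightarrow>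
   (real \<Rightarrow> 'u \<Rightarrow>\<^sub>L 'v::real_normed_vector) \<Rightarrow> ('w \<Rightarrow> 'v) \<Rightarrow> bool" where
  "has_levy_integral M L t f Z \<longleftrightarrow>
     set_borel_measurable lborel {0..t} f \<and>
     (\<integral>\<^sup>+s\<in>{0..t}. ennreal ((norm (f s))\<^sup>2) \<partial>lborel) < \<infinity> \<and>
     Z \<in> borel_measurable M \<and>
     (\<exists>\<phi>. L2_approx t f \<phi>) \<and>
     (\<forall>\<phi>. L2_approx t f \<phi> \<longrightarrow>
        tendsto_in_prob M (\<lambda>n. step_integral (\<phi> n) L) Z sequentially)"

definition progressive ::
  "(real \<Rightarrow> 'w measure) \<Rightarrow> real \<Rightarrow> (real \<Rightarrow> 'w \<Rightarrow> 'e::topological_space) \<Rightarrow> bool" where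
  "progressive F T Y \<longleftrightarrow>
     (\<forall>t\<in>{0..T}. (\<lambda>(s, \<omega>). Y s \<omega>) \<in> borel_measurable (restrict_space borel {0..t} \<Otimes>\<^sub>M F t))"

text \<open>The equation is \<open>dY = \<gamma> A Y dt + G dL\<close>, \<open>Y(0) = 0\<close>, where \<open>A\<close> has domain \<open>D\<close>.\<close>

definition weak_solution ::
  "'w measure \<Rightarrow> (real \<Rightarrow> 'w measure) \<Rightarrow> real \<Rightarrow> 'v::{real_inner, banach, second_countable_topology} set \<Rightarrow>
   ('v \<Rightarrow> 'v) \<Rightarrow> ('u::real_inner \<Rightarrow>\<^sub>L 'v) \<Rightarrow> (real \<Rightarrow> 'w \<Rightarrow> 'u) \<Rightarrow> real \<Rightarrow> (real \<Rightarrow> 'w \<Rightarrow> 'v) \<Rightarrow> bool" where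
  "weak_solution M F T D A G L \<gamma> Y \<longleftrightarrow>
     progressive F T Y \<and>
     (\<forall>v\<in>adj_dom D A. \<forall>t\<in>{0..T}. AE \<omega> in M.
        Y t \<omega> \<bullet> v =
          (LINT s:{0..t}|lborel. Y s \<omega> \<bullet> (\<gamma> *\<^sub>R adj_op D A v)) + L t \<omega> \<bullet> adjoint (blinfun_apply G) v)"

definition integrated_process ::
  "real \<Rightarrow> (real \<Rightarrow> 'w \<Rightarrow> 'v::{banach, second_countable_topology}) \<Rightarrow> real \<Rightarrow> 'w \<Rightarrow> 'v" where
  "integrated_process \<gamma> Y t \<omega> = \<gamma> *\<^sub>R (LINT s:{0..t}|lborel. Y s \<omega>)"

end

theory Submission
  imports Defs
begin

text \<open>
  Write \<open>Z = G L\<close>. Testing the weak equation with \<open>e k\<close>, for which \<open>A\<^sup>* e k = - lam k e k\<close>, shows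
  that the coordinates of \<open>X = \<gamma> \<integral> Y\<close> satisfy \<open>- lam k X k = Y k - Z k\<close>. Since \<open>Y - Z\<close> is a vector,
  \<open>X\<close> lies in the domain of \<open>A\<close> and \<open>A X = Y - Z\<close>, almost surely at all times
  (\<open>gen_from_coordinates\<close>, \<open>gen_of_integrated_path\<close>). Hence \<open>A X\<close> has cadlag paths, and each of its
  coordinates \<open>x\<close> solves the scalar relaxation equation \<open>x' = c (f - x)\<close>, \<open>x 0 = 0\<close>, driven by the
  corresponding coordinate \<open>f\<close> of \<open>- Z\<close> with the rate \<open>c = \<gamma> lam k\<close>.

  The rest is a statement about single paths: as \<open>c\<close> grows, \<open>x\<close> approaches \<open>f\<close> in M1. Between two
  large jumps of \<open>f\<close> the path oscillates little and \<open>x\<close> stays near it. After a jump at \<open>a\<close> the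
  relaxing path runs from \<open>f (a-)\<close> to \<open>f a\<close> along an exponential, that is, almost monotonically and
  within a short time. This is a continuous traversal of the vertical segment which the completed
  graph of \<open>f\<close> has at \<open>a\<close>, so with a suitable time change \<open>x\<close> follows a parametric representation
  of \<open>f\<close> (\<open>tracks_jump\<close>, \<open>dist_M1_relaxes_le\<close>). There is no such convergence in the J1
  topology when \<open>f\<close> jumps, because J1 limits of continuous paths are continuous. At the
  end point \<open>T\<close> there is no time left to catch up, and one has to know that \<open>f\<close> does not jump there;
  this is what stochastic continuity of \<open>L\<close> provides (\<open>AE_left_continuous_at_end\<close>).

  To pass from paths to outer probabilities the bound must be uniform on large \<^emph>\<open>measurable\<close> sets:
  pointwise convergence of functions that need not be measurable would not suffice. The sets
  are those where the path of \<open>Z\<close> is bounded by \<open>K\<close>, makes no two successive moves larger than \<open>\<eta>\<close>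
  within a time window of length \<open>\<delta>\<close>, and is nearly constant for a time \<open>\<delta>\<close> at both ends
  (\<open>regular_path\<close>). By right-continuity this depends on countably many times only, so it is an
  event; its probability tends to one as \<open>\<delta> \<rightarrow> 0\<close> and \<open>K \<rightarrow> \<infinity>\<close> (\<open>regular_path_prob_limit\<close>); and on it the M1 distance is at most \<open>max (2 \<delta>) (20 \<eta>)\<close> once
  \<open>\<gamma>\<close> is large, for all coordinates at once since the rates \<open>lam k\<close> are bounded away from \<open>0\<close>.
\<close>

section \<open>Cadlag paths and their oscillation\<close>

lemma cadlag_right:
  assumes "cadlag_on T f" "0 \<le> t" "t < T"
  shows "(f \<longlongrightarrow> f t) (at_right t)"
  using assms by (auto simp: cadlag_on_def)

lemma cadlag_left_lim:
  assumes "cadlag_on T f" "0 < t" "t \<le> T"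
  shows "(f \<longlongrightarrow> left_lim f t) (at_left t)"
proof -
  have "t \<in> {0<..T}" using assms by auto
  with assms(1) obtain l where l: "(f \<longlongrightarrow> l) (at_left t)"
    unfolding cadlag_on_def by blast
  then have "Lim (at_left t) f = l"
    by (intro tendsto_Lim) auto
  with l assms show ?thesis by (simp add: left_lim_def)
qed

text \<open>Near a time \<open>t\<close> a cadlag path stays close to its left limit before \<open>t\<close> and close to \<open>f t\<close> from
  \<open>t\<close> on. Compactness of \<open>[0, T]\<close> turns this into all the uniform statements about cadlag paths below.
  At \<open>t = 0\<close> the value \<open>l\<close> is arbitrary.\<close>

lemma cadlag_locally_two_valued:
  fixes f :: "real \<Rightarrow> 'e::metric_space"
  assumes "cadlag_on T f" "t \<in> {0..T}" "\<eta> > 0"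
  shows "\<exists>d>0. \<exists>l. (\<forall>s\<in>{0..T}. t \<le> s \<and> s < t + d \<longrightarrow> dist (f s) (f t) < \<eta>) \<and>
    (\<forall>s\<in>{0..T}. t - d < s \<and> s < t \<longrightarrow> dist (f s) l < \<eta>)"
proof -
  have "\<exists>d>0. \<forall>s\<in>{0..T}. t \<le> s \<and> s < t + d \<longrightarrow> dist (f s) (f t) < \<eta>"
  proof (cases "t < T")
    case True
    then have "eventually (\<lambda>s. dist (f s) (f t) < \<eta>) (at_right t)"
      using cadlag_right[OF assms(1), of t] assms by (auto simp: tendsto_iff)
    then obtain b where b: "b > t" "\<And>s. t < s \<Longrightarrow> s < b \<Longrightarrow> dist (f s) (f t) < \<eta>"
      unfolding eventually_at_right_field by blast
    have "dist (f s) (f t) < \<eta>" if "t \<le> s" "s < t + (b - t)" for s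
      using b(2)[of s] that assms(3) by (cases "s = t") auto
    then show ?thesis using b(1) by (intro exI[of _ "b - t"]) auto
  next
    case False
    then show ?thesis using assms by (intro exI[of _ 1]) auto
  qed
  then obtain d1 where d1: "d1 > 0" "\<forall>s\<in>{0..T}. t \<le> s \<and> s < t + d1 \<longrightarrow> dist (f s) (f t) < \<eta>"
    by blast
  have "\<exists>d>0. \<exists>l. \<forall>s\<in>{0..T}. t - d < s \<and> s < t \<longrightarrow> dist (f s) l < \<eta>"
  proof (cases "t > 0")
    case True
    with assms(2) have "t \<in> {0<..T}" by auto
    with assms(1) obtain l where "(f \<longlongrightarrow> l) (at_left t)"
      unfolding cadlag_on_def by blast
    then have "eventually (\<lambda>s. dist (f s) l < \<eta>) (at_left t)"
      using assms by (auto simp: tendsto_iff)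
    then obtain b where b: "b < t" "\<And>s. b < s \<Longrightarrow> s < t \<Longrightarrow> dist (f s) l < \<eta>"
      unfolding eventually_at_left_field by blast
    show ?thesis using b by (intro exI[of _ "t - b"]) auto
  next
    case False
    then show ?thesis using assms by (intro exI[of _ 1]) auto
  qed
  then obtain d2 l where d2: "d2 > 0" "\<forall>s\<in>{0..T}. t - d2 < s \<and> s < t \<longrightarrow> dist (f s) l < \<eta>"
    by blast
  show ?thesis using d1 d2 by (intro exI[of _ "min d1 d2"] conjI exI[of _ l]) auto
qed

lemma cadlag_finite_cover:
  fixes f :: "real \<Rightarrow> 'e::metric_space"
  assumes "cadlag_on T f" "\<eta> > 0"
  shows "\<exists>A d l. finite A \<and> {0..T} \<subseteq> (\<Union>a\<in>A. ball a (d a)) \<and>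
    (\<forall>a\<in>A. \<forall>s\<in>{0..T}. a \<le> s \<longrightarrow> s < a + d a \<longrightarrow> dist (f s) (f a) < \<eta>) \<and>
    (\<forall>a\<in>A. \<forall>s\<in>{0..T}. a - d a < s \<longrightarrow> s < a \<longrightarrow> dist (f s) (l a) < \<eta>)"
proof -
  have "\<forall>t\<in>{0..T}. \<exists>d l. d>0 \<and> (\<forall>s\<in>{0..T}. t \<le> s \<and> s < t + d \<longrightarrow> dist (f s) (f t) < \<eta>) \<and>
    (\<forall>s\<in>{0..T}. t - d < s \<and> s < t \<longrightarrow> dist (f s) l < \<eta>)"
    using cadlag_locally_two_valued[OF assms(1) _ assms(2)] by blast
  then obtain d l where dl: "\<And>t. t \<in> {0..T} \<Longrightarrow> d t > 0"
    "\<And>t s. t \<in> {0..T} \<Longrightarrow> s \<in> {0..T} \<Longrightarrow> t \<le> s \<Longrightarrow> s < t + d t \<Longrightarrow> dist (f s) (f t) < \<eta>"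
    "\<And>t s. t \<in> {0..T} \<Longrightarrow> s \<in> {0..T} \<Longrightarrow> t - d t < s \<Longrightarrow> s < t \<Longrightarrow> dist (f s) (l t) < \<eta>"
    by metis
  have "{0..T} \<subseteq> (\<Union>t\<in>{0..T}. ball t (d t))"
    using dl(1) by (meson UN_I centre_in_ball subsetI)
  then obtain A where A: "A \<subseteq> {0..T}" "finite A" "{0..T} \<subseteq> (\<Union>a\<in>A. ball a (d a))"
    by (rule compactE_image[OF compact_Icc, rotated 1]) auto
  have "\<forall>a\<in>A. \<forall>s\<in>{0..T}. a \<le> s \<longrightarrow> s < a + d a \<longrightarrow> dist (f s) (f a) < \<eta>"
    using dl(2) A(1) by blast
  moreover have "\<forall>a\<in>A. \<forall>s\<in>{0..T}. a - d a < s \<longrightarrow> s < a \<longrightarrow> dist (f s) (l a) < \<eta>"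
    using dl(3) A(1) by blast
  ultimately show ?thesis using A(2,3) by blast
qed

lemma cadlag_bounded:
  fixes f :: "real \<Rightarrow> 'e::real_normed_vector"
  assumes "cadlag_on T f"
  shows "\<exists>K. \<forall>s\<in>{0..T}. norm (f s) \<le> K"
proof -
  obtain A d l where A: "finite A" "{0..T} \<subseteq> (\<Union>a\<in>A. ball a (d a))"
    "\<forall>a\<in>A. \<forall>s\<in>{0..T}. a \<le> s \<longrightarrow> s < a + d a \<longrightarrow> dist (f s) (f a) < 1"
    "\<forall>a\<in>A. \<forall>s\<in>{0..T}. a - d a < s \<longrightarrow> s < a \<longrightarrow> dist (f s) (l a) < 1"
    using cadlag_finite_cover[OF assms zero_less_one] by (elim exE conjE)
  let ?h = "\<lambda>a. norm (f a) + norm (l a) + 1"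
  have "norm (f s) \<le> (\<Sum>a\<in>A. ?h a)" if s: "s \<in> {0..T}" for s
  proof -
    obtain a where a: "a \<in> A" "dist a s < d a" using A(2) s by auto
    have "norm (f s) \<le> ?h a"
    proof (cases "a \<le> s")
      case True
      then have "dist (f s) (f a) < 1" using bspec[OF bspec[OF A(3) a(1)] s] a by (auto simp: dist_real_def)
      then show ?thesis using norm_triangle_sub[of "f s" "f a"]
        by (smt (verit) dist_norm norm_ge_zero)
    next
      case False
      then have "dist (f s) (l a) < 1" using bspec[OF bspec[OF A(4) a(1)] s] a by (auto simp: dist_real_def)
      then show ?thesis using norm_triangle_sub[of "f s" "l a"]
        by (smt (verit) dist_norm norm_ge_zero)
    qed
    also have "\<dots> \<le> (\<Sum>a\<in>A. ?h a)"
      using A(1) a by (intro member_le_sum) auto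
    finally show ?thesis .
  qed
  then show ?thesis by blast
qed

text \<open>A jump larger than \<open>2 \<eta>\<close> can only sit at one of the finitely many centres of a cover by
  intervals on which the path is two-valued up to \<open>\<eta>\<close>.\<close>

lemma cadlag_countable_jumps:
  fixes f :: "real \<Rightarrow> real"
  assumes "cadlag_on T f"
  shows "countable {t\<in>{0<..T}. left_lim f t \<noteq> f t}"
proof -
  have fin: "finite {t\<in>{0<..T}. \<bar>left_lim f t - f t\<bar> > inverse (Suc n)}" for n
  proof -
    define \<eta> where "\<eta> = inverse (real (Suc n)) / 2"
    have \<eta>: "\<eta> > 0" by (simp add: \<eta>_def)
    obtain A d l where A: "finite A" "{0..T} \<subseteq> (\<Union>a\<in>A. ball a (d a))"
      "\<forall>a\<in>A. \<forall>s\<in>{0..T}. a \<le> s \<longrightarrow> s < a + d a \<longrightarrow> dist (f s) (f a) < \<eta>"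
      "\<forall>a\<in>A. \<forall>s\<in>{0..T}. a - d a < s \<longrightarrow> s < a \<longrightarrow> dist (f s) (l a) < \<eta>"
      using cadlag_finite_cover[OF assms \<eta>] by (elim exE conjE)
    have "t \<in> A" if t: "t \<in> {0<..T}" "\<bar>left_lim f t - f t\<bar> > inverse (Suc n)" for t
    proof (rule ccontr)
      assume "t \<notin> A"
      obtain a where a: "a \<in> A" "dist a t < d a" using subsetD[OF A(2), of t] t by auto
      with \<open>t \<notin> A\<close> have "a \<noteq> t" by auto
      have "\<exists>m. \<bar>f t - m\<bar> \<le> \<eta> \<and> eventually (\<lambda>s. \<bar>f s - m\<bar> \<le> \<eta>) (at_left t)"
      proof (cases "a < t")
        case True
        have "\<bar>f s - f a\<bar> \<le> \<eta>" if "max 0 a < s" "s \<le> t" for s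
          using bspec[OF A(3) a(1)] that a t True by (auto simp: dist_real_def intro: less_imp_le)
        moreover have "max 0 a < t" using True t by auto
        ultimately show ?thesis
          unfolding eventually_at_left_field
          by (intro exI[of _ "f a"] conjI exI[of _ "max 0 a"]) auto
      next
        case False
        have "\<bar>f s - l a\<bar> \<le> \<eta>" if "max 0 (a - d a) < s" "s \<le> t" for s
          using bspec[OF A(4) a(1)] that a t False \<open>a \<noteq> t\<close> by (auto simp: dist_real_def)
        moreover have "max 0 (a - d a) < t" using a t by (auto simp: dist_real_def)
        ultimately show ?thesis
          unfolding eventually_at_left_field
          by (intro exI[of _ "l a"] conjI exI[of _ "max 0 (a - d a)"]) auto
      qed
      then obtain m where m: "\<bar>f t - m\<bar> \<le> \<eta>" "eventually (\<lambda>s. \<bar>f s - m\<bar> \<le> \<eta>) (at_left t)"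
        by blast
      have "((\<lambda>s. \<bar>f s - m\<bar>) \<longlongrightarrow> \<bar>left_lim f t - m\<bar>) (at_left t)"
        using cadlag_left_lim[OF assms, of t] t by (intro tendsto_intros) auto
      then have "\<bar>left_lim f t - m\<bar> \<le> \<eta>"
        by (rule tendsto_upperbound) (use m in auto)
      then have "\<bar>left_lim f t - f t\<bar> \<le> 2 * \<eta>" using m(1) by linarith
      with t(2) show False by (simp add: \<eta>_def)
    qed
    then show ?thesis using A(1) by (auto intro: finite_subset)
  qed
  have "{t\<in>{0<..T}. left_lim f t \<noteq> f t} \<subseteq>
      (\<Union>n. {t\<in>{0<..T}. \<bar>left_lim f t - f t\<bar> > inverse (Suc n)})"
  proof
    fix t assume t: "t \<in> {t\<in>{0<..T}. left_lim f t \<noteq> f t}"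
    then have "\<bar>left_lim f t - f t\<bar> > 0" by auto
    then show "t \<in> (\<Union>n. {t\<in>{0<..T}. \<bar>left_lim f t - f t\<bar> > inverse (Suc n)})"
      using t reals_Archimedean by blast
  qed
  then show ?thesis
    by (rule countable_subset) (rule countable_UN, simp, rule countable_finite, rule fin)
qed

text \<open>The last clause says that Skorokhod's modulus \<open>w''\<close> at \<open>\<delta>\<close> is at most \<open>\<eta>\<close>: of two
  successive moves within a window shorter than \<open>\<delta>\<close>, at most one is larger than \<open>\<eta>\<close>. It does not
  see a single jump next to \<open>0\<close> or \<open>T\<close>, which the two clauses before it exclude. The modulus is phrased with triples of times rather
  than with partitions because this form is determined by the values on a countable dense set.\<close>

definition regular_path ::
  "real \<Rightarrow> real \<Rightarrow> real \<Rightarrow> real \<Rightarrow> (real \<Rightarrow> 'e::real_normed_vector) \<Rightarrow> bool" where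
  "regular_path T \<delta> \<eta> K f \<longleftrightarrow>
     (\<forall>s\<in>{0..T}. norm (f s) \<le> K) \<and>
     (\<forall>s\<in>{0..T}. s < \<delta> \<longrightarrow> norm (f s - f 0) \<le> \<eta>) \<and>
     (\<forall>s\<in>{0..T}. T - \<delta> < s \<longrightarrow> norm (f s - f T) \<le> \<eta>) \<and>
     (\<forall>r\<in>{0..T}. \<forall>s\<in>{0..T}. \<forall>t\<in>{0..T}. r < s \<and> s < t \<and> t < r + \<delta> \<longrightarrow>
        norm (f s - f r) \<le> \<eta> \<or> norm (f t - f s) \<le> \<eta>)"

lemma regular_pathD:
  assumes "regular_path T \<delta> \<eta> K f"
  shows "s \<in> {0..T} \<Longrightarrow> norm (f s) \<le> K"
    and "s \<in> {0..T} \<Longrightarrow> s < \<delta> \<Longrightarrow> norm (f s - f 0) \<le> \<eta>"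
    and "s \<in> {0..T} \<Longrightarrow> T - \<delta> < s \<Longrightarrow> norm (f s - f T) \<le> \<eta>"
    and "r \<in> {0..T} \<Longrightarrow> s \<in> {0..T} \<Longrightarrow> t \<in> {0..T} \<Longrightarrow> r < s \<Longrightarrow> s < t \<Longrightarrow> t < r + \<delta> \<Longrightarrow>
       norm (f s - f r) \<le> \<eta> \<or> norm (f t - f s) \<le> \<eta>"
  using assms unfolding regular_path_def by blast+

lemma regular_path_mono:
  assumes "regular_path T \<delta> \<eta> K f" "\<delta>' \<le> \<delta>" "K \<le> K'"
  shows "regular_path T \<delta>' \<eta> K' f"
proof -
  have "norm (f s) \<le> K'" if "s \<in> {0..T}" for s
    using regular_pathD(1)[OF assms(1) that] assms(3) by linarith
  moreover have "norm (f s - f 0) \<le> \<eta>" if "s \<in> {0..T}" "s < \<delta>'" for s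
    using regular_pathD(2)[OF assms(1)] assms(2) that by auto
  moreover have "norm (f s - f T) \<le> \<eta>" if "s \<in> {0..T}" "T - \<delta>' < s" for s
    using regular_pathD(3)[OF assms(1)] assms(2) that by auto
  moreover have "norm (f s - f r) \<le> \<eta> \<or> norm (f t - f s) \<le> \<eta>"
    if "r \<in> {0..T}" "s \<in> {0..T}" "t \<in> {0..T}" "r < s \<and> s < t \<and> t < r + \<delta>'" for r s t
    by (rule regular_pathD(4)[OF assms(1)]) (use assms(2) that in auto)
  ultimately show ?thesis unfolding regular_path_def by blast
qed

text \<open>By a Lebesgue number argument: if \<open>\<delta>\<close> is small, any three times within \<open>\<delta>\<close> lie in one interval on
  which the path is two-valued up to \<open>\<eta> / 2\<close>, and then the middle time shares its value with one of
  the other two. The clause at the right end is where the absence of a jump at \<open>T\<close> enters.\<close>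

lemma cadlag_imp_regular:
  fixes f :: "real \<Rightarrow> 'e::real_normed_vector"
  assumes "cadlag_on T f" "T > 0" "\<eta> > 0" and cT: "(f \<longlongrightarrow> f T) (at_left T)"
  shows "\<exists>\<delta>>0. \<exists>K. regular_path T \<delta> \<eta> K f"
proof -
  obtain K where K: "\<forall>s\<in>{0..T}. norm (f s) \<le> K" using cadlag_bounded[OF assms(1)] by blast
  obtain A d l where A: "{0..T} \<subseteq> (\<Union>a\<in>A. ball a (d a))"
    "\<forall>a\<in>A. \<forall>s\<in>{0..T}. a \<le> s \<longrightarrow> s < a + d a \<longrightarrow> dist (f s) (f a) < \<eta> / 2"
    "\<forall>a\<in>A. \<forall>s\<in>{0..T}. a - d a < s \<longrightarrow> s < a \<longrightarrow> dist (f s) (l a) < \<eta> / 2"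
    using cadlag_finite_cover[OF assms(1) half_gt_zero[OF assms(3)]] by (elim exE conjE)
  have "\<exists>e>0. \<forall>x\<in>{0..T}. \<exists>b\<in>(\<lambda>a. ball a (d a)) ` A. ball x e \<subseteq> b"
    by (rule Heine_Borel_lemma[OF compact_Icc A(1)]) auto
  then obtain d1 where d1: "d1 > 0" "\<And>x. x \<in> {0..T} \<Longrightarrow> \<exists>a\<in>A. ball x d1 \<subseteq> ball a (d a)"
    by blast
  have triple: "norm (f s - f r) \<le> \<eta> \<or> norm (f t - f s) \<le> \<eta>"
    if rst: "r \<in> {0..T}" "s \<in> {0..T}" "t \<in> {0..T}" "r < s" "s < t" "t < r + d1" for r s t
  proof -
    obtain a where a: "a \<in> A" "ball s d1 \<subseteq> ball a (d a)" using d1(2)[OF rst(2)] by blast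
    have "r \<in> ball s d1" "s \<in> ball s d1" "t \<in> ball s d1"
      using rst by (auto simp: dist_real_def)
    with a(2) have "r \<in> ball a (d a)" "s \<in> ball a (d a)" "t \<in> ball a (d a)" by blast+
    then have near: "a - d a < r" "t < a + d a" by (auto simp: dist_real_def)
    show ?thesis
    proof (cases "s < a")
      case True
      have "dist (f s) (l a) < \<eta> / 2" "dist (f r) (l a) < \<eta> / 2"
        using bspec[OF A(3) a(1)] rst near True by auto
      then have "dist (f s) (f r) < \<eta>" by (rule dist_triangle_half_l)
      then show ?thesis by (auto simp: dist_norm)
    next
      case False
      have "dist (f t) (f a) < \<eta> / 2" "dist (f s) (f a) < \<eta> / 2"
        using bspec[OF A(2) a(1)] rst near False by auto
      then have "dist (f t) (f s) < \<eta>" by (rule dist_triangle_half_l)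
      then show ?thesis by (auto simp: dist_norm)
    qed
  qed
  have "eventually (\<lambda>s. dist (f s) (f T) < \<eta>) (at_left T)"
    using cT \<open>\<eta> > 0\<close> by (auto simp: tendsto_iff)
  then obtain b where b: "b < T" "\<And>s. b < s \<Longrightarrow> s < T \<Longrightarrow> dist (f s) (f T) < \<eta>"
    unfolding eventually_at_left_field by blast
  have rT: "norm (f s - f T) \<le> \<eta>" if "T - (T - b) < s" "s \<le> T" for s
    using b(2)[of s] that \<open>\<eta> > 0\<close> by (cases "s = T") (auto simp: dist_norm)
  obtain d0 where d0: "d0 > 0" "\<forall>s\<in>{0..T}. 0 \<le> s \<and> s < 0 + d0 \<longrightarrow> dist (f s) (f 0) < \<eta>"
    using cadlag_locally_two_valued[OF assms(1), of 0 \<eta>] assms by auto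
  define \<delta> where "\<delta> = min d0 (min d1 (T - b))"
  have "\<delta> > 0" using d0 d1 b by (simp add: \<delta>_def)
  moreover have "regular_path T \<delta> \<eta> K f"
    unfolding regular_path_def
  proof (intro conjI ballI impI)
    fix s assume "s \<in> {0..T}" "s < \<delta>"
    then show "norm (f s - f 0) \<le> \<eta>" using d0 by (auto simp: \<delta>_def dist_norm intro: less_imp_le)
  next
    fix s assume "s \<in> {0..T}" "T - \<delta> < s"
    then show "norm (f s - f T) \<le> \<eta>" using rT by (auto simp: \<delta>_def)
  next
    fix r s t assume "r \<in> {0..T}" "s \<in> {0..T}" "t \<in> {0..T}" "r < s \<and> s < t \<and> t < r + \<delta>"
    then show "norm (f s - f r) \<le> \<eta> \<or> norm (f t - f s) \<le> \<eta>"
      using triple[of r s t] by (auto simp: \<delta>_def)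
  qed (use K in auto)
  ultimately show ?thesis by blast
qed

text \<open>A regular path admits a partition of \<open>[0, T]\<close> with gaps between \<open>\<delta> / 3\<close> and \<open>2 \<delta>\<close> on whose half-open
  cells it varies by at most \<open>4 \<eta>\<close>. The partition is presented as an induction principle: what holds at
  \<open>0\<close> and is inherited along each cell holds at \<open>T\<close>. The next partition point is the first time after
  \<open>a + \<delta> / 3\<close> (within another \<open>\<delta> / 3\<close>) at which the path moves away from its value at \<open>a + \<delta> / 3\<close> by more than \<open>\<eta>\<close>, or \<open>a + \<delta> / 3\<close> if
  there is none. Having moved once, the path is quiet for the next \<open>\<delta> / 3\<close>, which keeps the gaps large.\<close>

lemma regular_path_chain:
  fixes f :: "real \<Rightarrow> 'e::real_normed_vector"
  assumes cad: "cadlag_on T f" and reg: "regular_path T \<delta> \<eta> K f" and \<delta>: "0 < \<delta>" "\<delta> \<le> T" and "\<eta> \<ge> 0"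
    and start: "Q 0"
    and step: "\<And>a \<tau>. Q a \<Longrightarrow> 0 \<le> a \<Longrightarrow> a + \<delta> / 3 \<le> \<tau> \<Longrightarrow> \<tau> \<le> T \<Longrightarrow> \<tau> \<le> a + 2 * \<delta> \<Longrightarrow>
       (\<forall>s\<in>{a..<\<tau>}. norm (f s - f a) \<le> 4 * \<eta>) \<Longrightarrow> Q \<tau>"
  shows "Q T"
proof -
  have main: "Q T" if "0 \<le> a" "a \<le> T - \<delta>" "Q a" "\<forall>s\<in>{a..a + \<delta> / 3}. norm (f s - f a) \<le> \<eta>"
    "T - a \<le> real n * (\<delta> / 3)" for a n
    using that
  proof (induction n arbitrary: a)
    case 0
    then show ?case using \<delta> by auto
  next
    case (Suc n)
    define b where "b = a + \<delta> / 3"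
    have b: "0 \<le> b" "b + \<delta> / 3 \<le> T" "b \<le> T" using Suc.prems \<delta> by (auto simp: b_def)
    have fb: "norm (f b - f a) \<le> \<eta>" using Suc.prems \<delta> by (auto simp: b_def)
    have "\<exists>\<tau>. b \<le> \<tau> \<and> \<tau> \<le> b + \<delta> / 3 \<and> (\<forall>s\<in>{b..<\<tau>}. norm (f s - f b) \<le> \<eta>) \<and>
       (\<forall>s\<in>{0..T}. \<tau> \<le> s \<and> s \<le> \<tau> + \<delta> / 3 \<longrightarrow> norm (f s - f \<tau>) \<le> \<eta>)"
    proof (cases "\<forall>s\<in>{b..b + \<delta> / 3}. norm (f s - f b) \<le> \<eta>")
      case True
      then show ?thesis using \<delta> by (intro exI[of _ b]) auto
    next
      case False
      define B where "B = {s\<in>{b..b + \<delta> / 3}. norm (f s - f b) > \<eta>}"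
      have "B \<noteq> {}" using False unfolding B_def by force
      moreover have "bdd_below B" by (auto simp: B_def)
      ultimately have B: "B \<noteq> {}" "bdd_below B" by auto
      define \<tau> where "\<tau> = Inf B"
      have "b \<le> \<tau>" unfolding \<tau>_def using B by (intro cInf_greatest) (auto simp: B_def)
      obtain s0 where s0: "s0 \<in> B" using B by auto
      have "\<tau> \<le> s0" unfolding \<tau>_def using B s0 by (intro cInf_lower)
      then have \<tau>2: "\<tau> \<le> b + \<delta> / 3" using s0 by (auto simp: B_def)
      have pre: "norm (f s - f b) \<le> \<eta>" if "b \<le> s" "s < \<tau>" for s
      proof (rule ccontr)
        assume "\<not> ?thesis"
        then have "s \<in> B" using that \<tau>2 by (auto simp: B_def)
        then have "\<tau> \<le> s" unfolding \<tau>_def using B by (intro cInf_lower)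
        with that show False by auto
      qed
      have post: "norm (f s - f \<tau>) \<le> \<eta>" if s: "s \<in> {0..T}" "\<tau> \<le> s" "s \<le> \<tau> + \<delta> / 3" for s
      proof (rule ccontr)
        assume neg: "\<not> ?thesis"
        then have "\<tau> < s" using s \<open>\<eta> \<ge> 0\<close> by (cases "s = \<tau>") auto
        then have "\<tau> < T" using s by auto
        \<comment> \<open>Right-continuity gives a time \<open>r \<ge> \<tau>\<close> whose value is more than \<open>\<eta>\<close> away both from the
          value at \<open>b\<close> and from the value at \<open>s\<close>: two large moves in a short window.\<close>
        have "((\<lambda>r. norm (f s - f r)) \<longlongrightarrow> norm (f s - f \<tau>)) (at_right \<tau>)"
          using cadlag_right[OF cad, of \<tau>] \<open>\<tau> < T\<close> \<open>b \<le> \<tau>\<close> b by (intro tendsto_intros) auto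
        then have "eventually (\<lambda>r. norm (f s - f r) > \<eta>) (at_right \<tau>)"
          using neg by (intro order_tendstoD) auto
        then obtain z where z: "z > \<tau>" "\<And>r. \<tau> < r \<Longrightarrow> r < z \<Longrightarrow> norm (f s - f r) > \<eta>"
          unfolding eventually_at_right_field by blast
        have "Inf B < min z s" using z \<open>\<tau> < s\<close> by (simp add: \<tau>_def)
        then obtain r where r: "r \<in> B" "r < min z s" using B cInf_lessD by blast
        have "\<tau> \<le> r" unfolding \<tau>_def using B r by (intro cInf_lower)
        have far: "norm (f s - f r) > \<eta>"
          using z(2)[of r] r neg \<open>\<tau> \<le> r\<close> by (cases "r = \<tau>") auto
        have "b < r" using r \<open>\<eta> \<ge> 0\<close> by (cases "r = b") (auto simp: B_def)
        moreover have "s < b + \<delta>" using s \<tau>2 \<delta> by auto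
        moreover have "b \<in> {0..T}" "r \<in> {0..T}" using b r s \<open>b < r\<close> by auto
        ultimately have "norm (f r - f b) \<le> \<eta> \<or> norm (f s - f r) \<le> \<eta>"
          using regular_pathD(4)[OF reg, of b r s] s r by auto
        then show False using far r by (auto simp: B_def)
      qed
      show ?thesis using \<open>b \<le> \<tau>\<close> \<tau>2 pre post by (intro exI[of _ \<tau>]) auto
    qed
    then obtain \<tau> where \<tau>: "b \<le> \<tau>" "\<tau> \<le> b + \<delta> / 3"
      "\<forall>s\<in>{b..<\<tau>}. norm (f s - f b) \<le> \<eta>"
      "\<forall>s\<in>{0..T}. \<tau> \<le> s \<and> s \<le> \<tau> + \<delta> / 3 \<longrightarrow> norm (f s - f \<tau>) \<le> \<eta>" by blast
    have osc: "norm (f s - f a) \<le> 2 * \<eta>" if "a \<le> s" "s < \<tau>" for s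
    proof (cases "s < b")
      case True
      then have "norm (f s - f a) \<le> \<eta>" using Suc.prems(4) that by (auto simp: b_def)
      then show ?thesis using \<open>\<eta> \<ge> 0\<close> by linarith
    next
      case False
      then have "norm (f s - f b) \<le> \<eta>" using \<tau>(3) that by auto
      then show ?thesis using fb norm_triangle_ineq[of "f s - f b" "f b - f a"] by auto
    qed
    have \<tau>T: "\<tau> \<le> T" using \<tau> b by auto
    show ?case
    proof (cases "\<tau> \<le> T - \<delta>")
      case True
      have "Q \<tau>"
      proof (rule step[OF Suc.prems(3,1)])
        show "\<forall>s\<in>{a..<\<tau>}. norm (f s - f a) \<le> 4 * \<eta>"
        proof
          fix s assume "s \<in> {a..<\<tau>}"
          then show "norm (f s - f a) \<le> 4 * \<eta>" using osc[of s] \<open>\<eta> \<ge> 0\<close> by auto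
        qed
      qed (use \<tau> \<tau>T \<delta> in \<open>auto simp: b_def\<close>)
      then show ?thesis
      proof (rule Suc.IH[rotated 2])
        show "\<forall>s\<in>{\<tau>..\<tau> + \<delta> / 3}. norm (f s - f \<tau>) \<le> \<eta>"
          using \<tau> True b \<delta> by auto
        show "T - \<tau> \<le> real n * (\<delta> / 3)"
          using Suc.prems(5) \<tau>(1) by (auto simp: b_def algebra_simps)
      qed (use True \<tau> b in auto)
    next
      case False
      \<comment> \<open>The remaining piece up to \<open>T\<close> may be too short for a cell of its own. It lies in the final window,
        where the path is close to \<open>f T\<close>, so it is merged into the current cell; \<open>s0\<close> is a time common to
        that window and to \<open>[a, \<tau>)\<close>.\<close>
      define s0 where "s0 = max a ((T - \<delta> + \<tau>) / 2)"
      have s0: "a \<le> s0" "s0 < \<tau>" "T - \<delta> < s0" "s0 \<in> {0..T}"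
        using False Suc.prems \<tau> \<tau>T \<delta> b by (auto simp: s0_def b_def max_def)
      have "norm (f s - f a) \<le> 4 * \<eta>" if s: "a \<le> s" "s < T" for s
      proof (cases "s < \<tau>")
        case True
        then show ?thesis using osc[of s] s \<open>\<eta> \<ge> 0\<close> by auto
      next
        case F2: False
        have "norm (f s - f T) \<le> \<eta>" "norm (f s0 - f T) \<le> \<eta>"
          using regular_pathD(3)[OF reg] s0 s False F2 Suc.prems(1) by auto
        moreover have "norm (f s0 - f a) \<le> 2 * \<eta>" using osc s0 by auto
        ultimately show ?thesis
          using norm_triangle_ineq[of "f s - f T" "f T - f a"]
            norm_triangle_ineq[of "f T - f s0" "f s0 - f a"] norm_minus_commute[of "f T" "f s0"]
          by auto
      qed
      then show ?thesis
        by (intro step[OF Suc.prems(3,1)]) (use \<tau> \<tau>T False \<delta> in \<open>auto simp: b_def\<close>)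
    qed
  qed
  obtain n where "T \<le> real n * (\<delta> / 3)"
    using \<delta> real_arch_simple[of "T / (\<delta> / 3)"] by (auto simp: field_simps)
  moreover have "\<forall>s\<in>{0..0 + \<delta> / 3}. norm (f s - f 0) \<le> \<eta>"
    using regular_pathD(2)[OF reg] \<delta> by auto
  ultimately show ?thesis using main[of 0 n] start \<delta> by auto
qed

section \<open>Existence of parametric representations\<close>

lemma left_lim_close:
  assumes "cadlag_on T f" "0 < t" "t \<le> T" "eventually (\<lambda>s. \<bar>f s - m\<bar> \<le> \<eta>) (at_left t)"
  shows "\<bar>left_lim f t - m\<bar> \<le> \<eta>"
proof (rule tendsto_upperbound)
  show "((\<lambda>s. \<bar>f s - m\<bar>) \<longlongrightarrow> \<bar>left_lim f t - m\<bar>) (at_left t)"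
    using cadlag_left_lim[OF assms(1-3)] by (intro tendsto_intros)
qed (use assms in auto)

lemma abs_convex_comb_le:
  fixes x y m :: real
  assumes "\<bar>x - m\<bar> \<le> \<eta>" "\<bar>y - m\<bar> \<le> \<eta>" "0 \<le> \<alpha>" "\<alpha> \<le> 1"
  shows "\<bar>\<alpha> * x + (1 - \<alpha>) * y - m\<bar> \<le> \<eta>"
proof -
  have "\<alpha> * x + (1 - \<alpha>) * y - m = \<alpha> * (x - m) + (1 - \<alpha>) * (y - m)"
    by (simp add: algebra_simps)
  also have "\<bar>\<dots>\<bar> \<le> \<alpha> * \<bar>x - m\<bar> + (1 - \<alpha>) * \<bar>y - m\<bar>"
    using assms by (intro order_trans[OF abs_triangle_ineq]) (simp add: abs_mult)
  also have "\<dots> \<le> \<alpha> * \<eta> + (1 - \<alpha>) * \<eta>"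
    using assms by (intro add_mono mult_left_mono) auto
  finally show ?thesis by (simp add: algebra_simps)
qed

lemma ext_graph_close:
  assumes "cadlag_on T f" "(s, v) \<in> ext_graph T f"
    and "\<bar>f s - m\<bar> \<le> \<eta>" and "\<bar>left_lim f s - m\<bar> \<le> \<eta>"
  shows "\<bar>v - m\<bar> \<le> \<eta>"
  using assms abs_convex_comb_le by (auto simp: ext_graph_def)

text \<open>The time change is the inverse of the strictly increasing function \<open>J t = t + (\<Sum>n. w n t)\<close>, which
  jumps by at least \<open>(1/2)^n\<close> at the \<open>n\<close>-th point of an enumeration of \<open>C\<close>; a jump of \<open>J\<close> is a flat piece of the inverse. The
  inverse is continuous because it is monotone and onto.\<close>

lemma exists_time_change_with_flats:
  fixes T :: real
  assumes "T > 0" "countable C"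
  shows "\<exists>r :: real \<Rightarrow> real. continuous_on {0..1} r \<and> mono_on {0..1} r \<and> r 0 = 0 \<and> r 1 = T \<and>
    (\<forall>t\<in>C \<inter> {0<..T}. \<exists>x\<in>{0..1}. \<exists>y\<in>{0..1}. x < y \<and> r x = t \<and> r y = t)"
proof -
  define w where "w = (\<lambda>n t. (1/2)^n * indicator {from_nat_into (insert 0 C) n..} t :: real)"
  define J where "J = (\<lambda>t. t + (\<Sum>n. w n t))"
  have sm: "summable (\<lambda>n. w n t)" for t
    by (rule summable_comparison_test'[where g = "\<lambda>n. (1/2)^n" and N = 0])
       (auto simp: w_def indicator_def)
  have wmono: "w n s \<le> w n t" if "s \<le> t" for n s t
    using that by (auto simp: w_def indicator_def)
  have Jdiff: "J t - J s \<ge> (t - s) + (w n t - w n s)" if "s \<le> t" for s t n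
  proof -
    have "(\<Sum>k. w k t) - (\<Sum>k. w k s) = (\<Sum>k. w k t - w k s)"
      by (rule suminf_diff[OF sm sm])
    also have "\<dots> \<ge> sum (\<lambda>k. w k t - w k s) {n}"
      by (rule sum_le_suminf) (use sm wmono that in \<open>auto intro: summable_diff\<close>)
    finally show ?thesis by (simp add: J_def)
  qed
  have Jstrict: "J s < J t" if "s < t" for s t
    using Jdiff[of s t 0] wmono[of s t 0] that by auto
  have Jle: "J s \<le> J t \<longleftrightarrow> s \<le> t" for s t
    using Jstrict by (metis leD linorder_le_less_linear order_le_less)
  have wbd: "0 \<le> (\<Sum>n. w n t)" "(\<Sum>n. w n t) \<le> 2" for t
  proof -
    show "0 \<le> (\<Sum>n. w n t)" by (rule suminf_nonneg[OF sm]) (auto simp: w_def)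
    have "(\<Sum>n. w n t) \<le> (\<Sum>n. (1/2)^n)"
      by (rule suminf_le[OF _ sm]) (auto simp: w_def indicator_def)
    then show "(\<Sum>n. w n t) \<le> 2" by (simp add: suminf_geometric)
  qed
  define R where "R = (\<lambda>x. Sup {t. J t \<le> x})"
  have ne: "{t. J t \<le> x} \<noteq> {}" for x
    using wbd(2)[of "x - 2"] by (auto simp: J_def intro!: exI[of _ "x - 2"])
  have bd: "bdd_above {t. J t \<le> x}" for x
  proof (rule bdd_aboveI[of _ x])
    fix t assume "t \<in> {t. J t \<le> x}" then show "t \<le> x" using wbd(1)[of t] by (auto simp: J_def)
  qed
  have RJ: "R (J t) = t" for t
    unfolding R_def Jle by (rule cSup_eq_maximum) auto
  have Rmono: "R x \<le> R y" if "x \<le> y" for x y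
    unfolding R_def using that by (intro cSup_subset_mono ne bd) auto
  have "range R = UNIV" using RJ by (metis surjI)
  then have Rcont: "continuous_on UNIV R"
    by (intro continuous_onI_mono) (auto intro: Rmono)
  have flat: "\<exists>x. J 0 \<le> x \<and> x < J t \<and> R x = t" if t: "t \<in> C" "0 < t" for t
  proof -
    obtain n where n: "from_nat_into (insert 0 C) n = t"
      using from_nat_into_surj[of "insert 0 C" t] t assms(2) by auto
    have gap: "J s + (1/2)^n \<le> J t" if "s < t" for s
      using Jdiff[of s t n] that n by (auto simp: w_def)
    define x where "x = J t - (1/2)^n"
    have "s \<le> R x" if "s < t" for s
      unfolding R_def using gap[OF that] by (intro cSup_upper bd) (auto simp: x_def)
    then have "t \<le> R x" by (rule dense_le)
    moreover have "R x \<le> R (J t)" by (rule Rmono) (simp add: x_def)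
    moreover have "J 0 \<le> x" using gap[OF t(2)] by (simp add: x_def)
    ultimately show ?thesis by (intro exI[of _ x]) (auto simp: x_def RJ)
  qed
  define N where "N = J T - J 0"
  have N: "N > 0" using Jstrict[of 0 T] assms(1) by (simp add: N_def)
  define r where "r = (\<lambda>x. R (J 0 + x * N))"
  show ?thesis
  proof (intro exI[of _ r] conjI ballI)
    have "continuous_on {0..1} (\<lambda>x. J 0 + x * N)" by (intro continuous_intros)
    then show "continuous_on {0..1} r"
      unfolding r_def by (rule continuous_on_compose2[OF Rcont]) auto
    show "mono_on {0..1} r" using N by (auto simp: r_def mono_on_def intro!: Rmono)
    show "r 0 = 0" "r 1 = T" by (simp_all add: r_def RJ N_def)
    fix t assume "t \<in> C \<inter> {0<..T}"
    then have t: "t \<in> C" "0 < t" "t \<le> T" by auto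
    obtain x where x: "J 0 \<le> x" "x < J t" "R x = t" using flat[OF t(1,2)] by blast
    have "J t \<le> J T" using t by (simp add: Jle)
    define x' y' where "x' = (x - J 0) / N" and "y' = (J t - J 0) / N"
    have "x' \<in> {0..1}" "y' \<in> {0..1}" "x' < y'"
      using x \<open>J t \<le> J T\<close> N by (auto simp: x'_def y'_def N_def divide_simps)
    moreover have "r x' = t" "r y' = t" using N x by (auto simp: r_def x'_def y'_def RJ)
    ultimately show "\<exists>x\<in>{0..1}. \<exists>y\<in>{0..1}. x < y \<and> r x = t \<and> r y = t" by blast
  qed
qed

lemma fibre_interval:
  fixes r :: "real \<Rightarrow> real"
  assumes r: "continuous_on {0..1} r" "mono_on {0..1} r" "r 0 = 0" "r 1 = T" and t: "t \<in> {0..T}"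
  obtains \<beta> \<beta>' where "0 \<le> \<beta>" "\<beta> \<le> \<beta>'" "\<beta>' \<le> 1" "{x\<in>{0..1}. r x = t} = {\<beta>..\<beta>'}"
proof -
  let ?F = "{x\<in>{0..1}. r x = t}"
  have "\<exists>x. 0 \<le> x \<and> x \<le> 1 \<and> r x = t"
    using r t by (intro IVT') auto
  then have ne: "?F \<noteq> {}" by auto
  have "closed ?F"
    using continuous_closed_preimage[OF r(1) closed_real_atLeastAtMost closed_singleton[of t]]
    by (simp add: vimage_def Int_def)
  moreover have "bounded ?F" by (rule bounded_subset[of "{0..1}"]) auto
  ultimately have "compact ?F" by (simp add: compact_eq_bounded_closed)
  from compact_attains_inf[OF this ne] compact_attains_sup[OF this ne]
  obtain \<beta> \<beta>' where b0: "\<beta> \<in> ?F" "\<forall>x\<in>?F. \<beta> \<le> x" "\<beta>' \<in> ?F" "\<forall>x\<in>?F. x \<le> \<beta>'" by blast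
  then have b: "\<beta> \<in> ?F" "\<And>x. x \<in> ?F \<Longrightarrow> \<beta> \<le> x" "\<beta>' \<in> ?F" "\<And>x. x \<in> ?F \<Longrightarrow> x \<le> \<beta>'" by blast+
  have "{x\<in>{0..1}. r x = t} = {\<beta>..\<beta>'}"
  proof
    show "{\<beta>..\<beta>'} \<subseteq> ?F"
    proof
      fix x assume x: "x \<in> {\<beta>..\<beta>'}"
      with b have x01: "x \<in> {0..1}" by auto
      have "r \<beta> \<le> r x" "r x \<le> r \<beta>'"
        using b x x01 mono_onD[OF r(2), of \<beta> x] mono_onD[OF r(2), of x \<beta>'] by auto
      then show "x \<in> ?F" using b x01 by auto
    qed
  qed (use b in auto)
  moreover have "\<beta> \<le> \<beta>'" by (rule b(2)[OF b(3)])
  moreover have "0 \<le> \<beta>" "\<beta>' \<le> 1" using b(1,3) by auto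
  ultimately show ?thesis by (intro that)
qed



text \<open>The time component rests on a nondegenerate interval at every jump time of \<open>f\<close>; on that interval the
  space component moves linearly from the left limit to the value.\<close>

lemma param_reps_nonempty:
  assumes cad: "cadlag_on T f" and T: "T > 0"
  shows "\<exists>p. p \<in> param_reps T f"
proof -
  define C where "C = {t\<in>{0<..T}. left_lim f t \<noteq> f t}"
  have "countable C" unfolding C_def by (rule cadlag_countable_jumps[OF cad])
  from exists_time_change_with_flats[OF T this] obtain r :: "real \<Rightarrow> real"
    where r: "continuous_on {0..1} r" "mono_on {0..1} r" "r 0 = 0" "r 1 = T"
      and flat: "\<forall>t\<in>C \<inter> {0<..T}. \<exists>x\<in>{0..1}. \<exists>y\<in>{0..1}. x < y \<and> r x = t \<and> r y = t"
    by blast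
  have r01: "r x \<in> {0..T}" if "x \<in> {0..1}" for x
    using mono_onD[OF r(2), of 0 x] mono_onD[OF r(2), of x 1] r(3,4) that by auto
  have "\<forall>t\<in>{0..T}. \<exists>\<beta> \<beta>'. 0 \<le> \<beta> \<and> \<beta> \<le> \<beta>' \<and> \<beta>' \<le> 1 \<and> {x\<in>{0..1}. r x = t} = {\<beta>..\<beta>'}"
  proof
    fix t assume "t \<in> {0..T}"
    then obtain \<beta> \<beta>' where "0 \<le> \<beta>" "\<beta> \<le> \<beta>'" "\<beta>' \<le> 1" "{x\<in>{0..1}. r x = t} = {\<beta>..\<beta>'}"
      by (rule fibre_interval[OF r])
    then show "\<exists>\<beta> \<beta>'. 0 \<le> \<beta> \<and> \<beta> \<le> \<beta>' \<and> \<beta>' \<le> 1 \<and> {x\<in>{0..1}. r x = t} = {\<beta>..\<beta>'}"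
      by blast
  qed
  then obtain b b' where bb: "\<forall>t\<in>{0..T}. 0 \<le> b t \<and> b t \<le> b' t \<and> b' t \<le> 1 \<and>
      {x\<in>{0..1}. r x = t} = {b t..b' t}"
    unfolding bchoice_iff by blast
  have b: "0 \<le> b t" "b t \<le> b' t" "b' t \<le> 1" "{x\<in>{0..1}. r x = t} = {b t..b' t}"
    if "t \<in> {0..T}" for t
    using bb that by blast+
  have mem: "x \<in> {0..1} \<and> r x = t \<longleftrightarrow> b t \<le> x \<and> x \<le> b' t" if "t \<in> {0..T}" for x t
    using eqset_imp_iff[OF b(4)[OF that], of x] by simp
  have fib: "b (r x) \<le> x" "x \<le> b' (r x)" if "x \<in> {0..1}" for x
    using mem[OF r01[OF that], of x] that by simp_all
  have rb: "r x = t \<and> x \<in> {0..1}" if "t \<in> {0..T}" "b t \<le> x" "x \<le> b' t" for x t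
    using mem[OF that(1), of x] that(2,3) by blast
  have nojump: "left_lim f t = f t" if "t \<in> {0..T}" "b t = b' t" for t
  proof (rule ccontr)
    assume neg: "left_lim f t \<noteq> f t"
    then have "t \<noteq> 0" by (auto simp: left_lim_def)
    then have "t \<in> C \<inter> {0<..T}" using neg that by (auto simp: C_def)
    then obtain x y where xy: "x \<in> {0..1}" "y \<in> {0..1}" "x < y" "r x = t" "r y = t"
      using flat by blast
    have "b t \<le> x" "y \<le> b' t" using fib(1)[OF xy(1)] fib(2)[OF xy(2)] xy(4,5) by simp_all
    then show False using xy(3) that(2) by simp
  qed
  define \<theta> where "\<theta> = (\<lambda>x. (x - b (r x)) / (b' (r x) - b (r x)))"
  have \<theta>01: "0 \<le> \<theta> x" "\<theta> x \<le> 1" if "x \<in> {0..1}" for x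
    using fib[OF that] by (auto simp: \<theta>_def divide_simps)
  define u where "u = (\<lambda>x. left_lim f (r x) + \<theta> x * (f (r x) - left_lim f (r x)))"
  have u_conv: "u x = (1 - \<theta> x) * left_lim f (r x) + (1 - (1 - \<theta> x)) * f (r x)" for x
    by (simp add: u_def algebra_simps)
  have u_end: "u (b' t) = f t" "u (b t) = left_lim f t" if "t \<in> {0..T}" for t
  proof -
    have "r (b' t) = t" "r (b t) = t" using rb[OF that, of "b' t"] rb[OF that, of "b t"] b(2)[OF that] by simp_all
    then show "u (b' t) = f t" "u (b t) = left_lim f t"
      using nojump[OF that] by (cases "b t = b' t"; simp add: u_def \<theta>_def)+
  qed
  have u_near: "\<bar>u x - m\<bar> \<le> \<eta>" if "x \<in> {0..1}" "\<bar>f (r x) - m\<bar> \<le> \<eta>" "\<bar>left_lim f (r x) - m\<bar> \<le> \<eta>" for x m \<eta>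
    unfolding u_conv using \<theta>01[OF that(1)] that by (intro abs_convex_comb_le) auto
  \<comment> \<open>Within a fibre \<open>u\<close> is affine; this settles continuity from the side on which the fibre extends.\<close>
  have u_aff: "\<exists>k. \<forall>x\<in>{b t..b' t}. u x = left_lim f t + (x - b t) * k" if "t \<in> {0..T}" for t
  proof (intro exI[of _ "(f t - left_lim f t) / (b' t - b t)"] ballI)
    fix x assume "x \<in> {b t..b' t}"
    then have "r x = t" using rb[OF that] by simp
    then show "u x = left_lim f t + (x - b t) * ((f t - left_lim f t) / (b' t - b t))"
      by (simp add: u_def \<theta>_def)
  qed
  have u_right: "eventually (\<lambda>y. dist (u y) (u x) < \<epsilon>) (at x within {x..1})"
    if x: "x \<in> {0..1}" and \<epsilon>: "\<epsilon> > 0" for x \<epsilon>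
  proof -
    define t where "t = r x"
    have t: "t \<in> {0..T}" using r01[OF x] by (simp add: t_def)
    show ?thesis
    proof (cases "x < b' t")
      case True
      obtain k where k: "\<And>y. y \<in> {b t..b' t} \<Longrightarrow> u y = left_lim f t + (y - b t) * k"
        using u_aff[OF t] by blast
      have "((\<lambda>y. left_lim f t + (y - b t) * k) \<longlongrightarrow> left_lim f t + (x - b t) * k) (at x within {x..1})"
        by (intro tendsto_intros)
      then have "eventually (\<lambda>y. dist (left_lim f t + (y - b t) * k) (left_lim f t + (x - b t) * k) < \<epsilon>) (at x within {x..1})"
        using \<epsilon> by (rule tendstoD)
      moreover have "eventually (\<lambda>y. y \<in> {..<b' t}) (at x within {x..1})"
        using True by (auto simp: eventually_at_topological intro!: exI[of _ "{..<b' t}"])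
      moreover have "eventually (\<lambda>y. y \<in> {x..1}) (at x within {x..1})"
        by (auto simp: eventually_at_filter)
      ultimately show ?thesis
      proof eventually_elim
        case (elim y)
        have "b t \<le> x" "b t \<le> y" using fib[OF x] elim by (auto simp: t_def)
        then show ?case using elim True k[of x] k[of y] by auto
      qed
    next
      case False
      then have xb: "x = b' t" using fib[OF x] by (auto simp: t_def)
      have ux: "u x = f t" using u_end(1)[OF t] xb by simp
      show ?thesis
      proof (cases "t < T")
        case True
        have "eventually (\<lambda>s. dist (f s) (f t) < \<epsilon>/2) (at_right t)"
          by (rule tendstoD[OF cadlag_right[OF cad]]) (use True t \<epsilon> in auto)
        then obtain z where z: "z > t" "\<And>s. t < s \<Longrightarrow> s < z \<Longrightarrow> \<bar>f s - f t\<bar> < \<epsilon>/2"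
          unfolding eventually_at_right_field dist_real_def by blast
        have "(r \<longlongrightarrow> r x) (at x within {x..1})"
          by (rule tendsto_within_subset[of _ _ _ "{0..1}"]) (use r(1) x in \<open>auto simp: continuous_on_def\<close>)
        then have "eventually (\<lambda>y. r y < z) (at x within {x..1})"
          using z(1) by (intro order_tendstoD) (auto simp: t_def)
        moreover have "eventually (\<lambda>y. y \<in> {x..1} \<and> y \<noteq> x) (at x within {x..1})"
          by (auto simp: eventually_at_filter)
        ultimately show ?thesis
        proof eventually_elim
          case (elim y)
          then have y: "y \<in> {0..1}" "x < y" using x by auto
          have "r x \<le> r y" using mono_onD[OF r(2) x y(1)] y by auto
          moreover have "r y \<noteq> t" using fib[OF y(1)] y xb by auto
          ultimately have ry: "t < r y" by (auto simp: t_def)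
          have "\<bar>f (r y) - f t\<bar> \<le> \<epsilon>/2" using z(2)[OF ry] elim by auto
          moreover have "eventually (\<lambda>s. \<bar>f s - f t\<bar> \<le> \<epsilon>/2) (at_left (r y))"
            unfolding eventually_at_left_field
            by (intro exI[of _ t]) (use ry z(2) elim in \<open>auto intro!: less_imp_le\<close>)
          then have "\<bar>left_lim f (r y) - f t\<bar> \<le> \<epsilon>/2"
            using ry t r01[OF y(1)] by (intro left_lim_close[OF cad]) auto
          ultimately have "\<bar>u y - f t\<bar> \<le> \<epsilon>/2" by (intro u_near y)
          then show ?case using \<epsilon> ux by (auto simp: dist_real_def)
        qed
      next
        case False
        then have "t = T" using t by auto
        then have "r 1 = t" using r by simp
        moreover have "1 \<le> b' (r 1)" by (rule fib) simp
        ultimately have "x = 1" using xb x by auto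
        then show ?thesis by (simp add: eventually_at_filter)
      qed
    qed
  qed
  have u_left: "eventually (\<lambda>y. dist (u y) (u x) < \<epsilon>) (at x within {0..x})"
    if x: "x \<in> {0..1}" and \<epsilon>: "\<epsilon> > 0" for x \<epsilon>
  proof -
    define t where "t = r x"
    have t: "t \<in> {0..T}" using r01[OF x] by (simp add: t_def)
    show ?thesis
    proof (cases "b t < x")
      case True
      obtain k where k: "\<And>y. y \<in> {b t..b' t} \<Longrightarrow> u y = left_lim f t + (y - b t) * k"
        using u_aff[OF t] by blast
      have "((\<lambda>y. left_lim f t + (y - b t) * k) \<longlongrightarrow> left_lim f t + (x - b t) * k) (at x within {0..x})"
        by (intro tendsto_intros)
      then have "eventually (\<lambda>y. dist (left_lim f t + (y - b t) * k) (left_lim f t + (x - b t) * k) < \<epsilon>) (at x within {0..x})"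
        using \<epsilon> by (rule tendstoD)
      moreover have "eventually (\<lambda>y. y \<in> {b t<..}) (at x within {0..x})"
        using True by (auto simp: eventually_at_topological intro!: exI[of _ "{b t<..}"])
      moreover have "eventually (\<lambda>y. y \<in> {0..x}) (at x within {0..x})"
        by (auto simp: eventually_at_filter)
      ultimately show ?thesis
      proof eventually_elim
        case (elim y)
        have "x \<le> b' t" "y \<le> b' t" using fib[OF x] elim by (auto simp: t_def)
        then show ?case using elim True k[of x] k[of y] by auto
      qed
    next
      case False
      then have xb: "x = b t" using fib[OF x] by (auto simp: t_def)
      have ux: "u x = left_lim f t" using u_end(2)[OF t] xb by simp
      show ?thesis
      proof (cases "0 < t")
        case True
        have "eventually (\<lambda>s. dist (f s) (left_lim f t) < \<epsilon>/2) (at_left t)"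
          by (rule tendstoD[OF cadlag_left_lim[OF cad]]) (use True t \<epsilon> in auto)
        then obtain z0 where z0: "z0 < t" "\<And>s. z0 < s \<Longrightarrow> s < t \<Longrightarrow> \<bar>f s - left_lim f t\<bar> < \<epsilon>/2"
          unfolding eventually_at_left_field dist_real_def by blast
        define z where "z = max z0 0"
        have z: "z < t" "\<And>s. z < s \<Longrightarrow> s < t \<Longrightarrow> \<bar>f s - left_lim f t\<bar> < \<epsilon>/2" "0 \<le> z"
          using z0 True by (auto simp: z_def)
        have "(r \<longlongrightarrow> r x) (at x within {0..x})"
          by (rule tendsto_within_subset[of _ _ _ "{0..1}"]) (use r(1) x in \<open>auto simp: continuous_on_def\<close>)
        then have "eventually (\<lambda>y. r y > z) (at x within {0..x})"
          using z(1) by (intro order_tendstoD) (auto simp: t_def)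
        moreover have "eventually (\<lambda>y. y \<in> {0..x} \<and> y \<noteq> x) (at x within {0..x})"
          by (auto simp: eventually_at_filter)
        ultimately show ?thesis
        proof eventually_elim
          case (elim y)
          then have y: "y \<in> {0..1}" "y < x" using x by auto
          have "r y \<le> r x" using mono_onD[OF r(2) y(1) x] y by auto
          moreover have "r y \<noteq> t" using fib[OF y(1)] y xb by auto
          ultimately have ry: "r y < t" by (auto simp: t_def)
          have "\<bar>f (r y) - left_lim f t\<bar> \<le> \<epsilon>/2" using z(2)[OF _ ry] elim by auto
          moreover have "eventually (\<lambda>s. \<bar>f s - left_lim f t\<bar> \<le> \<epsilon>/2) (at_left (r y))"
            unfolding eventually_at_left_field
            by (intro exI[of _ z]) (use ry z(2) elim in \<open>auto intro!: less_imp_le\<close>)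
          then have "\<bar>left_lim f (r y) - left_lim f t\<bar> \<le> \<epsilon>/2"
            using ry t r01[OF y(1)] elim z(3) by (intro left_lim_close[OF cad]) auto
          ultimately have "\<bar>u y - left_lim f t\<bar> \<le> \<epsilon>/2" by (intro u_near y)
          then show ?case using \<epsilon> ux by (auto simp: dist_real_def)
        qed
      next
        case False
        then have "t = 0" using t by auto
        then have "r 0 = t" using r by simp
        moreover have "b (r 0) \<le> 0" by (rule fib) simp
        ultimately have "x = 0" using xb x by auto
        then show ?thesis by (simp add: eventually_at_filter)
      qed
    qed
  qed
  have ucont: "continuous_on {0..1} u"
    unfolding continuous_on_def
  proof (intro ballI tendstoI)
    fix x \<epsilon> :: real assume x: "x \<in> {0..1}" and \<epsilon>: "\<epsilon> > 0"
    have "{0..1} = {0..x} \<union> {x..1}" using x by auto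
    then show "eventually (\<lambda>y. dist (u y) (u x) < \<epsilon>) (at x within {0..1})"
      using u_left[OF x \<epsilon>] u_right[OF x \<epsilon>] by (simp add: at_within_union eventually_sup)
  qed
  define p where "p = (\<lambda>x. (r x, u x))"
  have "p \<in> param_reps T f"
    unfolding param_reps_def
  proof (intro CollectI conjI ballI impI)
    show "continuous_on {0..1} p" unfolding p_def by (intro continuous_on_Pair r ucont)
    show "p ` {0..1} = ext_graph T f"
    proof (intro equalityI subsetI)
      fix q assume "q \<in> p ` {0..1}"
      then obtain x where x: "x \<in> {0..1}" "q = (r x, u x)" by (auto simp: p_def)
      then show "q \<in> ext_graph T f"
        using r01[OF x(1)] \<theta>01[OF x(1)] u_conv[of x]
        by (auto simp: ext_graph_def intro!: bexI[of _ "1 - \<theta> x"])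
    next
      fix q assume "q \<in> ext_graph T f"
      then obtain t \<alpha> where q: "t \<in> {0..T}" "\<alpha> \<in> {0..1}" "q = (t, \<alpha> * left_lim f t + (1 - \<alpha>) * f t)"
        by (auto simp: ext_graph_def)
      define x where "x = b' t - \<alpha> * (b' t - b t)"
      have bb: "b t \<le> b' t" using b(2)[OF q(1)] .
      have "\<alpha> * (b' t - b t) \<le> 1 * (b' t - b t)"
        using q(2) bb by (intro mult_right_mono) auto
      moreover have "0 \<le> \<alpha> * (b' t - b t)" using q(2) bb by auto
      ultimately have x: "b t \<le> x" "x \<le> b' t" by (auto simp: x_def)
      have rx: "r x = t" "x \<in> {0..1}" using rb[OF q(1) x] by auto
      have "u x = \<alpha> * left_lim f t + (1 - \<alpha>) * f t"
      proof (cases "b t = b' t")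
        case True
        then show ?thesis using nojump[OF q(1)] by (simp add: u_def rx algebra_simps)
      next
        case False
        then have "x - b t = (1 - \<alpha>) * (b' t - b t)" by (simp add: x_def algebra_simps)
        then have th: "\<theta> x = 1 - \<alpha>" using False by (simp add: \<theta>_def rx)
        show ?thesis unfolding u_def rx th by (simp add: algebra_simps)
      qed
      then show "q \<in> p ` {0..1}" using rx q(3) by (auto simp: p_def intro!: image_eqI[of _ _ x])
    qed
    fix x y :: real assume xy: "x \<in> {0..1}" "y \<in> {0..1}" "x \<le> y"
    show "graph_le f (p x) (p y)"
    proof (cases "r x < r y")
      case True then show ?thesis by (simp add: graph_le_def p_def)
    next
      case False
      then have eq: "r x = r y" using mono_onD[OF r(2) xy] by auto
      have "\<theta> x \<le> \<theta> y" using xy fib[OF xy(1)] eq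
        by (auto simp: \<theta>_def intro!: divide_right_mono)
      then have "\<bar>\<theta> x\<bar> * \<bar>f (r y) - left_lim f (r y)\<bar> \<le> \<bar>\<theta> y\<bar> * \<bar>f (r y) - left_lim f (r y)\<bar>"
        using \<theta>01(1)[OF xy(1)] by (intro mult_right_mono) auto
      then show ?thesis by (simp add: graph_le_def p_def u_def eq abs_mult)
    qed
  next
    have 0: "0 \<in> {0..T}" "T \<in> {0..T}" using T by auto
    have "left_lim f 0 = f 0" by (simp add: left_lim_def)
    then show "p 0 = (0, f 0)" using r by (simp add: p_def u_def)
    have "1 \<le> b' (r 1)" by (rule fib) simp
    then have "b' T = 1" using b(3)[OF 0(2)] r(4) by simp
    then show "p 1 = (T, f T)" using u_end(1)[OF 0(2)] r by (simp add: p_def)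
  qed
  then show ?thesis by blast
qed

section \<open>Bounding the M1 distance by gluing\<close>

lemma param_rep_bdd:
  assumes "p \<in> param_reps T f" "q \<in> param_reps T g"
  shows "bdd_above ((\<lambda>x. \<bar>fst (p x) - fst (q x)\<bar>) ` {0..1})"
    and "bdd_above ((\<lambda>x. \<bar>snd (p x) - snd (q x)\<bar>) ` {0..1})"
proof -
  have c: "continuous_on {0..1} p" "continuous_on {0..1} q"
    using assms by (auto simp: param_reps_def)
  show "bdd_above ((\<lambda>x. \<bar>fst (p x) - fst (q x)\<bar>) ` {0..1})"
    by (intro bounded_imp_bdd_above compact_imp_bounded compact_continuous_image continuous_intros c)
      auto
  show "bdd_above ((\<lambda>x. \<bar>snd (p x) - snd (q x)\<bar>) ` {0..1})"
    by (intro bounded_imp_bdd_above compact_imp_bounded compact_continuous_image continuous_intros c)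
      auto
qed

lemma param_rep_dist_nonneg:
  assumes "p \<in> param_reps T f" "q \<in> param_reps T g"
  shows "0 \<le> max (SUP x\<in>{0..1}. \<bar>fst (p x) - fst (q x)\<bar>) (SUP x\<in>{0..1}. \<bar>snd (p x) - snd (q x)\<bar>)"
proof -
  have "0 \<le> \<bar>fst (p 0) - fst (q 0)\<bar>" by simp
  also have "\<dots> \<le> (SUP x\<in>{0..1}. \<bar>fst (p x) - fst (q x)\<bar>)"
    by (rule cSUP_upper[OF _ param_rep_bdd(1)[OF assms]]) simp
  finally show ?thesis by simp
qed

lemma dist_M1_le:
  assumes pq: "p \<in> param_reps T f" "q \<in> param_reps T g"
    and B: "\<And>x. x \<in> {0..1} \<Longrightarrow> \<bar>fst (p x) - fst (q x)\<bar> \<le> B"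
      "\<And>x. x \<in> {0..1} \<Longrightarrow> \<bar>snd (p x) - snd (q x)\<bar> \<le> B"
  shows "dist_M1 T f g \<le> B"
proof -
  let ?d = "\<lambda>(p, q). max (SUP x\<in>{0..1}. \<bar>fst (p x) - fst (q x)\<bar> :: real)
    (SUP x\<in>{0..1}. \<bar>snd (p x) - snd (q x)\<bar> :: real)"
  have "bdd_below (?d ` (param_reps T f \<times> param_reps T g))"
    by (rule bdd_belowI[of _ 0]) (use param_rep_dist_nonneg in \<open>force simp del: max.absorb_iff1\<close>)
  then have "dist_M1 T f g \<le> ?d (p, q)"
    unfolding dist_M1_def by (rule cINF_lower) (use pq in auto)
  also have "\<dots> \<le> B"
    using B by (auto intro!: cSUP_least)
  finally show ?thesis .
qed

lemma dist_M1_nonneg: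
  assumes "param_reps T f \<noteq> {}" "param_reps T g \<noteq> {}"
  shows "dist_M1 T f g \<ge> 0"
  unfolding dist_M1_def
proof (rule cINF_greatest)
  show "param_reps T f \<times> param_reps T g \<noteq> {}" using assms by auto
  fix pq assume "pq \<in> param_reps T f \<times> param_reps T g"
  then show "0 \<le> (case pq of (p, q) \<Rightarrow> max (SUP x\<in>{0..1}. \<bar>fst (p x) - fst (q x)\<bar> :: real)
    (SUP x\<in>{0..1}. \<bar>snd (p x) - snd (q x)\<bar> :: real))"
    using param_rep_dist_nonneg[of "fst pq" T f "snd pq" g] by (cases pq) auto
qed

text \<open>While the parameter runs from \<open>b\<close> to \<open>b'\<close>, the graph of the continuous path \<open>X\<close>, traversed
  monotonically from time \<open>a\<close> to time \<open>a'\<close>, stays within \<open>B\<close> of the representation \<open>p\<close> of another path.\<close>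

definition tracks ::
  "(real \<Rightarrow> real) \<Rightarrow> (real \<Rightarrow> real \<times> real) \<Rightarrow> real \<Rightarrow> real \<Rightarrow> real \<Rightarrow> real \<Rightarrow> real \<Rightarrow> bool" where
  "tracks X p B b a b' a' \<longleftrightarrow>
     (\<exists>\<rho>. continuous_on {b..b'} \<rho> \<and> mono_on {b..b'} \<rho> \<and> \<rho> b = a \<and> \<rho> b' = a' \<and>
        (\<forall>x\<in>{b..b'}. \<bar>\<rho> x - fst (p x)\<bar> \<le> B \<and> \<bar>X (\<rho> x) - snd (p x)\<bar> \<le> B))"

lemma tracks_trans:
  assumes "tracks X p B b a b' a'" "tracks X p B b' a' b'' a''" "b \<le> b'" "b' \<le> b''"
  shows "tracks X p B b a b'' a''"
proof -
  obtain \<rho> where 1: "continuous_on {b..b'} \<rho>" "mono_on {b..b'} \<rho>" "\<rho> b = a" "\<rho> b' = a'"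
    "\<forall>x\<in>{b..b'}. \<bar>\<rho> x - fst (p x)\<bar> \<le> B \<and> \<bar>X (\<rho> x) - snd (p x)\<bar> \<le> B"
    using assms(1) unfolding tracks_def by blast
  obtain \<sigma> where 2: "continuous_on {b'..b''} \<sigma>" "mono_on {b'..b''} \<sigma>" "\<sigma> b' = a'" "\<sigma> b'' = a''"
    "\<forall>x\<in>{b'..b''}. \<bar>\<sigma> x - fst (p x)\<bar> \<le> B \<and> \<bar>X (\<sigma> x) - snd (p x)\<bar> \<le> B"
    using assms(2) unfolding tracks_def by blast
  define \<tau> where "\<tau> = (\<lambda>x. if x \<le> b' then \<rho> x else \<sigma> x)"
  have "{b..b''} = {b..b'} \<union> {b'..b''}" using assms by auto
  then have "continuous_on {b..b''} \<tau>"
    unfolding \<tau>_def using 1 2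
    by (simp only:, intro continuous_on_If) (auto simp: antisym)
  moreover have "mono_on {b..b''} \<tau>"
  proof (rule mono_onI)
    fix x y assume xy: "x \<in> {b..b''}" "y \<in> {b..b''}" "x \<le> y"
    consider "y \<le> b'" | "x \<le> b'" "b' < y" | "b' < x" by linarith
    then show "\<tau> x \<le> \<tau> y"
    proof cases
      case 1
      then show ?thesis using xy mono_onD[OF \<open>mono_on {b..b'} \<rho>\<close>, of x y] by (auto simp: \<tau>_def)
    next
      case 2
      have "\<rho> x \<le> \<rho> b'" using 2 xy mono_onD[OF \<open>mono_on {b..b'} \<rho>\<close>, of x b'] assms by auto
      moreover have "\<sigma> b' \<le> \<sigma> y"
        using 2 xy mono_onD[OF \<open>mono_on {b'..b''} \<sigma>\<close>, of b' y] assms by auto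
      ultimately show ?thesis using 2 \<open>\<rho> b' = a'\<close> \<open>\<sigma> b' = a'\<close> by (auto simp: \<tau>_def)
    next
      case 3
      then show ?thesis using xy mono_onD[OF \<open>mono_on {b'..b''} \<sigma>\<close>, of x y] by (auto simp: \<tau>_def)
    qed
  qed
  moreover have "\<tau> b = a" using 1 assms by (auto simp: \<tau>_def)
  moreover have "\<tau> b'' = a''" using 1 2 assms by (auto simp: \<tau>_def)
  moreover have "\<forall>x\<in>{b..b''}. \<bar>\<tau> x - fst (p x)\<bar> \<le> B \<and> \<bar>X (\<tau> x) - snd (p x)\<bar> \<le> B"
    using 1(5) 2(5) by (auto simp: \<tau>_def)
  ultimately show ?thesis unfolding tracks_def by blast
qed

text \<open>If all pairs of points are close, any monotone traversal will do; the one chosen is affine.\<close>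

lemma tracks_rectangle:
  assumes "b < b' \<or> b = b' \<and> a = a'" "a \<le> a'"
    and "\<And>x t. x \<in> {b..b'} \<Longrightarrow> t \<in> {a..a'} \<Longrightarrow> \<bar>t - fst (p x)\<bar> \<le> B"
    and "\<And>x t. x \<in> {b..b'} \<Longrightarrow> t \<in> {a..a'} \<Longrightarrow> \<bar>X t - snd (p x)\<bar> \<le> B"
  shows "tracks X p B b a b' a'"
proof -
  define \<rho> where "\<rho> = (\<lambda>x. a + (x - b) / (b' - b) * (a' - a))"
  have "continuous_on {b..b'} \<rho>" unfolding \<rho>_def divide_inverse by (intro continuous_intros)
  moreover have "mono_on {b..b'} \<rho>"
    using assms(1,2) by (auto simp: \<rho>_def mono_on_def intro!: mult_right_mono divide_right_mono)
  moreover have ends: "\<rho> b = a" "\<rho> b' = a'" using assms(1) by (auto simp: \<rho>_def)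
  moreover have "\<rho> x \<in> {a..a'}" if "x \<in> {b..b'}" for x
    using mono_onD[OF \<open>mono_on {b..b'} \<rho>\<close>, of b x] mono_onD[OF \<open>mono_on {b..b'} \<rho>\<close>, of x b'] that ends
    by auto
  ultimately show ?thesis unfolding tracks_def using assms(3,4) by (intro exI[of _ \<rho>]) blast
qed

lemma continuous_graph_param:
  assumes X: "continuous_on {0..T} X" and \<rho>: "continuous_on {0..1} \<rho>" "mono_on {0..1} \<rho>" "\<rho> 0 = 0" "\<rho> 1 = T"
  shows "(\<lambda>x. (\<rho> x, X (\<rho> x))) \<in> param_reps T X"
proof -
  have \<rho>01: "\<rho> x \<in> {0..T}" if "x \<in> {0..1}" for x
    using mono_onD[OF \<rho>(2), of 0 x] mono_onD[OF \<rho>(2), of x 1] \<rho>(3,4) that by auto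
  have ll: "left_lim X t = X t" if "t \<in> {0..T}" for t
  proof (cases "t = 0")
    case True then show ?thesis by (simp add: left_lim_def)
  next
    case False
    with that have t: "0 < t" by auto
    have "(X \<longlongrightarrow> X t) (at t within {0..T})" using X that by (auto simp: continuous_on_def)
    then have "(X \<longlongrightarrow> X t) (at t within {0..t})"
      by (rule tendsto_within_subset) (use that in auto)
    then have "Lim (at_left t) X = X t"
      unfolding at_within_Icc_at_left[OF t] by (intro tendsto_Lim) auto
    then show ?thesis using False that by (simp add: left_lim_def)
  qed
  have eg: "ext_graph T X = (\<lambda>t. (t, X t)) ` {0..T}"
    by (auto simp: ext_graph_def ll algebra_simps intro!: bexI[of _ 0])
  have "\<rho> ` {0..1} = {0..T}"
  proof
    show "\<rho> ` {0..1} \<subseteq> {0..T}" using \<rho>01 by auto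
    show "{0..T} \<subseteq> \<rho> ` {0..1}"
    proof
      fix t assume t: "t \<in> {0..T}"
      have "\<exists>x. 0 \<le> x \<and> x \<le> 1 \<and> \<rho> x = t" using \<rho> t by (intro IVT') auto
      then show "t \<in> \<rho> ` {0..1}" by auto
    qed
  qed
  then have im: "(\<lambda>x. (\<rho> x, X (\<rho> x))) ` {0..1} = ext_graph T X"
    unfolding eg by (metis (no_types, lifting) image_cong image_image)
  show ?thesis
    unfolding param_reps_def
  proof (intro CollectI conjI ballI impI im)
    show "continuous_on {0..1} (\<lambda>x. (\<rho> x, X (\<rho> x)))"
      by (intro continuous_on_Pair \<rho> continuous_on_compose2[OF X \<rho>(1)]) (use \<rho>01 in auto)
    fix x y :: real assume "x \<in> {0..1}" "y \<in> {0..1}" "x \<le> y"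
    then have "\<rho> x \<le> \<rho> y" using mono_onD[OF \<rho>(2)] by auto
    then show "graph_le X (\<rho> x, X (\<rho> x)) (\<rho> y, X (\<rho> y))" by (auto simp: graph_le_def)
  qed (use \<rho> in auto)
qed

lemma dist_M1_le_tracks:
  assumes "continuous_on {0..T} X" "p \<in> param_reps T f" "tracks X p B 0 0 1 T"
  shows "dist_M1 T X f \<le> B"
proof -
  obtain \<rho> where \<rho>: "continuous_on {0..1} \<rho>" "mono_on {0..1} \<rho>" "\<rho> 0 = 0" "\<rho> 1 = T"
    "\<forall>x\<in>{0..1}. \<bar>\<rho> x - fst (p x)\<bar> \<le> B \<and> \<bar>X (\<rho> x) - snd (p x)\<bar> \<le> B"
    using assms(3) unfolding tracks_def by blast
  show ?thesis
    by (rule dist_M1_le[OF continuous_graph_param[OF assms(1) \<rho>(1-4)] assms(2)]) (use \<rho>(5) in auto)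
qed

section \<open>The relaxation equation\<close>

text \<open>The integral form of \<open>X' = c (f - X)\<close>, \<open>X 0 = 0\<close>, that is,
  \<open>X t = c \<integral>\<^bsub>0\<^esub>\<^bsup>t\<^esup> exp (- c (t - s)) f s ds\<close>.\<close>

definition relaxes :: "real \<Rightarrow> real \<Rightarrow> (real \<Rightarrow> real) \<Rightarrow> (real \<Rightarrow> real) \<Rightarrow> bool" where
  "relaxes T c f X \<longleftrightarrow> (\<lambda>s. f s - X s) integrable_on {0..T} \<and>
     (\<forall>t\<in>{0..T}. X t = c * integral {0..t} (\<lambda>s. f s - X s))"

lemma relaxes_uminus:
  assumes "relaxes T c f X"
  shows "relaxes T c (\<lambda>s. - f s) (\<lambda>s. - X s)"
proof -
  have "((\<lambda>s. - f s - - X s) :: real \<Rightarrow> real) = (\<lambda>s. - (f s - X s))" by auto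
  moreover have "(\<lambda>s. - (f s - X s)) integrable_on {0..T}"
    using assms unfolding relaxes_def by (intro integrable_neg) simp
  moreover have "integral {0..t} (\<lambda>s. - (f s - X s)) = - integral {0..t} (\<lambda>s. f s - X s)" for t
    by (rule integral_neg)
  ultimately show ?thesis
    using assms unfolding relaxes_def by (simp del: minus_diff_eq)
qed

lemma relaxes_continuous:
  assumes "relaxes T c f X"
  shows "continuous_on {0..T} X"
proof -
  have "continuous_on {0..T} (\<lambda>t. c * integral {0..t} (\<lambda>s. f s - X s))"
    using assms unfolding relaxes_def
    by (intro continuous_intros indefinite_integral_continuous_1) auto
  then show ?thesis
    by (rule continuous_on_eq) (use assms in \<open>auto simp: relaxes_def\<close>)
qed

lemma relaxes_increment:
  assumes "relaxes T c f X" "0 \<le> s" "s \<le> t" "t \<le> T"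
  shows "(\<lambda>s. f s - X s) integrable_on {s..t}" "X t - X s = c * integral {s..t} (\<lambda>s. f s - X s)"
proof -
  have i: "(\<lambda>s. f s - X s) integrable_on {0..T}"
    and X: "\<And>t. t \<in> {0..T} \<Longrightarrow> X t = c * integral {0..t} (\<lambda>s. f s - X s)"
    using assms(1) by (auto simp: relaxes_def)
  show "(\<lambda>s. f s - X s) integrable_on {s..t}"
    by (rule integrable_subinterval_real[OF i]) (use assms in auto)
  have "(\<lambda>s. f s - X s) integrable_on {0..t}"
    by (rule integrable_subinterval_real[OF i]) (use assms in auto)
  note comb = Henstock_Kurzweil_Integration.integral_combine[OF assms(2,3) this]
  have "X t - X s = c * (integral {0..t} (\<lambda>s. f s - X s) - integral {0..s} (\<lambda>s. f s - X s))"
    using X[of s] X[of t] assms by (simp add: right_diff_distrib)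
  also have "\<dots> = c * integral {s..t} (\<lambda>s. f s - X s)" by (simp add: comb[symmetric])
  finally show "X t - X s = c * integral {s..t} (\<lambda>s. f s - X s)" .
qed

text \<open>Comparison with the solution for the constant input \<open>M\<close>. As \<open>f\<close> is merely integrable, this is
  argued with increments: after the last time at which \<open>X\<close> is not above the comparison function, the
  difference could only decrease.\<close>

lemma relaxes_upper:
  assumes rel: "relaxes T c f X" and c: "c > 0" and ab: "0 \<le> a" "b \<le> T"
    and M: "\<And>s. a \<le> s \<Longrightarrow> s < b \<Longrightarrow> f s \<le> M" and t: "a \<le> t" "t \<le> b"
  shows "X t \<le> M + exp (- c * (t - a)) * (X a - M)"
proof (rule ccontr)
  define U where "U = (\<lambda>t. M + exp (- c * (t - a)) * (X a - M))"
  define W where "W = (\<lambda>t. X t - U t)"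
  assume "\<not> ?thesis"
  then have Wt: "W t > 0" by (simp add: W_def U_def)
  have U': "((\<lambda>u. c * (M - U u)) has_integral (U s' - U s)) {s..s'}" if "s \<le> s'" for s s'
  proof (rule fundamental_theorem_of_calculus[OF that])
    fix x
    have "(U has_real_derivative (c * (M - U x))) (at x within {s..s'})"
      unfolding U_def by (auto intro!: derivative_eq_intros simp: algebra_simps)
    then show "(U has_vector_derivative c * (M - U x)) (at x within {s..s'})"
      by (simp add: has_real_derivative_iff_has_vector_derivative)
  qed
  have Wcont: "continuous_on {a..t} W"
    unfolding W_def U_def
    by (intro continuous_intros continuous_on_subset[OF relaxes_continuous[OF rel]]) (use ab t in auto)
  \<comment> \<open>Start from the last time before \<open>t\<close> at which \<open>X\<close> is not above the comparison function.\<close>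
  define Z where "Z = {s\<in>{a..t}. W s \<le> 0}"
  have aZ: "a \<in> Z" using t by (auto simp: Z_def W_def U_def)
  have "closed Z"
    using continuous_closed_preimage[OF Wcont closed_real_atLeastAtMost closed_atMost[of 0]]
    by (simp add: Z_def vimage_def Int_def)
  moreover have "bounded Z" by (rule bounded_subset[of "{a..t}"]) (auto simp: Z_def)
  ultimately have "compact Z" by (simp add: compact_eq_bounded_closed)
  from compact_attains_sup[OF this] aZ obtain s where s: "s \<in> Z" "\<forall>x\<in>Z. x \<le> s" by blast
  then have sz: "a \<le> s" "s \<le> t" "W s \<le> 0" by (auto simp: Z_def)
  have Wpos: "W u > 0" if "s < u" "u \<le> t" for u
  proof (rule ccontr)
    assume "\<not> W u > 0"
    then have "u \<in> Z" using that sz by (auto simp: Z_def)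
    then show False using s(2) that by auto
  qed
  have fi: "(\<lambda>u. f u - X u) integrable_on {s..t}" and
    Xi: "X t - X s = c * integral {s..t} (\<lambda>u. f u - X u)"
    using relaxes_increment[OF rel, of s t] sz ab t by auto
  have Ui: "(\<lambda>u. c * (M - U u)) integrable_on {s..t}" "integral {s..t} (\<lambda>u. c * (M - U u)) = U t - U s"
    using U'[OF sz(2)] by (auto simp: has_integral_iff)
  have fi': "(\<lambda>u. c * (f u - X u)) integrable_on {s..t}" using fi by (rule integrable_on_mult_right)
  have "W t - W s = integral {s..t} (\<lambda>u. c * (f u - X u)) - integral {s..t} (\<lambda>u. c * (M - U u))"
    using Xi Ui by (simp add: W_def)
  also have "\<dots> = integral {s..t} (\<lambda>u. c * (f u - X u) - c * (M - U u))"
    by (rule Henstock_Kurzweil_Integration.integral_diff[symmetric]) (use fi' Ui in auto)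
  also have "\<dots> = integral {s<..<t} (\<lambda>u. c * (f u - X u) - c * (M - U u))"
    by (rule integral_open_interval_real)
  also have "\<dots> \<le> integral {s<..<t} (\<lambda>u. 0)"
  proof (rule integral_le)
    show "(\<lambda>u. c * (f u - X u) - c * (M - U u)) integrable_on {s<..<t}"
      unfolding integrable_on_open_interval_real
      by (intro integrable_diff fi' Ui)
    fix u assume u: "u \<in> {s<..<t}"
    have "W u > 0" using Wpos u by auto
    moreover have "f u \<le> M" using M u sz t by auto
    ultimately have "f u - X u \<le> M - U u" by (simp add: W_def)
    then show "c * (f u - X u) - c * (M - U u) \<le> 0" using c by auto
  qed (rule integrable_0)
  finally show False using Wt sz by simp
qed

lemma relaxes_near_constant:
  assumes rel: "relaxes T c f X" and c: "c > 0" and ab: "0 \<le> a" "b \<le> T"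
    and M: "\<And>s. a \<le> s \<Longrightarrow> s < b \<Longrightarrow> \<bar>f s - m\<bar> \<le> \<omega>" and t: "a \<le> t" "t \<le> b" and "\<omega> \<ge> 0"
  shows "\<bar>X t - m - exp (- c * (t - a)) * (X a - m)\<bar> \<le> \<omega>"
proof -
  let ?E = "exp (- c * (t - a))"
  have "X t \<le> (m + \<omega>) + ?E * (X a - (m + \<omega>))"
    by (rule relaxes_upper[OF rel c ab _ t]) (use M in \<open>force simp: abs_le_iff\<close>)
  moreover have "- X t \<le> (\<omega> - m) + ?E * (- X a - (\<omega> - m))"
    by (rule relaxes_upper[OF relaxes_uminus[OF rel] c ab _ t]) (use M in \<open>force simp: abs_le_iff\<close>)
  moreover have "0 \<le> ?E * \<omega>" using \<open>\<omega> \<ge> 0\<close> by simp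
  ultimately show ?thesis by (auto simp: abs_le_iff algebra_simps)
qed

lemma relaxes_start: "relaxes T c f X \<Longrightarrow> 0 \<le> T \<Longrightarrow> X 0 = 0"
  by (auto simp: relaxes_def)

lemma relaxes_bounded:
  assumes "relaxes T c f X" "c > 0" "\<And>s. s \<in> {0..T} \<Longrightarrow> \<bar>f s\<bar> \<le> K" "t \<in> {0..T}"
  shows "\<bar>X t\<bar> \<le> K"
proof -
  have "K \<ge> 0" using assms(3)[OF assms(4)] by linarith
  have "\<bar>X t - 0 - exp (- c * (t - 0)) * (X 0 - 0)\<bar> \<le> K"
    by (rule relaxes_near_constant[OF assms(1,2), where b = T]) (use assms \<open>K \<ge> 0\<close> in auto)
  then show ?thesis using relaxes_start[OF assms(1)] assms(4) by simp
qed

text \<open>The order on the completed graph forces a parametric representation to enter the vertical segment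
  at time \<open>t\<close> at its left limit and to leave it at the value.\<close>

lemma param_rep_fibre:
  assumes p: "p \<in> param_reps T f" and t: "t \<in> {0..T}"
  shows "\<exists>\<beta> \<beta>'. 0 \<le> \<beta> \<and> \<beta> \<le> \<beta>' \<and> \<beta>' \<le> 1 \<and> (\<forall>x\<in>{0..1}. fst (p x) = t \<longleftrightarrow> \<beta> \<le> x \<and> x \<le> \<beta>') \<and>
    snd (p \<beta>) = left_lim f t \<and> snd (p \<beta>') = f t"
proof -
  have c: "continuous_on {0..1} p" and im: "p ` {0..1} = ext_graph T f"
    and ord: "\<And>a b. a \<in> {0..1} \<Longrightarrow> b \<in> {0..1} \<Longrightarrow> a \<le> b \<Longrightarrow> graph_le f (p a) (p b)"
    and ends: "p 0 = (0, f 0)" "p 1 = (T, f T)"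
    using p by (auto simp: param_reps_def)
  have "mono_on {0..1} (\<lambda>x. fst (p x))"
  proof (rule mono_onI)
    fix x y :: real assume "x \<in> {0..1}" "y \<in> {0..1}" "x \<le> y"
    from ord[OF this] show "fst (p x) \<le> fst (p y)" by (auto simp: graph_le_def)
  qed
  moreover have "continuous_on {0..1} (\<lambda>x. fst (p x))" by (intro continuous_intros c)
  ultimately obtain \<beta> \<beta>' where b: "0 \<le> \<beta>" "\<beta> \<le> \<beta>'" "\<beta>' \<le> 1" "{x\<in>{0..1}. fst (p x) = t} = {\<beta>..\<beta>'}"
    using t ends by (elim fibre_interval[of "\<lambda>x. fst (p x)" T t, rotated]) auto
  have mem: "fst (p x) = t \<longleftrightarrow> \<beta> \<le> x \<and> x \<le> \<beta>'" if "x \<in> {0..1}" for x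
    using eqset_imp_iff[OF b(4), of x] that by simp
  have b01: "\<beta> \<in> {0..1}" "\<beta>' \<in> {0..1}" using b(1-3) by auto
  have "(t, left_lim f t) \<in> p ` {0..1}"
    unfolding im ext_graph_def using t by (auto intro!: bexI[of _ 1])
  then obtain x where x: "x \<in> {0..1}" "p x = (t, left_lim f t)" by auto
  have "\<beta> \<le> x" "x \<le> \<beta>'" using mem[OF x(1)] x(2) by auto
  have "fst (p \<beta>) = t" "fst (p \<beta>') = t" using mem[OF b01(1)] mem[OF b01(2)] b(2) by auto
  have left: "snd (p \<beta>) = left_lim f t"
    using ord[OF b01(1) x(1) \<open>\<beta> \<le> x\<close>] x(2) \<open>fst (p \<beta>) = t\<close> by (auto simp: graph_le_def)
  have "(t, f t) \<in> p ` {0..1}"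
    unfolding im ext_graph_def using t by (auto intro!: bexI[of _ 0])
  then obtain y where y: "y \<in> {0..1}" "p y = (t, f t)" by auto
  have "y \<le> \<beta>'" using mem[OF y(1)] y(2) by auto
  have le: "\<bar>left_lim f t - f t\<bar> \<le> \<bar>left_lim f t - snd (p \<beta>')\<bar>"
    using ord[OF y(1) b01(2) \<open>y \<le> \<beta>'\<close>] y(2) \<open>fst (p \<beta>') = t\<close> by (auto simp: graph_le_def)
  have "p \<beta>' \<in> ext_graph T f" using im b01 by auto
  then obtain \<alpha> where \<alpha>: "\<alpha> \<in> {0..1}" "snd (p \<beta>') = \<alpha> * left_lim f t + (1 - \<alpha>) * f t"
    using \<open>fst (p \<beta>') = t\<close> by (auto simp: ext_graph_def)
  have "left_lim f t - snd (p \<beta>') = (1 - \<alpha>) * (left_lim f t - f t)"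
    unfolding \<alpha>(2) by (simp add: algebra_simps)
  then have "\<bar>left_lim f t - f t\<bar> \<le> (1 - \<alpha>) * \<bar>left_lim f t - f t\<bar>"
    using le \<alpha>(1) by (simp add: abs_mult)
  then have "\<alpha> * \<bar>left_lim f t - f t\<bar> \<le> 0" by (simp add: algebra_simps)
  then have "\<alpha> = 0 \<or> left_lim f t = f t"
    using \<alpha>(1) by (auto simp: mult_le_0_iff)
  then have "snd (p \<beta>') = f t" unfolding \<alpha>(2) by (auto simp: algebra_simps)
  with left mem b(1-3) show ?thesis by (intro exI[of _ \<beta>] exI[of _ \<beta>']) auto
qed

section \<open>Relaxation tracks a path in M1\<close>

text \<open>At a jump, the representation \<open>p\<close> moves from the left limit \<open>l\<close> to the value \<open>m\<close>, having covered the
  fraction \<open>\<theta>\<close> of the way, while the relaxing path needs the time \<open>s\<close> to do so, where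
  \<open>1 - exp (- c s) = \<theta>\<close>. Solving for \<open>s\<close> gives the time change. Because the whole way would take infinite
  time, \<open>\<theta>\<close> is scaled by \<open>q = 1 - exp (- c d)\<close>, so that \<open>\<theta> = 1\<close> is reached at time \<open>d\<close>.\<close>

lemma tracks_jump:
  assumes p: "p \<in> param_reps T f" and rel: "relaxes T c f X" and c: "c > 0"
    and \<beta>: "0 \<le> \<beta>" "\<beta> \<le> \<beta>'" "\<beta>' \<le> 1" "\<And>x. x \<in> {\<beta>..\<beta>'} \<Longrightarrow> fst (p x) = a"
      "snd (p \<beta>) = left_lim f a" "snd (p \<beta>') = f a"
    and jump: "left_lim f a \<noteq> f a"
    and ad: "0 \<le> a" "d > 0" "a + d \<le> T" and osc: "\<And>s. a \<le> s \<Longrightarrow> s < a + d \<Longrightarrow> \<bar>f s - f a\<bar> \<le> \<omega>" and "\<omega> \<ge> 0"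
    and start: "\<bar>X a - left_lim f a\<bar> \<le> 3 * \<omega>" and small: "exp (- c * d) * \<bar>left_lim f a - f a\<bar> \<le> \<omega>"
    and B: "d \<le> B" "5 * \<omega> \<le> B"
  shows "tracks X p B \<beta> a \<beta>' (a + d)"
proof -
  let ?l = "left_lim f a" and ?m = "f a"
  define q where "q = 1 - exp (- c * d)"
  have q: "0 \<le> q" "q < 1" using c ad by (auto simp: q_def)
  define \<theta> where "\<theta> = (\<lambda>x. \<bar>?l - snd (p x)\<bar> / \<bar>?l - ?m\<bar>)"
  define \<rho> where "\<rho> = (\<lambda>x. a - ln (1 - \<theta> x * q) / c)"
  have x01: "x \<in> {0..1}" if "x \<in> {\<beta>..\<beta>'}" for x using that \<beta>(1-3) by auto
  have cp: "continuous_on {0..1} p" and im: "p ` {0..1} = ext_graph T f"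
    and ord: "\<And>a b. a \<in> {0..1} \<Longrightarrow> b \<in> {0..1} \<Longrightarrow> a \<le> b \<Longrightarrow> graph_le f (p a) (p b)"
    using p by (auto simp: param_reps_def)
  have \<theta>u: "0 \<le> \<theta> x \<and> \<theta> x \<le> 1 \<and> snd (p x) - ?m = (1 - \<theta> x) * (?l - ?m)" if x: "x \<in> {\<beta>..\<beta>'}" for x
  proof -
    have "p x \<in> ext_graph T f" using im x01[OF x] by auto
    then obtain \<alpha> where \<alpha>: "0 \<le> \<alpha>" "\<alpha> \<le> 1" "snd (p x) = \<alpha> * ?l + (1 - \<alpha>) * ?m"
      using \<beta>(4)[OF x] by (auto simp: ext_graph_def)
    have "?l - snd (p x) = (1 - \<alpha>) * (?l - ?m)" unfolding \<alpha>(3) by (simp add: algebra_simps)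
    then have th: "\<theta> x = 1 - \<alpha>" using \<alpha>(1,2) jump by (simp add: \<theta>_def abs_mult)
    show ?thesis unfolding th \<alpha>(3) using \<alpha>(1,2) by (simp add: algebra_simps)
  qed
  have \<theta>mono: "\<theta> x \<le> \<theta> y" if "x \<in> {\<beta>..\<beta>'}" "y \<in> {\<beta>..\<beta>'}" "x \<le> y" for x y
    using ord[OF x01[OF that(1)] x01[OF that(2)] that(3)] \<beta>(4)[OF that(1)] \<beta>(4)[OF that(2)]
    by (auto simp: graph_le_def \<theta>_def intro!: divide_right_mono)
  have arg: "1 - \<theta> x * q > 0" if x: "x \<in> {\<beta>..\<beta>'}" for x
  proof -
    have "\<theta> x * q \<le> 1 * q" using \<theta>u[OF x] q by (intro mult_right_mono) auto
    then show ?thesis using q by simp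
  qed
  have "continuous_on {\<beta>..\<beta>'} p" by (rule continuous_on_subset[OF cp]) (use x01 in auto)
  then have "continuous_on {\<beta>..\<beta>'} \<theta>"
    unfolding \<theta>_def divide_inverse by (intro continuous_intros)
  moreover have "\<forall>x\<in>{\<beta>..\<beta>'}. 1 - \<theta> x * q \<noteq> 0" using arg by force
  ultimately have "continuous_on {\<beta>..\<beta>'} \<rho>"
    unfolding \<rho>_def divide_inverse by (intro continuous_intros)
  moreover have rmono: "mono_on {\<beta>..\<beta>'} \<rho>"
  proof (rule mono_onI)
    fix x y assume xy: "x \<in> {\<beta>..\<beta>'}" "y \<in> {\<beta>..\<beta>'}" "x \<le> y"
    have "\<theta> x * q \<le> \<theta> y * q" using \<theta>mono[OF xy] q by (intro mult_right_mono) auto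
    then have "ln (1 - \<theta> y * q) \<le> ln (1 - \<theta> x * q)" using arg[OF xy(2)] by simp
    then show "\<rho> x \<le> \<rho> y" using c by (simp add: \<rho>_def divide_right_mono)
  qed
  moreover have "\<theta> \<beta> = 0" "\<theta> \<beta>' = 1" using jump \<beta>(5,6) by (simp_all add: \<theta>_def)
  then have ends: "\<rho> \<beta> = a" "\<rho> \<beta>' = a + d" using c by (simp_all add: \<rho>_def q_def)
  moreover have "\<bar>\<rho> x - fst (p x)\<bar> \<le> B \<and> \<bar>X (\<rho> x) - snd (p x)\<bar> \<le> B" if x: "x \<in> {\<beta>..\<beta>'}" for x
  proof -
    have \<rho>x: "a \<le> \<rho> x" "\<rho> x \<le> a + d"
      using mono_onD[OF rmono, of \<beta> x] mono_onD[OF rmono, of x \<beta>'] ends x by auto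
    let ?E = "exp (- c * (\<rho> x - a))"
    have E: "?E = 1 - \<theta> x * q" using c arg[OF x] by (simp add: \<rho>_def)
    have near: "\<bar>X (\<rho> x) - ?m - ?E * (X a - ?m)\<bar> \<le> \<omega>"
      by (rule relaxes_near_constant[OF rel c ad(1,3) osc \<rho>x]) (use \<open>\<omega> \<ge> 0\<close> in auto)
    have "0 \<le> ?E" "?E \<le> 1" using c \<rho>x(1) by auto
    then have 2: "\<bar>?E * (X a - ?l)\<bar> \<le> 3 * \<omega>"
      using start mult_mono[of ?E 1 "\<bar>X a - ?l\<bar>" "3 * \<omega>"] by (simp add: abs_mult)
    have "\<theta> x * (exp (- c * d) * \<bar>?l - ?m\<bar>) \<le> 1 * \<omega>"
      using \<theta>u[OF x] small by (intro mult_mono) auto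
    then have 3: "\<bar>\<theta> x * exp (- c * d) * (?l - ?m)\<bar> \<le> \<omega>"
      using \<theta>u[OF x] by (simp add: abs_mult mult.assoc)
    have "X (\<rho> x) - snd (p x) = (X (\<rho> x) - ?m - ?E * (X a - ?m)) + ?E * (X a - ?l) + (?E - (1 - \<theta> x)) * (?l - ?m)"
      using \<theta>u[OF x] by (simp add: algebra_simps)
    also have "?E - (1 - \<theta> x) = \<theta> x * exp (- c * d)" unfolding E q_def by (simp add: algebra_simps)
    finally have "\<bar>X (\<rho> x) - snd (p x)\<bar> \<le> 5 * \<omega>" using near 2 3 by linarith
    then show ?thesis using \<rho>x B \<beta>(4)[OF x] by auto
  qed
  ultimately show ?thesis unfolding tracks_def by blast
qed

lemma left_lim_bound:
  assumes "cadlag_on T f" "0 \<le> a" "a \<le> T" "\<And>s. s \<in> {0..T} \<Longrightarrow> \<bar>f s\<bar> \<le> K"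
  shows "\<bar>left_lim f a\<bar> \<le> K"
proof (cases "a = 0")
  case True
  then show ?thesis using assms by (auto simp: left_lim_def)
next
  case False
  have "eventually (\<lambda>s. \<bar>f s - 0\<bar> \<le> K) (at_left a)"
    unfolding eventually_at_left_field using assms False by (intro exI[of _ 0]) auto
  then show ?thesis using left_lim_close[OF assms(1), of a 0 K] False assms by auto
qed

text \<open>The two paths are synchronised at the partition points of \<open>regular_path_chain\<close>. The invariant \<open>Q a\<close>
  says that the parametrisations have been matched until the representation of \<open>f\<close> arrives at the
  vertical segment at \<open>a\<close> (parameter \<open>\<beta>\<close>) and that \<open>X\<close> is then close to the left limit there. In the
  next cell, a jump of \<open>f\<close> is matched during the first \<open>\<delta> / 6\<close> of time, after which \<open>X\<close> has forgotten its
  initial value up to \<open>exp (- c \<delta> / 6) 2 K\<close>. With oscillation \<open>\<omega> = 4 \<eta>\<close> in a cell, every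
  matched pair of points differs by at most \<open>5 \<omega> = 20 \<eta>\<close> in space.\<close>

lemma dist_M1_relaxes_le:
  assumes cad: "cadlag_on T f" and f0: "f 0 = 0" and reg: "regular_path T \<delta> \<eta> K f"
    and \<delta>: "0 < \<delta>" "\<delta> \<le> T" and \<eta>: "\<eta> \<ge> 0" and c: "c > 0" and rel: "relaxes T c f X"
    and small: "exp (- c * (\<delta> / 6)) * (2 * K) \<le> 4 * \<eta>"
  shows "dist_M1 T X f \<le> max (2 * \<delta>) (20 * \<eta>)"
proof -
  define B where "B = max (2 * \<delta>) (20 * \<eta>)"
  have B: "2 * \<delta> \<le> B" "20 * \<eta> \<le> B" by (auto simp: B_def)
  have T: "T > 0" using \<delta> by simp
  obtain p where p: "p \<in> param_reps T f" using param_reps_nonempty[OF cad T] by blast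
  have im: "p ` {0..1} = ext_graph T f"
    and ord: "\<And>a b. a \<in> {0..1} \<Longrightarrow> b \<in> {0..1} \<Longrightarrow> a \<le> b \<Longrightarrow> graph_le f (p a) (p b)"
    and ends: "p 0 = (0, f 0)" "p 1 = (T, f T)"
    using p by (auto simp: param_reps_def)
  have rmono: "fst (p x) \<le> fst (p y)" if "x \<in> {0..1}" "y \<in> {0..1}" "x \<le> y" for x y
    using ord[OF that] by (auto simp: graph_le_def)
  have K: "\<bar>f s\<bar> \<le> K" if "s \<in> {0..T}" for s
    using regular_pathD(1)[OF reg that] by simp
  have XK: "\<bar>X s\<bar> \<le> K" if "s \<in> {0..T}" for s
    by (rule relaxes_bounded[OF rel c K that])
  have lK: "\<bar>left_lim f s\<bar> \<le> K" if "0 \<le> s" "s \<le> T" for s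
    by (rule left_lim_bound[OF cad that K])
  define Q where "Q = (\<lambda>a. (\<exists>\<beta>\<in>{0..1}. fst (p \<beta>) = a \<and> (\<forall>x\<in>{0..1}. fst (p x) = a \<longrightarrow> \<beta> \<le> x) \<and>
    tracks X p B 0 0 \<beta> a) \<and> \<bar>X a - left_lim f a\<bar> \<le> 12 * \<eta>)"
  have "Q T"
  proof (rule regular_path_chain[OF cad reg \<delta> \<eta>])
    have "tracks X p B 0 0 0 0"
      by (rule tracks_rectangle) (use ends relaxes_start[OF rel] T f0 B \<delta> in auto)
    then show "Q 0" using ends relaxes_start[OF rel] T f0 \<eta> unfolding Q_def
      by (intro conjI bexI[of _ 0]) (auto simp: left_lim_def)
  next
    fix a \<tau> assume Qa: "Q a" and a: "0 \<le> a" "a + \<delta> / 3 \<le> \<tau>" "\<tau> \<le> T" "\<tau> \<le> a + 2 * \<delta>"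
      and osc: "\<forall>s\<in>{a..<\<tau>}. norm (f s - f a) \<le> 4 * \<eta>"
    define d where "d = \<delta> / 6"
    have d: "d > 0" "a + d < \<tau>" "d \<le> B" using a \<delta> B by (auto simp: d_def)
    have osc': "\<bar>f s - f a\<bar> \<le> 4 * \<eta>" if "a \<le> s" "s < \<tau>" for s using osc that by auto
    have aT: "a \<in> {0..T}" "\<tau> \<in> {0..T}" "a < \<tau>" using a d by auto
    obtain \<beta> where b: "\<beta> \<in> {0..1}" "fst (p \<beta>) = a" "\<forall>x\<in>{0..1}. fst (p x) = a \<longrightarrow> \<beta> \<le> x"
        "tracks X p B 0 0 \<beta> a" and Xa: "\<bar>X a - left_lim f a\<bar> \<le> 12 * \<eta>"
      using Qa by (auto simp: Q_def)
    from param_rep_fibre[OF p aT(1)] obtain \<beta>1 \<beta>' where b': "0 \<le> \<beta>1" "\<beta>1 \<le> \<beta>'" "\<beta>' \<le> 1"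
      "\<forall>x\<in>{0..1}. fst (p x) = a \<longleftrightarrow> \<beta>1 \<le> x \<and> x \<le> \<beta>'" "snd (p \<beta>1) = left_lim f a" "snd (p \<beta>') = f a"
      by blast
    have "fst (p \<beta>1) = a" using b'(1-4) by auto
    then have "\<beta> \<le> \<beta>1" using b(3) b'(1-3) by auto
    moreover have "\<beta>1 \<le> \<beta>" using b(1,2) b'(4) by auto
    ultimately have [simp]: "\<beta>1 = \<beta>" by simp
    from param_rep_fibre[OF p aT(2)] obtain \<gamma> \<gamma>' where g: "0 \<le> \<gamma>" "\<gamma> \<le> \<gamma>'" "\<gamma>' \<le> 1"
      "\<forall>x\<in>{0..1}. fst (p x) = \<tau> \<longleftrightarrow> \<gamma> \<le> x \<and> x \<le> \<gamma>'" "snd (p \<gamma>) = left_lim f \<tau>" "snd (p \<gamma>') = f \<tau>"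
      by blast
    have \<gamma>01: "\<gamma> \<in> {0..1}" "fst (p \<gamma>) = \<tau>" using g(1-4) by auto
    have \<beta>'01: "\<beta>' \<in> {0..1}" "fst (p \<beta>') = a" using b'(1-4) by auto
    have "\<beta>' < \<gamma>"
      using rmono[OF \<gamma>01(1) \<beta>'01(1)] \<beta>'01(2) \<gamma>01(2) aT(3) by (cases "\<gamma> \<le> \<beta>'") auto
    have ll: "\<bar>left_lim f s - f a\<bar> \<le> 4 * \<eta>" if "a < s" "s \<le> \<tau>" for s
    proof (rule left_lim_close[OF cad])
      show "eventually (\<lambda>s. \<bar>f s - f a\<bar> \<le> 4 * \<eta>) (at_left s)"
        unfolding eventually_at_left_field using that osc' by (intro exI[of _ a]) auto
    qed (use that a in auto)
    \<comment> \<open>On the parameters from leaving the segment at \<open>a\<close> to arriving at the segment at \<open>\<tau>\<close>, the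
      representation sees only values of \<open>f\<close> on the cell and their left limits.\<close>
    have u_near: "\<bar>snd (p x) - f a\<bar> \<le> 4 * \<eta> \<and> a \<le> fst (p x) \<and> fst (p x) \<le> \<tau>"
      if x: "\<beta>' \<le> x" "x \<le> \<gamma>" for x
    proof -
      have x01: "x \<in> {0..1}" using x \<beta>'01 \<gamma>01 by auto
      have r: "a \<le> fst (p x)" "fst (p x) \<le> \<tau>"
        using rmono[OF \<beta>'01(1) x01 x(1)] rmono[OF x01 \<gamma>01(1) x(2)] \<beta>'01(2) \<gamma>01(2) by auto
      consider "fst (p x) = a" | "fst (p x) = \<tau>" | "a < fst (p x)" "fst (p x) < \<tau>"
        using r by linarith
      then have "\<bar>snd (p x) - f a\<bar> \<le> 4 * \<eta>"
      proof cases
        case 1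
        then have "x = \<beta>'" using b'(4) x01 x(1) by auto
        then show ?thesis using b'(6) \<eta> by simp
      next
        case 2
        then have "x = \<gamma>" using g(4) x01 x(2) by auto
        then show ?thesis using g(5) ll[of \<tau>] aT by simp
      next
        case 3
        have "(fst (p x), snd (p x)) \<in> ext_graph T f" using im x01 by auto
        then show ?thesis by (rule ext_graph_close[OF cad]) (use 3 osc' ll in auto)
      qed
      with r show ?thesis by blast
    qed
    have Xnear: "\<bar>X t - f a - exp (- c * (t - a)) * (X a - f a)\<bar> \<le> 4 * \<eta>" if "a \<le> t" "t \<le> \<tau>" for t
      by (rule relaxes_near_constant[OF rel c a(1,3) osc' that]) (use \<eta> in auto)
    have forgotten: "\<bar>X t - f a\<bar> \<le> 8 * \<eta>" if t: "a + d \<le> t" "t \<le> \<tau>" for t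
    proof -
      have "exp (- c * (t - a)) * \<bar>X a - f a\<bar> \<le> exp (- c * d) * (2 * K)"
        using c t K[OF aT(1)] XK[OF aT(1)] by (intro mult_mono) auto
      also have "\<dots> \<le> 4 * \<eta>" using small by (simp add: d_def)
      finally have "\<bar>exp (- c * (t - a)) * (X a - f a)\<bar> \<le> 4 * \<eta>"
        by (simp add: abs_mult)
      then show ?thesis using Xnear[of t] t d by auto
    qed
    have "tracks X p B \<beta> a \<gamma> \<tau>"
    proof (cases "left_lim f a = f a")
      case True
      have u_eq: "snd (p x) = f a \<and> fst (p x) = a" if "\<beta> \<le> x" "x \<le> \<beta>'" for x
      proof -
        have x01: "x \<in> {0..1}" using that b(1) \<beta>'01 by auto
        have "fst (p x) = a" using b'(4) that x01 by auto
        moreover have "p x \<in> ext_graph T f" using im x01 by auto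
        ultimately show ?thesis using True by (auto simp: ext_graph_def algebra_simps)
      qed
      have u_near': "\<bar>snd (p x) - f a\<bar> \<le> 4 * \<eta> \<and> a \<le> fst (p x) \<and> fst (p x) \<le> \<tau>"
        if x: "\<beta> \<le> x" "x \<le> \<gamma>" for x
        using u_eq[of x] u_near[of x] x \<eta> aT by (cases "x \<le> \<beta>'") auto
      show ?thesis
      proof (rule tracks_rectangle)
        show "\<beta> < \<gamma> \<or> \<beta> = \<gamma> \<and> a = \<tau>" using \<open>\<beta>' < \<gamma>\<close> b'(2) by auto
        fix x t assume x: "x \<in> {\<beta>..\<gamma>}" and t: "t \<in> {a..\<tau>}"
        show "\<bar>t - fst (p x)\<bar> \<le> B" using u_near'[of x] x t a(4) B by auto
        have "\<bar>exp (- c * (t - a)) * (X a - f a)\<bar> \<le> 1 * (12 * \<eta>)"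
          unfolding abs_mult using Xa True c t by (intro mult_mono) auto
        then have "\<bar>X t - f a\<bar> \<le> 16 * \<eta>" using Xnear[of t] t by auto
        then show "\<bar>X t - snd (p x)\<bar> \<le> B" using u_near'[of x] x B by auto
      qed (use aT in auto)
    next
      case False
      have "tracks X p B \<beta> a \<beta>' (a + d)"
      proof (rule tracks_jump[OF p rel c, where \<omega> = "4 * \<eta>"])
        have "exp (- c * d) * \<bar>left_lim f a - f a\<bar> \<le> exp (- c * d) * (2 * K)"
          using K[OF aT(1)] lK[of a] aT by (intro mult_left_mono) auto
        also have "\<dots> \<le> 4 * \<eta>" using small by (simp add: d_def)
        finally show "exp (- c * d) * \<bar>left_lim f a - f a\<bar> \<le> 4 * \<eta>" .
        show "fst (p x) = a" if "x \<in> {\<beta>..\<beta>'}" for x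
          using b'(4) that b(1) \<beta>'01 by auto
      qed (use b b' False a d osc' \<eta> Xa B in auto)
      moreover have "tracks X p B \<beta>' (a + d) \<gamma> \<tau>"
      proof (rule tracks_rectangle)
        fix x t assume x: "x \<in> {\<beta>'..\<gamma>}" and t: "t \<in> {a + d..\<tau>}"
        show "\<bar>t - fst (p x)\<bar> \<le> B" using u_near[of x] x t a(4) B d by auto
        show "\<bar>X t - snd (p x)\<bar> \<le> B" using u_near[of x] x forgotten[of t] t B \<eta> by auto
      qed (use \<open>\<beta>' < \<gamma>\<close> d in auto)
      ultimately show ?thesis
        by (rule tracks_trans) (use b' \<open>\<beta>' < \<gamma>\<close> in auto)
    qed
    then have "tracks X p B 0 0 \<gamma> \<tau>"
      by (rule tracks_trans[OF b(4)]) (use b(1) b'(2) \<open>\<beta>' < \<gamma>\<close> in auto)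
    moreover have "\<bar>X \<tau> - left_lim f \<tau>\<bar> \<le> 12 * \<eta>"
      using forgotten[of \<tau>] ll[of \<tau>] d aT by auto
    ultimately show "Q \<tau>" using \<gamma>01 g(4) unfolding Q_def by auto
  qed
  then obtain \<beta> where b: "\<beta> \<in> {0..1}" "fst (p \<beta>) = T" "tracks X p B 0 0 \<beta> T"
    and XT: "\<bar>X T - left_lim f T\<bar> \<le> 12 * \<eta>" by (auto simp: Q_def)
  have "\<bar>left_lim f T - f T\<bar> \<le> \<eta>"
  proof (rule left_lim_close[OF cad T])
    show "eventually (\<lambda>s. \<bar>f s - f T\<bar> \<le> \<eta>) (at_left T)"
      unfolding eventually_at_left_field
    proof (intro exI[of _ "T - \<delta>"] conjI allI impI)
      fix s assume "T - \<delta> < s" "s < T"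
      then show "\<bar>f s - f T\<bar> \<le> \<eta>" using regular_pathD(3)[OF reg, of s] \<delta> by auto
    qed (use \<delta> in auto)
  qed auto
  then have XT': "\<bar>X T - f T\<bar> \<le> 13 * \<eta>" using XT by linarith
  \<comment> \<open>On the segment at \<open>T\<close> the time change rests; this is harmless because the segment is short.\<close>
  have "tracks X p B \<beta> T 1 T"
  proof (rule tracks_rectangle)
    show "\<beta> < 1 \<or> \<beta> = 1 \<and> T = T" using b by auto
    fix x t assume x: "x \<in> {\<beta>..1}" and t: "t \<in> {T..T}"
    then have x01: "x \<in> {0..1}" using b by auto
    have "fst (p x) = T"
      using rmono[OF b(1) x01] rmono[OF x01, of 1] x b(2) ends by auto
    moreover have "(fst (p x), snd (p x)) \<in> ext_graph T f" using im x01 by auto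
    then have "\<bar>snd (p x) - f T\<bar> \<le> \<eta>"
      by (rule ext_graph_close[OF cad]) (use \<open>fst (p x) = T\<close> \<eta> \<open>\<bar>left_lim f T - f T\<bar> \<le> \<eta>\<close> in auto)
    ultimately show "\<bar>t - fst (p x)\<bar> \<le> B" "\<bar>X t - snd (p x)\<bar> \<le> B"
      using t XT' B \<delta> by auto
  qed auto
  then have "tracks X p B 0 0 1 T" by (rule tracks_trans[OF b(3)]) (use b in auto)
  then show ?thesis
    unfolding B_def[symmetric] by (rule dist_M1_le_tracks[OF relaxes_continuous[OF rel] p])
qed

section \<open>The adjoint and diagonal semigroups\<close>

text \<open>The representing vector is the minimiser of \<open>norm x ^ 2 / 2 - f x\<close>. The parallelogram law makes minimising
  sequences Cauchy, and the first-order condition at the minimiser is the representation.\<close>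

lemma riesz_representation:
  fixes f :: "'a::{real_inner, banach} \<Rightarrow> real"
  assumes "bounded_linear f"
  shows "\<exists>w. \<forall>x. f x = x \<bullet> w"
proof -
  interpret f: bounded_linear f by fact
  define J where "J = (\<lambda>x. (norm x)\<^sup>2 / 2 - f x)"
  obtain C where C: "\<And>x. norm (f x) \<le> norm x * C" using f.bounded by blast
  have "J x \<ge> - C\<^sup>2 / 2" for x
  proof -
    have "0 \<le> (norm x - C)\<^sup>2" by simp
    moreover have "f x \<le> norm x * C" using C[of x] by simp
    ultimately show ?thesis by (simp add: J_def power2_diff)
  qed
  then have bdd: "bdd_below (range J)" by (intro bdd_belowI[of _ "- C\<^sup>2 / 2"]) auto
  define m where "m = Inf (range J)"
  have m: "m \<le> J x" for x unfolding m_def using bdd by (intro cInf_lower) auto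
  have "\<exists>x. J x < m + inverse (Suc n)" for n
  proof -
    have "Inf (range J) < m + inverse (Suc n)" by (simp add: m_def)
    then show ?thesis using cInf_lessD[of "range J"] by auto
  qed
  then obtain X where X: "\<And>n. J (X n) < m + inverse (Suc n)" by metis
  have par: "(norm (x - y))\<^sup>2 / 4 = J x + J y - 2 * J ((1/2) *\<^sub>R (x + y))" for x y
    by (simp add: J_def f.scaleR f.add power2_norm_eq_inner inner_simps inner_commute field_simps)
  have "Cauchy X"
  proof (rule metric_CauchyI)
    fix \<epsilon> :: real assume \<epsilon>: "\<epsilon> > 0"
    then have "\<epsilon>\<^sup>2 / 8 > 0" by simp
    then obtain N where N: "inverse (real (Suc N)) < \<epsilon>\<^sup>2 / 8" using reals_Archimedean by blast
    have "dist (X i) (X j) < \<epsilon>" if "i \<ge> N" "j \<ge> N" for i j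
    proof -
      have "inverse (real (Suc i)) \<le> inverse (real (Suc N))" "inverse (real (Suc j)) \<le> inverse (real (Suc N))"
        using that by simp_all
      then have "(norm (X i - X j))\<^sup>2 / 4 < \<epsilon>\<^sup>2 / 4"
        using par[of "X i" "X j"] X[of i] X[of j] m[of "(1/2) *\<^sub>R (X i + X j)"] N by linarith
      then have "(norm (X i - X j))\<^sup>2 < \<epsilon>\<^sup>2" by simp
      then have "norm (X i - X j) < \<epsilon>" by (rule power2_less_imp_less) (use \<epsilon> in simp)
      then show ?thesis by (simp add: dist_norm)
    qed
    then show "\<exists>M. \<forall>m\<ge>M. \<forall>n\<ge>M. dist (X m) (X n) < \<epsilon>" by blast
  qed
  then obtain w where w: "X \<longlonglongrightarrow> w" using Cauchy_convergent convergent_def by blast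
  have "(\<lambda>n. J (X n)) \<longlonglongrightarrow> J w"
    unfolding J_def by (intro tendsto_intros w f.tendsto) simp
  moreover have "(\<lambda>n. m + inverse (real (Suc n))) \<longlonglongrightarrow> m + 0"
    by (intro tendsto_intros LIMSEQ_inverse_real_of_nat)
  ultimately have "J w \<le> m + 0"
    by (rule LIMSEQ_le) (use X less_imp_le in blast)
  then have min: "J w \<le> J x" for x using m[of x] by linarith
  have "f h = h \<bullet> w" for h
  proof -
    define g where "g = f h - h \<bullet> w"
    define N where "N = (norm h)\<^sup>2 + 1"
    have N: "N > 0" by (simp add: N_def add_nonneg_pos)
    \<comment> \<open>a step small enough for the linear term to dominate the quadratic one\<close>
    define t where "t = g / N"
    have "(norm (w + t *\<^sub>R h))\<^sup>2 = (norm w)\<^sup>2 + 2 * t * (h \<bullet> w) + t\<^sup>2 * (norm h)\<^sup>2"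
      unfolding power2_norm_eq_inner by (simp add: inner_simps inner_commute power2_eq_square)
    then have "J (w + t *\<^sub>R h) - J w = t\<^sup>2 * (norm h)\<^sup>2 / 2 - t * g"
      by (simp add: J_def g_def f.scaleR f.add field_simps)
    then have "t * g \<le> t\<^sup>2 * (norm h)\<^sup>2 / 2" using min[of "w + t *\<^sub>R h"] by simp
    also have "\<dots> \<le> t\<^sup>2 * N / 2" by (simp add: N_def mult_left_mono)
    also have "t\<^sup>2 * N = t * g" using N by (simp add: t_def power2_eq_square)
    finally have "t * g \<le> 0" by (simp add: mult.commute)
    then have "g * g \<le> 0" using N by (simp add: t_def divide_le_0_iff)
    then have "g = 0" by (metis mult_le_0_iff order_antisym)
    then show ?thesis by (simp add: g_def)
  qed
  then show ?thesis by blast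
qed

text \<open>The constant \<open>adjoint\<close> is defined by a choice, so its characteristic equation rests on the existence
  of some adjoint, which on a Hilbert space comes from the Riesz representation.\<close>

lemma inner_adjoint_blinfun:
  fixes G :: "'u::{real_inner, banach} \<Rightarrow>\<^sub>L 'v::real_inner"
  shows "x \<bullet> adjoint (blinfun_apply G) v = G x \<bullet> v"
proof -
  have "\<forall>y. \<exists>w. \<forall>x. G x \<bullet> y = x \<bullet> w"
    by (intro allI riesz_representation bounded_linear_compose[OF bounded_linear_inner_left]
        blinfun.bounded_linear_right)
  then have "\<exists>G'. \<forall>x y. G x \<bullet> y = x \<bullet> G' y" by metis
  then have "\<forall>x y. G x \<bullet> y = x \<bullet> adjoint (blinfun_apply G) y"
    unfolding adjoint_def by (rule someI_ex)
  then show ?thesis by simp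
qed

locale diagonal_semigroup =
  fixes S :: "real \<Rightarrow> 'v::{real_inner, banach, second_countable_topology} \<Rightarrow>\<^sub>L 'v" and e :: "nat \<Rightarrow> 'v" and lam :: "nat \<Rightarrow> real"
  assumes C0: "C0_semigroup S"
    and basis: "orthonormal_basis e"
    and eigen: "\<And>t k. t \<ge> 0 \<Longrightarrow> S t (e k) = exp (- lam k * t) *\<^sub>R e k"
    and lam_pos: "\<And>k. lam k > 0"
begin

lemma e_inner: "e i \<bullet> e j = (if i = j then 1 else 0)"
  using basis by (auto simp: orthonormal_basis_def)

lemma norm_e: "norm (e i) = 1"
  by (simp add: norm_eq_sqrt_inner e_inner)

lemma closed_containing_span_UNIV:
  assumes "closed {x. P x}" "\<And>x. x \<in> span (range e) \<Longrightarrow> P x"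
  shows "P x"
proof -
  have "closure (span (range e)) \<subseteq> {x. P x}"
    by (rule closure_minimal) (use assms in auto)
  then show ?thesis using basis by (auto simp: orthonormal_basis_def)
qed

lemma closed_subspace_containing_basis_UNIV:
  assumes "closed {x. P x}" "subspace {x. P x}" "\<And>k. P (e k)"
  shows "P x"
proof (rule closed_containing_span_UNIV[OF assms(1)])
  fix x assume "x \<in> span (range e)"
  moreover have "span (range e) \<subseteq> {x. P x}" by (rule span_minimal) (use assms in auto)
  ultimately show "P x" by auto
qed

lemma eq_if_same_coordinates:
  assumes "\<And>k. y \<bullet> e k = z \<bullet> e k"
  shows "y = z"
proof -
  have "(y - z) \<bullet> x = 0" for x
  proof (rule closed_subspace_containing_basis_UNIV)
    show "closed {x. (y - z) \<bullet> x = 0}" by (intro closed_Collect_eq continuous_intros)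
    show "subspace {x. (y - z) \<bullet> x = 0}" by (auto simp: subspace_def inner_simps)
    show "(y - z) \<bullet> e k = 0" for k using assms by (simp add: inner_diff_left)
  qed
  then have "(y - z) \<bullet> (y - z) = 0" .
  then show ?thesis by simp
qed

text \<open>Both sides are continuous and linear in \<open>x\<close>, and they agree on the basis.\<close>

lemma S_inner:
  assumes "t \<ge> 0"
  shows "S t x \<bullet> e k = exp (- lam k * t) * (x \<bullet> e k)"
proof (rule closed_subspace_containing_basis_UNIV
    [where P = "\<lambda>x. S t x \<bullet> e k = exp (- lam k * t) * (x \<bullet> e k)"])
  show "closed {x. S t x \<bullet> e k = exp (- lam k * t) * (x \<bullet> e k)}"
    by (intro closed_Collect_eq continuous_intros)
  show "subspace {x. S t x \<bullet> e k = exp (- lam k * t) * (x \<bullet> e k)}"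
    by (auto simp: subspace_def inner_simps blinfun.bilinear_simps algebra_simps)
  show "S t (e j) \<bullet> e k = exp (- lam k * t) * (e j \<bullet> e k)" for j
    using assms by (simp add: eigen e_inner)
qed

text \<open>On finite combinations of basis vectors this is the theorem of Pythagoras. Contractivity upgrades
  strong continuity at \<open>0\<close> to strong continuity at all times.\<close>

lemma S_contraction:
  assumes t: "t \<ge> 0"
  shows "norm (S t x) \<le> norm x"
proof (rule closed_containing_span_UNIV[where P = "\<lambda>x. norm (S t x) \<le> norm x"])
  show "closed {x. norm (S t x) \<le> norm x}" by (intro closed_Collect_le continuous_intros)
  fix x assume "x \<in> span (range e)"
  then have "\<exists>n a. x = (\<Sum>k<n. a k *\<^sub>R e k)"
  proof (induction rule: span_induct_alt)
    case base
    show ?case by (intro exI[of _ 0]) simp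
  next
    case (step c y x)
    then obtain j n a where j: "y = e j" and x: "x = (\<Sum>k<n. a k *\<^sub>R e k)" by auto
    define N where "N = max n (Suc j)"
    define b where "b = (\<lambda>k. (if k < n then a k else 0) + (if k = j then c else 0))"
    have "(\<Sum>k<N. b k *\<^sub>R e k) =
        (\<Sum>k<N. if k < n then a k *\<^sub>R e k else 0) + (\<Sum>k<N. if k = j then c *\<^sub>R e k else 0)"
      unfolding sum.distrib[symmetric]
      by (intro sum.cong) (auto simp: b_def scaleR_add_left)
    also have "(\<Sum>k<N. if k < n then a k *\<^sub>R e k else 0) = x"
      unfolding x by (rule sum.mono_neutral_cong_right) (auto simp: N_def)
    also have "(\<Sum>k<N. if k = j then c *\<^sub>R e k else 0) = c *\<^sub>R e j"
      by (simp add: N_def less_max_iff_disj)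
    finally show ?case unfolding j by (intro exI[of _ N] exI[of _ b]) (simp add: add.commute)
  qed
  then obtain n a where x: "x = (\<Sum>k<n. a k *\<^sub>R e k)" by blast
  have sq: "(norm (\<Sum>k<n. b k *\<^sub>R e k))\<^sup>2 = (\<Sum>k<n. (b k)\<^sup>2)" for b
    unfolding power2_norm_eq_inner
    by (simp add: inner_sum_left inner_sum_right e_inner power2_eq_square
        if_distrib[of "(*) _"] cong: if_cong)
  have Sx: "S t x = (\<Sum>k<n. (a k * exp (- lam k * t)) *\<^sub>R e k)"
    unfolding x by (simp add: blinfun.bilinear_simps blinfun.sum_right eigen t)
  have "(norm (S t x))\<^sup>2 \<le> (norm x)\<^sup>2"
    unfolding Sx unfolding x sq
  proof (rule sum_mono)
    fix k
    have "exp (- lam k * t) \<le> 1" using lam_pos[of k] t by simp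
    then have "(exp (- lam k * t))\<^sup>2 \<le> 1" by (simp add: power_le_one)
    then show "(a k * exp (- lam k * t))\<^sup>2 \<le> (a k)\<^sup>2"
      by (simp add: power_mult_distrib mult_left_le)
  qed
  then show "norm (S t x) \<le> norm x" by (rule power2_le_imp_le) simp
qed

lemma S_continuous: "continuous_on {0..} (\<lambda>s. S s y)"
proof -
  have near: "\<exists>d>0. \<forall>h. 0 \<le> h \<and> h < d \<longrightarrow> norm (S h y - y) < \<epsilon>" if "\<epsilon> > 0" for \<epsilon>
  proof -
    have "((\<lambda>t. S t y) \<longlongrightarrow> y) (at_right 0)" using C0 by (auto simp: C0_semigroup_def)
    then have "eventually (\<lambda>t. dist (S t y) y < \<epsilon>) (at_right 0)" using that by (rule tendstoD)
    then obtain d where d: "d > 0" "\<And>h. 0 < h \<Longrightarrow> h < d \<Longrightarrow> dist (S h y) y < \<epsilon>"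
      unfolding eventually_at_right_field by blast
    have "S 0 y = y" using C0 by (simp add: C0_semigroup_def)
    then have "norm (S h y - y) < \<epsilon>" if "0 \<le> h" "h < d" for h
      using d(2)[of h] that \<open>\<epsilon> > 0\<close> by (cases "h = 0") (auto simp: dist_norm)
    then show ?thesis using d(1) by blast
  qed
  have diff: "norm (S t y - S s y) \<le> norm (S (t - s) y - y)" if "0 \<le> s" "s \<le> t" for s t
  proof -
    have "\<forall>s\<ge>0. \<forall>t\<ge>0. S (s + t) = S s o\<^sub>L S t" using C0 by (simp add: C0_semigroup_def)
    from this[rule_format, of s "t - s"] have "S t = S s o\<^sub>L S (t - s)" using that by simp
    then have "S t y = S s (S (t - s) y)" by (simp only: blinfun_apply_blinfun_compose)
    then have "S t y - S s y = S s (S (t - s) y - y)" by (simp only: blinfun.diff_right)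
    then show ?thesis using S_contraction[OF that(1), of "S (t - s) y - y"] by simp
  qed
  show ?thesis
    unfolding continuous_on_iff
  proof (intro ballI allI impI)
    fix x \<epsilon> :: real assume x: "x \<in> {0..}" and "\<epsilon> > 0"
    obtain d where d: "d > 0" "\<forall>h. 0 \<le> h \<and> h < d \<longrightarrow> norm (S h y - y) < \<epsilon>"
      using near[OF \<open>\<epsilon> > 0\<close>] by blast
    have "dist (S x' y) (S x y) < \<epsilon>" if x': "x' \<in> {0..}" "dist x' x < d" for x'
    proof (cases "x \<le> x'")
      case True
      have "norm (S x' y - S x y) \<le> norm (S (x' - x) y - y)" by (rule diff) (use x True in auto)
      also have "\<dots> < \<epsilon>" by (rule d(2)[rule_format]) (use x' True in \<open>auto simp: dist_real_def\<close>)
      finally show ?thesis by (simp only: dist_norm)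
    next
      case False
      have "norm (S x y - S x' y) \<le> norm (S (x - x') y - y)" by (rule diff) (use x' False in auto)
      also have "\<dots> < \<epsilon>" by (rule d(2)[rule_format]) (use x' False in \<open>auto simp: dist_real_def\<close>)
      finally show ?thesis by (simp only: dist_norm norm_minus_commute)
    qed
    then show "\<exists>d>0. \<forall>x'\<in>{0..}. dist x' x < d \<longrightarrow> dist (S x' y) (S x y) < \<epsilon>"
      using d(1) by blast
  qed
qed

text \<open>The orbit satisfies \<open>S h x - x = \<integral>\<^bsub>0\<^esub>\<^bsup>h\<^esup> S s y ds\<close> because both sides have the same coordinates;
  dividing by \<open>h\<close> and using strong continuity at \<open>0\<close> gives the derivative. So the domain of the
  generator contains every vector on which the formal multiplication by \<open>- lam\<close> yields a vector.\<close>

lemma gen_from_coordinates: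
  assumes xy: "\<And>k. y \<bullet> e k = - lam k * (x \<bullet> e k)"
  shows "x \<in> gen_dom S" "gen S x = y"
proof -
  have cont: "continuous_on {0..h} (\<lambda>s. S s y)" for h
    by (rule continuous_on_subset[OF S_continuous]) (simp add: atLeastAtMost_def)
  have int: "integral {0..h} (\<lambda>s. S s y) = S h x - x" if h: "h \<ge> 0" for h
  proof (rule eq_if_same_coordinates)
    fix k
    have i: "(\<lambda>s. S s y) integrable_on {0..h}" by (rule integrable_continuous_real[OF cont])
    have "integral {0..h} (\<lambda>s. S s y) \<bullet> e k = integral {0..h} ((\<lambda>v. v \<bullet> e k) \<circ> (\<lambda>s. S s y))"
      using integral_linear[OF i bounded_linear_inner_left[of "e k"]] by simp
    also have "\<dots> = integral {0..h} (\<lambda>s. exp (- lam k * s) * (- lam k) * (x \<bullet> e k))"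
      by (intro integral_cong) (simp add: S_inner xy)
    also have "\<dots> = exp (- lam k * h) * (x \<bullet> e k) - exp (- lam k * 0) * (x \<bullet> e k)"
    proof (rule integral_unique, rule fundamental_theorem_of_calculus[OF h])
      fix s
      have "((\<lambda>s. exp (- lam k * s) * (x \<bullet> e k)) has_real_derivative
          exp (- lam k * s) * (- lam k) * (x \<bullet> e k)) (at s within {0..h})"
        by (auto intro!: derivative_eq_intros)
      then show "((\<lambda>s. exp (- lam k * s) * (x \<bullet> e k)) has_vector_derivative
          exp (- lam k * s) * (- lam k) * (x \<bullet> e k)) (at s within {0..h})"
        by (simp add: has_real_derivative_iff_has_vector_derivative)
    qed
    also have "\<dots> = (S h x - x) \<bullet> e k" by (simp add: inner_diff_left S_inner h)
    finally show "integral {0..h} (\<lambda>s. S s y) \<bullet> e k = (S h x - x) \<bullet> e k" .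
  qed
  have S0: "S 0 y = y" using C0 by (simp add: C0_semigroup_def)
  have "((\<lambda>h. integral {0..h} (\<lambda>s. S s y)) has_vector_derivative S 0 y) (at 0 within {0..1})"
    by (rule integral_has_vector_derivative[OF cont]) simp
  then have "((\<lambda>h. (1 / norm (h - 0)) *\<^sub>R (integral {0..h} (\<lambda>s. S s y) -
      (integral {0..0} (\<lambda>s. S s y) + (h - 0) *\<^sub>R S 0 y))) \<longlongrightarrow> 0) (at 0 within {0..1})"
    unfolding has_vector_derivative_def has_derivative_within by blast
  then have "((\<lambda>h. (1 / norm h) *\<^sub>R (integral {0..h} (\<lambda>s. S s y) - h *\<^sub>R y) + y) \<longlongrightarrow> 0 + y) (at_right 0)"
    by (intro tendsto_intros) (simp add: S0 at_within_Icc_at_right)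
  then have lim: "((\<lambda>h. (1 / norm h) *\<^sub>R (integral {0..h} (\<lambda>s. S s y) - h *\<^sub>R y) + y) \<longlongrightarrow> y) (at_right 0)"
    by simp
  have "((\<lambda>h. (S h x - x) /\<^sub>R h) \<longlongrightarrow> y) (at_right 0)"
  proof (rule Lim_transform_eventually[OF lim])
    show "eventually (\<lambda>h. (1 / norm h) *\<^sub>R (integral {0..h} (\<lambda>s. S s y) - h *\<^sub>R y) + y =
        (S h x - x) /\<^sub>R h) (at_right 0)"
      using eventually_at_right_less[of "0::real"]
      by eventually_elim (simp add: int divide_inverse scaleR_diff_right)
  qed
  then show "x \<in> gen_dom S" "gen S x = y"
    unfolding gen_dom_def gen_def by (blast, intro tendsto_Lim) simp_all
qed

lemma gen_inner:
  assumes "x \<in> gen_dom S"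
  shows "gen S x \<bullet> e k = - lam k * (x \<bullet> e k)"
proof -
  obtain y where y: "((\<lambda>h. (S h x - x) /\<^sub>R h) \<longlongrightarrow> y) (at_right 0)"
    using assms unfolding gen_dom_def by blast
  then have gy: "gen S x = y" unfolding gen_def by (intro tendsto_Lim) simp_all
  have "((\<lambda>h. ((S h x - x) /\<^sub>R h) \<bullet> e k) \<longlongrightarrow> y \<bullet> e k) (at_right 0)"
    by (intro tendsto_intros y)
  moreover have "((\<lambda>h. ((S h x - x) /\<^sub>R h) \<bullet> e k) \<longlongrightarrow> - lam k * (x \<bullet> e k)) (at_right 0)"
  proof -
    have "((\<lambda>h. exp (- lam k * h) * (x \<bullet> e k)) has_real_derivative - lam k * (x \<bullet> e k)) (at 0)"
      by (auto intro!: derivative_eq_intros)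
    then have "((\<lambda>h. (exp (- lam k * h) * (x \<bullet> e k) - x \<bullet> e k) / h) \<longlongrightarrow> - lam k * (x \<bullet> e k)) (at 0)"
      by (simp add: has_field_derivative_iff)
    then have "((\<lambda>h. (exp (- lam k * h) * (x \<bullet> e k) - x \<bullet> e k) / h) \<longlongrightarrow> - lam k * (x \<bullet> e k)) (at_right 0)"
      by (rule tendsto_mono[rotated]) (simp add: at_le)
    moreover have "eventually (\<lambda>h. (exp (- lam k * h) * (x \<bullet> e k) - x \<bullet> e k) / h =
        ((S h x - x) /\<^sub>R h) \<bullet> e k) (at_right 0)"
      using eventually_at_right_less[of "0::real"]
      by eventually_elim (simp add: S_inner inner_diff_left divide_inverse mult.commute)
    ultimately show ?thesis by (rule Lim_transform_eventually)
  qed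
  ultimately show ?thesis unfolding gy by (rule tendsto_unique[rotated]) simp
qed

lemma e_in_gen_dom: "e k \<in> gen_dom S"
  by (rule gen_from_coordinates[of "- lam k *\<^sub>R e k"]) (simp add: e_inner)

lemma e_in_adj_dom: "e k \<in> adj_dom (gen_dom S) (gen S)"
  unfolding adj_dom_def by (auto simp: gen_inner intro!: exI[of _ "- lam k *\<^sub>R e k"])

lemma adj_op_e: "adj_op (gen_dom S) (gen S) (e k) = - lam k *\<^sub>R e k"
  unfolding adj_op_def
proof (rule the_equality)
  show "\<forall>x\<in>gen_dom S. gen S x \<bullet> e k = x \<bullet> (- lam k *\<^sub>R e k)"
    by (auto simp: gen_inner)
  fix w assume w: "\<forall>x\<in>gen_dom S. gen S x \<bullet> e k = x \<bullet> w"
  show "w = - lam k *\<^sub>R e k"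
  proof (rule eq_if_same_coordinates)
    fix j
    have "e j \<bullet> w = gen S (e j) \<bullet> e k" using w e_in_gen_dom by simp
    also have "\<dots> = e j \<bullet> (- lam k *\<^sub>R e k)" by (simp add: gen_inner e_in_gen_dom)
    finally show "w \<bullet> e j = - lam k *\<^sub>R e k \<bullet> e j" by (simp add: inner_commute)
  qed
qed

end

section \<open>Regular paths form an event\<close>

lemma cadlag_on_compose:
  assumes "cadlag_on T f" "\<And>x. isCont h x"
  shows "cadlag_on T (\<lambda>t. h (f t))"
  unfolding cadlag_on_def
proof (intro conjI ballI)
  fix t assume "t \<in> {0..<T}"
  then have "(f \<longlongrightarrow> f t) (at_right t)" using assms(1) by (simp add: cadlag_on_def)
  then show "((\<lambda>t. h (f t)) \<longlongrightarrow> h (f t)) (at_right t)" by (rule isCont_tendsto_compose[OF assms(2)])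
next
  fix t assume "t \<in> {0<..T}"
  then obtain l where "(f \<longlongrightarrow> l) (at_left t)" using assms(1) unfolding cadlag_on_def by blast
  then have "((\<lambda>t. h (f t)) \<longlongrightarrow> h l) (at_left t)" by (rule isCont_tendsto_compose[OF assms(2)])
  then show "\<exists>l. ((\<lambda>t. h (f t)) \<longlongrightarrow> l) (at_left t)" by blast
qed

lemma cadlag_on_diff:
  fixes f g :: "real \<Rightarrow> 'e::real_normed_vector"
  assumes f: "cadlag_on T f" and g: "cadlag_on T g" and h: "\<And>t. t \<in> {0..T} \<Longrightarrow> h t = f t - g t"
  shows "cadlag_on T h"
  unfolding cadlag_on_def
proof (intro conjI ballI)
  fix t assume t: "t \<in> {0..<T}"
  have "((\<lambda>s. f s - g s) \<longlongrightarrow> f t - g t) (at_right t)"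
    using f g t by (intro tendsto_diff) (simp_all add: cadlag_on_def)
  moreover have "eventually (\<lambda>s. f s - g s = h s) (at_right t)"
    unfolding eventually_at_right_field using t h by (intro exI[of _ T]) auto
  ultimately have "(h \<longlongrightarrow> f t - g t) (at_right t)" by (rule Lim_transform_eventually)
  then show "(h \<longlongrightarrow> h t) (at_right t)" using h[of t] t by simp
next
  fix t assume t: "t \<in> {0<..T}"
  then obtain l m where "(f \<longlongrightarrow> l) (at_left t)" "(g \<longlongrightarrow> m) (at_left t)"
    using f g unfolding cadlag_on_def by blast
  then have "((\<lambda>s. f s - g s) \<longlongrightarrow> l - m) (at_left t)" by (rule tendsto_diff)
  moreover have "eventually (\<lambda>s. f s - g s = h s) (at_left t)"
    unfolding eventually_at_left_field using t h by (intro exI[of _ 0]) auto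
  ultimately have "(h \<longlongrightarrow> l - m) (at_left t)" by (rule Lim_transform_eventually)
  then show "\<exists>l. (h \<longlongrightarrow> l) (at_left t)" by blast
qed

text \<open>Since \<open>T\<close> cannot be approximated from the right within \<open>[0, T]\<close>, it has to be a member itself.\<close>

definition grid :: "real \<Rightarrow> real set" where
  "grid T = insert T (\<rat> \<inter> {0..T})"

lemma countable_grid: "countable (grid T)"
  by (simp add: grid_def countable_rat)

lemma grid_subset: "T \<ge> 0 \<Longrightarrow> grid T \<subseteq> {0..T}"
  by (auto simp: grid_def)

lemma grid_approx:
  assumes "s \<in> {0..T}"
  shows "\<exists>a. (\<forall>n. a n \<in> grid T \<and> s \<le> a n) \<and> a \<longlonglongrightarrow> s"
proof (cases "s = T")
  case True
  then show ?thesis by (intro exI[of _ "\<lambda>_. T"]) (simp add: grid_def)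
next
  case False
  define b where "b = (\<lambda>n. s + (T - s) * inverse (real (Suc n)))"
  have "s < b n" "b n \<le> T" for n
  proof -
    have "0 < (T - s) * inverse (real (Suc n))" using assms False by simp
    then show "s < b n" by (simp add: b_def)
    have "(T - s) * inverse (real (Suc n)) \<le> (T - s) * 1"
      by (rule mult_left_mono) (use assms in \<open>auto simp: inverse_le_1_iff\<close>)
    then show "b n \<le> T" by (simp add: b_def)
  qed
  then have "\<exists>q\<in>\<rat>. s < q \<and> q < b n" for n using Rats_dense_in_real by blast
  then obtain a where a: "\<And>n. a n \<in> \<rat>" "\<And>n. s < a n" "\<And>n. a n < b n" by metis
  have "b \<longlonglongrightarrow> s + (T - s) * 0"
    unfolding b_def by (intro tendsto_intros LIMSEQ_inverse_real_of_nat)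
  then have "a \<longlonglongrightarrow> s"
    by (intro tendsto_sandwich[of "\<lambda>_. s" a sequentially b]) (use a in \<open>auto intro!: always_eventually less_imp_le\<close>)
  moreover have "a n \<in> grid T \<and> s \<le> a n" for n
    using a(1)[of n] a(2)[of n] a(3)[of n] \<open>b n \<le> T\<close> assms by (auto simp: grid_def)
  ultimately show ?thesis by blast
qed

lemma cadlag_seq_right:
  fixes f :: "real \<Rightarrow> 'e::metric_space"
  assumes "cadlag_on T f" "s \<in> {0..T}" "\<And>n. a n \<in> grid T \<and> s \<le> a n" "a \<longlonglongrightarrow> s"
  shows "(\<lambda>n. f (a n)) \<longlonglongrightarrow> f s"
proof (cases "s = T")
  case True
  have "T \<ge> 0" using assms(2) by simp
  have "a n = T" for n using assms(3)[of n] grid_subset[OF \<open>T \<ge> 0\<close>] True by auto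
  then show ?thesis using True by simp
next
  case False
  then have "(f \<longlongrightarrow> f s) (at_right s)" using cadlag_right[OF assms(1), of s] assms(2) by simp
  then have right: "eventually (\<lambda>x. dist (f x) (f s) < \<epsilon>) (at_right s)" if "\<epsilon> > 0" for \<epsilon>
    using that by (rule tendstoD)
  show ?thesis
  proof (rule tendstoI)
    fix \<epsilon> :: real assume "\<epsilon> > 0"
    obtain z where z: "z > s" "\<And>x. s < x \<Longrightarrow> x < z \<Longrightarrow> dist (f x) (f s) < \<epsilon>"
      using right[OF \<open>\<epsilon> > 0\<close>] unfolding eventually_at_right_field by blast
    show "eventually (\<lambda>n. dist (f (a n)) (f s) < \<epsilon>) sequentially"
      using order_tendstoD(2)[OF assms(4) z(1)]
    proof eventually_elim
      case (elim n)
      then show ?case using z(2)[of "a n"] assms(3)[of n] \<open>\<epsilon> > 0\<close> by (cases "a n = s") auto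
    qed
  qed
qed

text \<open>Every time is a limit from the right of grid times, along which the strict order of three times
  persists; the disjunction of two non-strict inequalities is one for a minimum, and passes to the limit.\<close>

lemma regular_path_iff_grid:
  fixes f :: "real \<Rightarrow> 'e::real_normed_vector"
  assumes cad: "cadlag_on T f" and T: "T > 0"
  shows "regular_path T \<delta> \<eta> K f \<longleftrightarrow>
     (\<forall>s\<in>grid T. norm (f s) \<le> K) \<and>
     (\<forall>s\<in>grid T. s < \<delta> \<longrightarrow> norm (f s - f 0) \<le> \<eta>) \<and>
     (\<forall>s\<in>grid T. T - \<delta> < s \<longrightarrow> norm (f s - f T) \<le> \<eta>) \<and>
     (\<forall>r\<in>grid T. \<forall>s\<in>grid T. \<forall>t\<in>grid T. r < s \<and> s < t \<and> t < r + \<delta> \<longrightarrow>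
        norm (f s - f r) \<le> \<eta> \<or> norm (f t - f s) \<le> \<eta>)" (is "_ \<longleftrightarrow> ?P1 \<and> ?P2 \<and> ?P3 \<and> ?P4")
proof
  assume "regular_path T \<delta> \<eta> K f"
  then show "?P1 \<and> ?P2 \<and> ?P3 \<and> ?P4"
    using grid_subset[of T] T unfolding regular_path_def by (meson less_imp_le subsetD)
next
  assume P: "?P1 \<and> ?P2 \<and> ?P3 \<and> ?P4"
  have approx: "\<exists>a. (\<forall>n. a n \<in> grid T \<and> s \<le> a n) \<and> a \<longlonglongrightarrow> s \<and> (\<lambda>n. f (a n)) \<longlonglongrightarrow> f s"
    if s: "s \<in> {0..T}" for s
  proof -
    obtain a where a: "\<forall>n. a n \<in> grid T \<and> s \<le> a n" "a \<longlonglongrightarrow> s" using grid_approx[OF s] by blast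
    then have "(\<lambda>n. f (a n)) \<longlonglongrightarrow> f s" by (intro cadlag_seq_right[OF cad s]) auto
    with a show ?thesis by blast
  qed
  show "regular_path T \<delta> \<eta> K f"
    unfolding regular_path_def
  proof (intro conjI ballI impI)
    fix s assume s: "s \<in> {0..T}"
    obtain a where a: "\<forall>n. a n \<in> grid T \<and> s \<le> a n" "a \<longlonglongrightarrow> s" "(\<lambda>n. f (a n)) \<longlonglongrightarrow> f s"
      using approx[OF s] by blast
    show "norm (f s) \<le> K"
      by (rule tendsto_upperbound[OF tendsto_norm[OF a(3)]]) (use a(1) P in auto)
    show "norm (f s - f 0) \<le> \<eta>" if "s < \<delta>"
    proof (rule tendsto_upperbound)
      show "(\<lambda>n. norm (f (a n) - f 0)) \<longlonglongrightarrow> norm (f s - f 0)" by (intro tendsto_intros a)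
      show "eventually (\<lambda>n. norm (f (a n) - f 0) \<le> \<eta>) sequentially"
        using order_tendstoD(2)[OF a(2) that] by eventually_elim (use a(1) P in auto)
    qed simp
    show "norm (f s - f T) \<le> \<eta>" if "T - \<delta> < s"
    proof (rule tendsto_upperbound)
      show "(\<lambda>n. norm (f (a n) - f T)) \<longlonglongrightarrow> norm (f s - f T)" by (intro tendsto_intros a)
      show "eventually (\<lambda>n. norm (f (a n) - f T) \<le> \<eta>) sequentially"
        using order_tendstoD(1)[OF a(2) that] by eventually_elim (use a(1) P in auto)
    qed simp
  next
    fix r s t assume rst: "r \<in> {0..T}" "s \<in> {0..T}" "t \<in> {0..T}" "r < s \<and> s < t \<and> t < r + \<delta>"
    obtain a where a: "\<forall>n. a n \<in> grid T \<and> r \<le> a n" "a \<longlonglongrightarrow> r" "(\<lambda>n. f (a n)) \<longlonglongrightarrow> f r"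
      using approx[OF rst(1)] by blast
    obtain b where b: "\<forall>n. b n \<in> grid T \<and> s \<le> b n" "b \<longlonglongrightarrow> s" "(\<lambda>n. f (b n)) \<longlonglongrightarrow> f s"
      using approx[OF rst(2)] by blast
    obtain c where c: "\<forall>n. c n \<in> grid T \<and> t \<le> c n" "c \<longlonglongrightarrow> t" "(\<lambda>n. f (c n)) \<longlonglongrightarrow> f t"
      using approx[OF rst(3)] by blast
    have 1: "eventually (\<lambda>n. b n - a n > 0) sequentially"
      by (rule order_tendstoD(1)[OF tendsto_diff[OF b(2) a(2)]]) (use rst in auto)
    have 2: "eventually (\<lambda>n. c n - b n > 0) sequentially"
      by (rule order_tendstoD(1)[OF tendsto_diff[OF c(2) b(2)]]) (use rst in auto)
    have 3: "eventually (\<lambda>n. c n - a n < \<delta>) sequentially"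
      by (rule order_tendstoD(2)[OF tendsto_diff[OF c(2) a(2)]]) (use rst in auto)
    have "min (norm (f s - f r)) (norm (f t - f s)) \<le> \<eta>"
    proof (rule tendsto_upperbound)
      show "(\<lambda>n. min (norm (f (b n) - f (a n))) (norm (f (c n) - f (b n)))) \<longlonglongrightarrow>
          min (norm (f s - f r)) (norm (f t - f s))"
        by (intro tendsto_intros a b c)
      show "eventually (\<lambda>n. min (norm (f (b n) - f (a n))) (norm (f (c n) - f (b n))) \<le> \<eta>) sequentially"
        using 1 2 3
      proof eventually_elim
        case (elim n)
        then have "a n < b n \<and> b n < c n \<and> c n < a n + \<delta>" by linarith
        then have "norm (f (b n) - f (a n)) \<le> \<eta> \<or> norm (f (c n) - f (b n)) \<le> \<eta>"
          using P a(1) b(1) c(1) by blast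
        then show ?case by auto
      qed
    qed simp
    then show "norm (f s - f r) \<le> \<eta> \<or> norm (f t - f s) \<le> \<eta>" by (simp add: min_le_iff_disj)
  qed
qed

lemma regular_path_compose:
  assumes "regular_path T \<delta> \<eta> K f" "\<And>x. norm (h x) \<le> norm x" "\<And>x y. norm (h x - h y) \<le> norm (x - y)"
  shows "regular_path T \<delta> \<eta> K (\<lambda>t. h (f t))"
  unfolding regular_path_def
proof (intro conjI ballI impI)
  fix s assume s: "s \<in> {0..T}"
  show "norm (h (f s)) \<le> K" by (rule order_trans[OF assms(2) regular_pathD(1)[OF assms(1) s]])
  show "norm (h (f s) - h (f 0)) \<le> \<eta>" if "s < \<delta>"
    by (rule order_trans[OF assms(3) regular_pathD(2)[OF assms(1) s that]])
  show "norm (h (f s) - h (f T)) \<le> \<eta>" if "T - \<delta> < s"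
    by (rule order_trans[OF assms(3) regular_pathD(3)[OF assms(1) s that]])
next
  fix r s t assume rst: "r \<in> {0..T}" "s \<in> {0..T}" "t \<in> {0..T}" "r < s \<and> s < t \<and> t < r + \<delta>"
  have "norm (f s - f r) \<le> \<eta> \<or> norm (f t - f s) \<le> \<eta>"
    by (rule regular_pathD(4)[OF assms(1) rst(1-3)]) (use rst(4) in auto)
  then show "norm (h (f s) - h (f r)) \<le> \<eta> \<or> norm (h (f t) - h (f s)) \<le> \<eta>"
    using assms(3) order_trans by blast
qed

lemma sets_regular_path:
  fixes Z :: "real \<Rightarrow> 'w \<Rightarrow> 'e::{real_normed_vector, second_countable_topology}"
  assumes T: "T > 0" and meas: "\<And>t. t \<in> {0..T} \<Longrightarrow> Z t \<in> borel_measurable M"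
    and cad: "\<And>\<omega>. \<omega> \<in> space M \<Longrightarrow> cadlag_on T (\<lambda>t. Z t \<omega>)"
  shows "{\<omega>\<in>space M. regular_path T \<delta> \<eta> K (\<lambda>t. Z t \<omega>)} \<in> sets M"
proof -
  have Z [measurable]: "Z t \<in> borel_measurable M" if "t \<in> grid T" for t
    using meas grid_subset[of T] T that by auto
  have Z0 [measurable]: "Z 0 \<in> borel_measurable M" "Z T \<in> borel_measurable M"
    using meas T by auto
  note [simp] = countable_grid
  have "{\<omega>\<in>space M. regular_path T \<delta> \<eta> K (\<lambda>t. Z t \<omega>)} = {\<omega>\<in>space M.
     (\<forall>s\<in>grid T. norm (Z s \<omega>) \<le> K) \<and>
     (\<forall>s\<in>grid T. s < \<delta> \<longrightarrow> norm (Z s \<omega> - Z 0 \<omega>) \<le> \<eta>) \<and>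
     (\<forall>s\<in>grid T. T - \<delta> < s \<longrightarrow> norm (Z s \<omega> - Z T \<omega>) \<le> \<eta>) \<and>
     (\<forall>r\<in>grid T. \<forall>s\<in>grid T. \<forall>t\<in>grid T. r < s \<and> s < t \<and> t < r + \<delta> \<longrightarrow>
        norm (Z s \<omega> - Z r \<omega>) \<le> \<eta> \<or> norm (Z t \<omega> - Z s \<omega>) \<le> \<eta>)}"
    using regular_path_iff_grid[OF cad T] by (intro Collect_cong conj_cong refl) auto
  also have "\<dots> \<in> sets M"
    by (intro sets.sets_Collect_conj sets.sets_Collect_countable_Ball sets.sets_Collect_imp
        sets.sets_Collect_disj sets.sets_Collect_const countable_grid borel_measurable_le) measurable
  finally show ?thesis .
qed

section \<open>The integrated process solves a relaxation equation\<close>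

lemma set_integrable_bounded_interval:
  fixes y :: "real \<Rightarrow> 'v::{banach, second_countable_topology}"
  assumes "set_borel_measurable lborel {a..b} y" "\<And>s. s \<in> {a..b} \<Longrightarrow> norm (y s) \<le> K"
  shows "set_integrable lborel {a..b} y"
proof -
  have "integrable lborel (\<lambda>x. indicator {a..b} x *\<^sub>R (indicator {a..b} x *\<^sub>R y x))"
    by (rule integrableI_bounded_set_indicator[where B = K])
      (use assms in \<open>auto simp: set_borel_measurable_def indicator_def emeasure_lborel_Icc_eq\<close>)
  moreover have "(\<lambda>x. indicator {a..b} x *\<^sub>R (indicator {a..b} x *\<^sub>R y x)) =
      (\<lambda>x. indicator {a..b} x *\<^sub>R y x)"
    by (auto simp: indicator_def fun_eq_iff)
  ultimately show ?thesis unfolding set_integrable_def by argo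
qed

context diagonal_semigroup
begin

text \<open>The equation is assumed at countably many times, where the exceptional null sets of the weak
  formulation can be collected; right-continuity extends it to all times.\<close>

lemma gen_of_integrated_path:
  assumes T: "T > 0"
    and y: "cadlag_on T y" "set_borel_measurable lborel {0..T} y"
    and g: "cadlag_on T g"
    and eq: "\<And>k t. t \<in> grid T \<Longrightarrow>
      y t \<bullet> e k = (LINT s:{0..t}|lborel. y s \<bullet> (\<gamma> *\<^sub>R (- lam k *\<^sub>R e k))) + g t \<bullet> e k"
  shows "\<And>t. t \<in> {0..T} \<Longrightarrow> \<gamma> *\<^sub>R (LINT s:{0..t}|lborel. y s) \<in> gen_dom S" (is "PROP ?A")
    and "\<And>t. t \<in> {0..T} \<Longrightarrow> gen S (\<gamma> *\<^sub>R (LINT s:{0..t}|lborel. y s)) = y t - g t" (is "PROP ?B")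
    and "\<And>k. relaxes T (\<gamma> * lam k) (\<lambda>t. - g t \<bullet> e k)
           (\<lambda>t. gen S (\<gamma> *\<^sub>R (LINT s:{0..t}|lborel. y s)) \<bullet> e k)" (is "PROP ?C")
proof -
  obtain K where K: "\<forall>s\<in>{0..T}. norm (y s) \<le> K" using cadlag_bounded[OF y(1)] by blast
  have intT: "set_integrable lborel {0..T} y"
    by (rule set_integrable_bounded_interval[OF y(2)]) (use K in auto)
  have int: "set_integrable lborel {0..t} y" if "t \<in> {0..T}" for t
    by (rule set_integrable_subset[OF intT]) (use that in auto)
  have coord: "(LINT s:{0..t}|lborel. y s \<bullet> v) = (LINT s:{0..t}|lborel. y s) \<bullet> v" if "t \<in> {0..T}" for t v
    using int[OF that] integral_inner_left[of v lborel "\<lambda>s. indicator {0..t} s *\<^sub>R y s"]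
    by (simp add: set_lebesgue_integral_def set_integrable_def)
  have intk: "set_integrable lborel {0..t} (\<lambda>s. y s \<bullet> v)" if "t \<in> {0..T}" for t v
    using integrable_inner_left[of v lborel "\<lambda>s. indicator {0..t} s *\<^sub>R y s"] int[OF that]
    by (simp add: set_integrable_def)
  have hk: "(LINT s:{0..t}|lborel. y s) \<bullet> v = integral {0..t} (\<lambda>s. y s \<bullet> v)" if "t \<in> {0..T}" for t v
    using set_borel_integral_eq_integral(2)[OF intk[OF that]] coord[OF that] by simp
  have hkint: "(\<lambda>s. y s \<bullet> v) integrable_on {0..T}" for v
    by (rule set_borel_integral_eq_integral(1)[OF intk]) (use T in simp)
  have cont: "continuous_on {0..T} (\<lambda>t. (LINT s:{0..t}|lborel. y s) \<bullet> v)" for v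
    by (rule continuous_on_eq[OF indefinite_integral_continuous_1[OF hkint[of v]]]) (simp add: hk)
  have coords: "(y t - g t) \<bullet> e k = - lam k * (\<gamma> *\<^sub>R (LINT s:{0..t}|lborel. y s) \<bullet> e k)"
    if t: "t \<in> {0..T}" for t k
  proof -
    have on_grid: "y s \<bullet> e k = - lam k * (\<gamma> *\<^sub>R (LINT s:{0..s}|lborel. y s) \<bullet> e k) + g s \<bullet> e k"
      if "s \<in> grid T" for s
    proof -
      have "s \<in> {0..T}" using grid_subset[of T] T that by auto
      from eq[OF that, of k, unfolded coord[OF this]] show ?thesis by (simp add: algebra_simps)
    qed
    obtain a where a: "\<And>n. a n \<in> grid T \<and> t \<le> a n" "a \<longlonglongrightarrow> t" using grid_approx[OF t] by blast
    have aT: "a n \<in> {0..T}" for n using a(1)[of n] grid_subset[of T] T by auto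
    have lim_y: "(\<lambda>n. y (a n)) \<longlonglongrightarrow> y t" by (rule cadlag_seq_right[OF y(1) t a])
    have lim_g: "(\<lambda>n. g (a n)) \<longlonglongrightarrow> g t" by (rule cadlag_seq_right[OF g t a])
    have lim_I: "(\<lambda>n. (LINT s:{0..a n}|lborel. y s) \<bullet> e k) \<longlonglongrightarrow> (LINT s:{0..t}|lborel. y s) \<bullet> e k"
      by (rule continuous_on_tendsto_compose[OF cont a(2) t]) (use aT in auto)
    have "(\<lambda>n. y (a n) \<bullet> e k) \<longlonglongrightarrow> y t \<bullet> e k" by (intro tendsto_intros lim_y)
    moreover have "(\<lambda>n. y (a n) \<bullet> e k) \<longlonglongrightarrow>
        - lam k * (\<gamma> *\<^sub>R (LINT s:{0..t}|lborel. y s) \<bullet> e k) + g t \<bullet> e k"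
      unfolding on_grid[OF a(1)[THEN conjunct1]] inner_scaleR_left by (intro tendsto_intros lim_I lim_g)
    ultimately have "y t \<bullet> e k = - lam k * (\<gamma> *\<^sub>R (LINT s:{0..t}|lborel. y s) \<bullet> e k) + g t \<bullet> e k"
      by (rule LIMSEQ_unique)
    then show ?thesis by (simp add: inner_diff_left)
  qed
  show A: "PROP ?A" and B: "PROP ?B" using gen_from_coordinates[OF coords] by blast+
  show "PROP ?C"
  proof -
    fix k
    let ?X = "\<lambda>t. gen S (\<gamma> *\<^sub>R (LINT s:{0..t}|lborel. y s)) \<bullet> e k"
    have diff: "- g t \<bullet> e k - ?X t = - (y t \<bullet> e k)" if "t \<in> {0..T}" for t
      using B[OF that] by (simp add: inner_diff_left)
    show "relaxes T (\<gamma> * lam k) (\<lambda>t. - g t \<bullet> e k) ?X"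
      unfolding relaxes_def
    proof (intro conjI ballI)
      show "(\<lambda>s. - g s \<bullet> e k - ?X s) integrable_on {0..T}"
        by (rule integrable_eq[OF integrable_neg[OF hkint[of "e k"]]]) (rule diff[symmetric])
      fix t assume t: "t \<in> {0..T}"
      have "integral {0..t} (\<lambda>s. - g s \<bullet> e k - ?X s) = integral {0..t} (\<lambda>s. - (y s \<bullet> e k))"
        by (rule integral_cong) (use diff t in auto)
      also have "\<dots> = - integral {0..t} (\<lambda>s. y s \<bullet> e k)" by (rule integral_neg)
      finally have "integral {0..t} (\<lambda>s. - g s \<bullet> e k - ?X s) = - ((LINT s:{0..t}|lborel. y s) \<bullet> e k)"
        by (simp add: hk[OF t])
      then show "?X t = \<gamma> * lam k * integral {0..t} (\<lambda>s. - g s \<bullet> e k - ?X s)"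
        using B[OF t] coords[OF t, of k] by (simp add: mult_ac)
    qed
  qed
qed

end

lemma progressive_path_measurable:
  assumes "progressive F T Y" "T \<ge> 0" "\<omega> \<in> space (F T)"
  shows "set_borel_measurable lborel {0..T} (\<lambda>t. Y t \<omega> :: 'v::real_normed_vector)"
proof -
  have m: "(\<lambda>(s, \<omega>). Y s \<omega>) \<in> borel_measurable (restrict_space borel {0..T} \<Otimes>\<^sub>M F T)"
    using assms(1,2) by (auto simp: progressive_def)
  have "(\<lambda>s. (s, \<omega>)) \<in> measurable (restrict_space borel {0..T}) (restrict_space borel {0..T} \<Otimes>\<^sub>M F T)"
    using assms(3) by (intro measurable_Pair2')
  from measurable_compose[OF this m] have "(\<lambda>s. Y s \<omega>) \<in> borel_measurable (restrict_space borel {0..T})"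
    by simp
  then show ?thesis
    by (simp add: set_borel_measurable_def borel_measurable_restrict_space_iff)
qed

text \<open>Along a sequence increasing to \<open>T\<close> the path converges to its left limit, and in probability to its
  value at \<open>T\<close>.\<close>

lemma (in prob_space) AE_left_continuous_at_end:
  fixes L :: "real \<Rightarrow> 'a \<Rightarrow> 'u::{real_normed_vector, second_countable_topology}"
  assumes T: "T > 0" and meas: "\<And>t. t \<in> {0..T} \<Longrightarrow> L t \<in> borel_measurable M"
    and cad: "\<And>\<omega>. \<omega> \<in> space M \<Longrightarrow> cadlag_on T (\<lambda>t. L t \<omega>)"
    and stoch: "tendsto_in_prob M L (L T) (at T within {0..T})"
  shows "AE \<omega> in M. ((\<lambda>t. L t \<omega>) \<longlongrightarrow> L T \<omega>) (at_left T)"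
proof -
  define s where "s = (\<lambda>n. T - T * inverse (real (Suc (Suc n))))"
  have s: "0 \<le> s n" "s n < T" for n
  proof -
    have "T * inverse (real (Suc (Suc n))) \<le> T * 1"
      using T by (intro mult_left_mono) (auto simp: inverse_le_1_iff)
    then show "0 \<le> s n" by (simp add: s_def)
    show "s n < T" using T by (simp add: s_def)
  qed
  have "s \<longlonglongrightarrow> T - T * 0"
    unfolding s_def by (intro tendsto_intros LIMSEQ_Suc[OF LIMSEQ_inverse_real_of_nat])
  then have sT: "s \<longlonglongrightarrow> T" by simp
  have s_neq: "s n \<noteq> T" for n using s(2)[of n] by simp
  have s_left: "filterlim s (at_left T) sequentially"
    using sT s(2) s_neq by (simp add: filterlim_at)
  have s_within: "filterlim s (at T within {0..T}) sequentially"
    using sT s(1) less_imp_le[OF s(2)] s_neq by (simp add: filterlim_at)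
  have mT [measurable]: "L T \<in> borel_measurable M" "\<And>n. L (s n) \<in> borel_measurable M"
    using meas[of T] meas[of "s _"] T s by (auto simp: less_imp_le)
  \<comment> \<open>\<open>B j m\<close>: from index \<open>m\<close> on, the path stays at distance at least \<open>1 / (j + 1)\<close> from its value at \<open>T\<close>.\<close>
  define B where "B = (\<lambda>j m. {\<omega>\<in>space M. \<forall>n\<ge>m. inverse (real (Suc j)) \<le> dist (L (s n) \<omega>) (L T \<omega>)})"
  have B_sets: "B j m \<in> sets M" for j m unfolding B_def by measurable
  have "B j m \<in> null_sets M" for j m
  proof -
    have "(\<lambda>n. prob {\<omega>\<in>space M. inverse (real (Suc j)) \<le> dist (L (s n) \<omega>) (L T \<omega>)}) \<longlonglongrightarrow> 0"
      using stoch[unfolded tendsto_in_prob_def, rule_format, of "inverse (real (Suc j))"]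
      by (intro filterlim_compose[OF _ s_within]) auto
    moreover have "eventually (\<lambda>n. prob (B j m) \<le>
        prob {\<omega>\<in>space M. inverse (real (Suc j)) \<le> dist (L (s n) \<omega>) (L T \<omega>)}) sequentially"
      using eventually_ge_at_top[of m]
    proof eventually_elim
      case (elim n)
      show ?case by (rule finite_measure_mono) (use elim in \<open>auto simp: B_def\<close>)
    qed
    ultimately have "prob (B j m) \<le> 0" by (rule tendsto_lowerbound) simp
    then have "prob (B j m) = 0" by (simp add: measure_le_0_iff)
    then show ?thesis using B_sets by (simp add: null_sets_def emeasure_eq_measure)
  qed
  then have "AE \<omega> in M. \<forall>j m. \<omega> \<notin> B j m"
    by (simp add: AE_all_countable AE_not_in)
  then show ?thesis
  proof (rule AE_mp, intro AE_I2 impI)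
    fix \<omega> assume \<omega>: "\<omega> \<in> space M" and nB: "\<forall>j m. \<omega> \<notin> B j m"
    obtain l where l: "((\<lambda>t. L t \<omega>) \<longlongrightarrow> l) (at_left T)"
      using cad[OF \<omega>] T unfolding cadlag_on_def by (auto dest!: bspec[of _ _ T])
    have "l = L T \<omega>"
    proof (rule ccontr)
      assume "l \<noteq> L T \<omega>"
      then have "dist l (L T \<omega>) > 0" by simp
      then obtain j where j: "inverse (real (Suc j)) < dist l (L T \<omega>)" using reals_Archimedean by blast
      have "(\<lambda>n. dist (L (s n) \<omega>) (L T \<omega>)) \<longlonglongrightarrow> dist l (L T \<omega>)"
        by (intro tendsto_intros filterlim_compose[OF l s_left])
      from order_tendstoD(1)[OF this j] obtain m where
        "\<forall>n\<ge>m. inverse (real (Suc j)) < dist (L (s n) \<omega>) (L T \<omega>)"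
        by (auto simp: eventually_sequentially)
      then have "\<omega> \<in> B j m" using \<omega> by (auto simp: B_def intro: less_imp_le)
      with nB show False by blast
    qed
    with l show "((\<lambda>t. L t \<omega>) \<longlongrightarrow> L T \<omega>) (at_left T)" by simp
  qed
qed

lemma dist_M1_prod_le:
  assumes "\<And>k. 0 \<le> dist_M1 T (\<lambda>t. f t \<bullet> e k) (\<lambda>t. g t \<bullet> e k)"
    and "\<And>k. dist_M1 T (\<lambda>t. f t \<bullet> e k) (\<lambda>t. g t \<bullet> e k) \<le> B"
  shows "dist_M1_prod T e f g \<le> B"
proof -
  define d where "d = (\<lambda>k. dist_M1 T (\<lambda>t. f t \<bullet> e k) (\<lambda>t. g t \<bullet> e k))"
  have d: "0 \<le> d k" "d k \<le> B" for k using assms by (auto simp: d_def)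
  have "B \<ge> 0" using d[of 0] by linarith
  have frac: "0 \<le> d k / (1 + d k)" "d k / (1 + d k) \<le> B" for k
  proof -
    show "0 \<le> d k / (1 + d k)" using d[of k] by simp
    have "d k \<le> d k * (1 + d k)" using d(1)[of k] by (simp add: algebra_simps)
    then have "d k / (1 + d k) \<le> d k" using d(1)[of k] by (simp add: divide_le_eq)
    then show "d k / (1 + d k) \<le> B" using d(2)[of k] by simp
  qed
  have geo: "(\<lambda>k. (1 / 2) ^ Suc k) sums (1::real)" using power_half_series .
  have "dist_M1_prod T e f g = (\<Sum>k. (1 / 2) ^ Suc k * (d k / (1 + d k)))"
    by (simp add: dist_M1_prod_def d_def)
  also have "\<dots> \<le> (\<Sum>k. (1 / 2) ^ Suc k * B)"
  proof (rule suminf_le)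
    show le: "(1 / 2) ^ Suc k * (d k / (1 + d k)) \<le> (1 / 2) ^ Suc k * B" for k
      using frac by (intro mult_left_mono) auto
    show sB: "summable (\<lambda>k. (1 / 2) ^ Suc k * B)"
      by (rule summable_mult2[OF sums_summable[OF geo]])
    show "summable (\<lambda>k. (1 / 2) ^ Suc k * (d k / (1 + d k)))"
    proof (rule summable_comparison_test'[OF sB, of 0])
      fix k
      have "norm ((1 / 2) ^ Suc k * (d k / (1 + d k))) = (1 / 2) ^ Suc k * (d k / (1 + d k))"
        unfolding real_norm_def by (intro abs_of_nonneg mult_nonneg_nonneg frac(1)) simp
      then show "norm ((1 / 2) ^ Suc k * (d k / (1 + d k))) \<le> (1 / 2) ^ Suc k * B" using le by simp
    qed
  qed
  also have "\<dots> = B" using sums_mult2[OF geo, of B] by (simp add: sums_iff)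
  finally show ?thesis .
qed

section \<open>Convergence in probability\<close>

lemma cadlag_on_continuous:
  fixes X :: "real \<Rightarrow> real"
  assumes "continuous_on {0..T} X"
  shows "cadlag_on T X"
  unfolding cadlag_on_def
proof (intro conjI ballI)
  fix t assume t: "t \<in> {0..<T}"
  have "(X \<longlongrightarrow> X t) (at t within {0..T})" using assms t by (auto simp: continuous_on_def)
  then have "(X \<longlongrightarrow> X t) (at t within {t..T})" by (rule tendsto_within_subset) (use t in auto)
  then show "(X \<longlongrightarrow> X t) (at_right t)" using t by (simp add: at_within_Icc_at_right)
next
  fix t assume t: "t \<in> {0<..T}"
  have "(X \<longlongrightarrow> X t) (at t within {0..T})" using assms t by (auto simp: continuous_on_def)
  then have "(X \<longlongrightarrow> X t) (at t within {0..t})" by (rule tendsto_within_subset) (use t in auto)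
  then show "\<exists>l. (X \<longlongrightarrow> l) (at_left t)" using t by (auto simp: at_within_Icc_at_left)
qed

lemma exp_minus_mult_le:
  fixes a x b :: real
  assumes "a > 0" "x \<ge> b / a" "b \<ge> 0"
  shows "exp (- x) * b \<le> a"
proof -
  have "x \<ge> 0" using assms by (meson divide_nonneg_pos order_trans)
  have "b \<le> a * x" using assms by (simp add: divide_le_eq mult.commute)
  also have "x \<le> exp x" using exp_ge_add_one_self[of x] by linarith
  then have "a * x \<le> a * exp x" using assms(1) by (intro mult_left_mono) auto
  finally show ?thesis by (simp add: exp_minus divide_simps mult.commute)
qed

text \<open>The coordinate maps do not increase norms, so one regularity condition on the vector-valued path
  controls all coordinates with the same constants.\<close>

lemma dist_M1_prod_relaxes_le:
  fixes e :: "nat \<Rightarrow> 'v::real_inner"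
  assumes cad: "cadlag_on T z" and z0: "z 0 = 0" and reg: "regular_path T \<delta> \<eta> K z"
    and \<delta>: "0 < \<delta>" "\<delta> \<le> T" and \<eta>: "\<eta> \<ge> 0" and e: "\<And>k. norm (e k) = 1"
    and c: "\<And>k. c k > 0" and rel: "\<And>k. relaxes T (c k) (\<lambda>t. - z t \<bullet> e k) (\<lambda>t. X t \<bullet> e k)"
    and small: "\<And>k. exp (- c k * (\<delta> / 6)) * (2 * K) \<le> 4 * \<eta>"
  shows "dist_M1_prod T e X (\<lambda>t. - z t) \<le> max (2 * \<delta>) (20 * \<eta>)"
proof (rule dist_M1_prod_le)
  fix k
  have T: "T > 0" using \<delta> by simp
  have le: "norm (- x \<bullet> e k) \<le> norm x" for x :: 'v
    using Cauchy_Schwarz_ineq2[of x "e k"] e[of k] by simp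
  have cadk: "cadlag_on T (\<lambda>t. - z t \<bullet> e k)"
    by (rule cadlag_on_compose[OF cad, of "\<lambda>x. - x \<bullet> e k"]) (intro continuous_intros)
  have regk: "regular_path T \<delta> \<eta> K (\<lambda>t. - z t \<bullet> e k)"
  proof (rule regular_path_compose[OF reg, of "\<lambda>x. - x \<bullet> e k"])
    show "norm (- x \<bullet> e k - - y \<bullet> e k) \<le> norm (x - y)" for x y
      using le[of "x - y"] by (simp add: inner_diff_left)
  qed (rule le)
  have "param_reps T (\<lambda>t. X t \<bullet> e k) \<noteq> {}" "param_reps T (\<lambda>t. - z t \<bullet> e k) \<noteq> {}"
    using param_reps_nonempty[OF cadlag_on_continuous[OF relaxes_continuous[OF rel[of k]]] T]
      param_reps_nonempty[OF cadk T] by auto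
  then show "0 \<le> dist_M1 T (\<lambda>t. X t \<bullet> e k) (\<lambda>t. - z t \<bullet> e k)" by (rule dist_M1_nonneg)
  show "dist_M1 T (\<lambda>t. X t \<bullet> e k) (\<lambda>t. - z t \<bullet> e k) \<le> max (2 * \<delta>) (20 * \<eta>)"
    by (rule dist_M1_relaxes_le[OF cadk _ regk \<delta> \<eta> c rel small]) (simp add: z0)
qed

lemma positive_sequence_bounded_below:
  fixes lam :: "nat \<Rightarrow> real"
  assumes "\<And>k. lam k > 0" "filterlim lam at_top sequentially"
  shows "\<exists>l>0. \<forall>k. l \<le> lam k"
proof -
  obtain N where N: "\<And>k. k \<ge> N \<Longrightarrow> lam k \<ge> 1"
    using assms(2) unfolding filterlim_at_top eventually_sequentially by blast
  define l where "l = Min (insert 1 (lam ` {..<N}))"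
  have "l > 0" unfolding l_def using assms(1) by (subst Min_gr_iff) auto
  moreover have "l \<le> lam k" for k
  proof (cases "k < N")
    case True then show ?thesis unfolding l_def by (intro Min_le) auto
  next
    case False
    have "l \<le> 1" unfolding l_def by (intro Min_le) auto
    then show ?thesis using N[of k] False by auto
  qed
  ultimately show ?thesis by blast
qed

text \<open>The events increase with \<open>n\<close>, and every cadlag path without a jump at \<open>T\<close> lies in one of them.\<close>

lemma (in prob_space) regular_path_prob_limit:
  fixes Z :: "real \<Rightarrow> 'a \<Rightarrow> 'e::{real_normed_vector, second_countable_topology}"
  assumes T: "T > 0" and \<eta>: "\<eta> > 0" and meas: "\<And>t. t \<in> {0..T} \<Longrightarrow> Z t \<in> borel_measurable M"
    and cad: "\<And>\<omega>. \<omega> \<in> space M \<Longrightarrow> cadlag_on T (\<lambda>t. Z t \<omega>)"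
    and left: "AE \<omega> in M. ((\<lambda>t. Z t \<omega>) \<longlongrightarrow> Z T \<omega>) (at_left T)"
  shows "(\<lambda>n. emeasure M (space M - {\<omega>\<in>space M.
      regular_path T (inverse (real (Suc n))) \<eta> (real n) (\<lambda>t. Z t \<omega>)})) \<longlonglongrightarrow> 0"
proof -
  define E where "E = (\<lambda>n. {\<omega>\<in>space M. regular_path T (inverse (real (Suc n))) \<eta> (real n) (\<lambda>t. Z t \<omega>)})"
  have E_sets: "E n \<in> sets M" for n unfolding E_def by (rule sets_regular_path[OF T meas cad])
  have mono: "E m \<subseteq> E n" if "m \<le> n" for m n
  proof -
    have "inverse (real (Suc n)) \<le> inverse (real (Suc m))" using that by simp
    then show ?thesis unfolding E_def using that regular_path_mono by fastforce
  qed
  then have "incseq E" by (simp add: incseq_def)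
  have "AE \<omega> in M. \<omega> \<in> (\<Union>n. E n)"
    using left
  proof (rule AE_mp, intro AE_I2 impI)
    fix \<omega> assume \<omega>: "\<omega> \<in> space M" and "((\<lambda>t. Z t \<omega>) \<longlongrightarrow> Z T \<omega>) (at_left T)"
    from cadlag_imp_regular[OF cad[OF \<omega>] T \<eta> this(2)]
    obtain \<delta> K where \<delta>: "\<delta> > 0" and K: "regular_path T \<delta> \<eta> K (\<lambda>t. Z t \<omega>)" by blast
    obtain n1 where n1: "inverse (real (Suc n1)) < \<delta>" using reals_Archimedean[OF \<delta>] by blast
    obtain n2 where n2: "K \<le> real n2" using real_arch_simple by blast
    define n where "n = max n1 n2"
    have "inverse (real (Suc n)) \<le> inverse (real (Suc n1))" by (simp add: n_def)
    then have "inverse (real (Suc n)) \<le> \<delta>" using n1 by linarith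
    moreover have "K \<le> real n" using n2 by (simp add: n_def)
    ultimately have le: "inverse (real (Suc n)) \<le> \<delta>" "K \<le> real n" by auto
    from regular_path_mono[OF K le] show "\<omega> \<in> (\<Union>n. E n)" using \<omega> by (auto simp: E_def)
  qed
  then have "prob (\<Union>n. E n) = 1" using E_sets by (intro prob_eq_1[THEN iffD2]) auto
  moreover have "(\<lambda>n. prob (E n)) \<longlonglongrightarrow> prob (\<Union>n. E n)"
    by (rule finite_Lim_measure_incseq) (use E_sets \<open>incseq E\<close> in auto)
  ultimately have "(\<lambda>n. 1 - prob (E n)) \<longlonglongrightarrow> 1 - 1" by (intro tendsto_intros) simp
  then have "(\<lambda>n. prob (space M - E n)) \<longlonglongrightarrow> 0" using E_sets by (simp add: prob_compl)
  then have "(\<lambda>n. ennreal (prob (space M - E n))) \<longlonglongrightarrow> ennreal 0" by (rule tendsto_ennrealI)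
  then show ?thesis by (simp only: emeasure_eq_measure ennreal_0 E_def)
qed

theorem corollary5p1:
  fixes M :: "'w measure"
    and F :: "real \<Rightarrow> 'w measure"
    and T :: real
    and L :: "real \<Rightarrow> 'w \<Rightarrow> 'u::{real_inner, banach, second_countable_topology}"
    and G :: "'u \<Rightarrow>\<^sub>L 'v::{real_inner, banach, second_countable_topology}"
    and S :: "real \<Rightarrow> 'v \<Rightarrow>\<^sub>L 'v"
    and Y :: "real \<Rightarrow> real \<Rightarrow> 'w \<Rightarrow> 'v"
    and e :: "nat \<Rightarrow> 'v"
    and lam :: "nat \<Rightarrow> real"
  defines "AX \<equiv> \<lambda>\<gamma> t \<omega>. gen S (integrated_process \<gamma> (Y \<gamma>) t \<omega>)"
  assumes "prob_space M"
    and "filtration (space M) F"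
    and "\<And>t. subalgebra M (F t)"
    and "T > 0"
    and "levy_process M F T L"
    and "C0_semigroup S"
    and "\<And>\<gamma> t. \<gamma> > 0 \<Longrightarrow> t \<in> {0..T} \<Longrightarrow>
           has_levy_integral M L t (\<lambda>s. S (\<gamma> * (t - s)) o\<^sub>L G) (Y \<gamma> t)"
    and "\<And>\<gamma>. \<gamma> > 0 \<Longrightarrow> weak_solution M F T (gen_dom S) (gen S) G L \<gamma> (Y \<gamma>)"
    and "\<And>\<gamma>. \<gamma> > 0 \<Longrightarrow> AE \<omega> in M. cadlag_on T (\<lambda>t. Y \<gamma> t \<omega>)"
    and "orthonormal_basis e"
    and "\<And>t k. t \<ge> 0 \<Longrightarrow> S t (e k) = exp (- lam k * t) *\<^sub>R e k"
    and "\<And>k. lam k > 0"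
    and "filterlim lam at_top sequentially"
  shows "(\<forall>\<gamma>>0. AE \<omega> in M.
            (\<forall>t\<in>{0..T}. integrated_process \<gamma> (Y \<gamma>) t \<omega> \<in> gen_dom S) \<and>
            cadlag_on T (\<lambda>t. AX \<gamma> t \<omega>)) \<and>
         (\<forall>\<epsilon>>0. ((\<lambda>\<gamma>. outer_measure_of M
              {\<omega> \<in> space M. dist_M1_prod T e (\<lambda>t. AX \<gamma> t \<omega>) (\<lambda>t. - G (L t \<omega>)) \<ge> \<epsilon>})
            \<longlongrightarrow> 0) at_top)"
proof -
  note sub = assms(4) and T = assms(5) and levy = assms(6) and weak = assms(9) and cadY = assms(10)
    and lam = assms(13,14)
  interpret prob_space M by fact
  interpret diagonal_semigroup S e lam
    by unfold_locales (use assms in auto)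
  have spF: "space (F t) = space M" for t using sub[of t] by (simp add: subalgebra_def)
  have L_meas: "L t \<in> borel_measurable M" if "t \<in> {0..T}" for t
    using levy that sub measurable_from_subalg unfolding levy_process_def by blast
  have L_cad: "cadlag_on T (\<lambda>t. L t \<omega>)" if "\<omega> \<in> space M" for \<omega>
    using levy that by (simp add: levy_process_def)
  have L0: "AE \<omega> in M. L 0 \<omega> = 0" using levy by (simp add: levy_process_def)
  have L_stoch: "tendsto_in_prob M L (L T) (at T within {0..T})"
    using levy T by (simp add: levy_process_def)
  define Z where "Z = (\<lambda>t \<omega>. G (L t \<omega>))"
  have Z_meas: "Z t \<in> borel_measurable M" if "t \<in> {0..T}" for t
    unfolding Z_def
    by (rule borel_measurable_continuous_on[OF _ L_meas[OF that]]) (intro continuous_intros)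
  have Z_cad: "cadlag_on T (\<lambda>t. Z t \<omega>)" if "\<omega> \<in> space M" for \<omega>
    unfolding Z_def by (rule cadlag_on_compose[OF L_cad[OF that]]) (intro continuous_intros)
  have "AE \<omega> in M. ((\<lambda>t. L t \<omega>) \<longlongrightarrow> L T \<omega>) (at_left T)"
    by (rule AE_left_continuous_at_end[OF T L_meas L_cad L_stoch])
  then have Z_left: "AE \<omega> in M. ((\<lambda>t. Z t \<omega>) \<longlongrightarrow> Z T \<omega>) (at_left T)"
    unfolding Z_def by eventually_elim (intro tendsto_intros)
  have path: "AE \<omega> in M. \<omega> \<in> space M \<and> Z 0 \<omega> = 0 \<and>
      (\<forall>t\<in>{0..T}. integrated_process \<gamma> (Y \<gamma>) t \<omega> \<in> gen_dom S \<and> AX \<gamma> t \<omega> = Y \<gamma> t \<omega> - Z t \<omega>) \<and>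
      cadlag_on T (\<lambda>t. Y \<gamma> t \<omega>) \<and>
      (\<forall>k. relaxes T (\<gamma> * lam k) (\<lambda>t. - Z t \<omega> \<bullet> e k) (\<lambda>t. AX \<gamma> t \<omega> \<bullet> e k))"
    if \<gamma>: "\<gamma> > 0" for \<gamma>
  proof -
    have prog: "progressive F T (Y \<gamma>)" using weak[OF \<gamma>] by (simp add: weak_solution_def)
    have "AE \<omega> in M. Y \<gamma> t \<omega> \<bullet> e k =
        (LINT s:{0..t}|lborel. Y \<gamma> s \<omega> \<bullet> (\<gamma> *\<^sub>R (- lam k *\<^sub>R e k))) + Z t \<omega> \<bullet> e k"
      if "t \<in> {0..T}" for t k
    proof -
      have "AE \<omega> in M. Y \<gamma> t \<omega> \<bullet> e k =
          (LINT s:{0..t}|lborel. Y \<gamma> s \<omega> \<bullet> (\<gamma> *\<^sub>R adj_op (gen_dom S) (gen S) (e k))) +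
          L t \<omega> \<bullet> adjoint (blinfun_apply G) (e k)"
        using weak[OF \<gamma>] e_in_adj_dom that unfolding weak_solution_def by blast
      then show ?thesis unfolding adj_op_e inner_adjoint_blinfun Z_def .
    qed
    then have "AE \<omega> in M. \<forall>k. \<forall>t\<in>grid T. Y \<gamma> t \<omega> \<bullet> e k =
        (LINT s:{0..t}|lborel. Y \<gamma> s \<omega> \<bullet> (\<gamma> *\<^sub>R (- lam k *\<^sub>R e k))) + Z t \<omega> \<bullet> e k"
      using grid_subset[of T] T
      by (subst AE_all_countable, intro allI, subst AE_ball_countable[OF countable_grid]) auto
    with cadY[OF \<gamma>] L0 AE_space show ?thesis
    proof eventually_elim
      case (elim \<omega>)
      have "set_borel_measurable lborel {0..T} (\<lambda>t. Y \<gamma> t \<omega>)"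
        by (rule progressive_path_measurable[OF prog]) (use T elim spF in auto)
      note * = gen_of_integrated_path[OF T elim(1) this Z_cad[OF elim(3)], of \<gamma>]
      have "Z 0 \<omega> = 0" using elim(2) by (simp add: Z_def blinfun.zero_right)
      with elim * show ?case
        unfolding AX_def integrated_process_def by auto
    qed
  qed
  show ?thesis
  proof (intro conjI allI impI)
    fix \<gamma> :: real assume \<gamma>: "\<gamma> > 0"
    show "AE \<omega> in M. (\<forall>t\<in>{0..T}. integrated_process \<gamma> (Y \<gamma>) t \<omega> \<in> gen_dom S) \<and>
        cadlag_on T (\<lambda>t. AX \<gamma> t \<omega>)"
      using path[OF \<gamma>]
    proof eventually_elim
      case (elim \<omega>)
      have "cadlag_on T (\<lambda>t. AX \<gamma> t \<omega>)"
        by (rule cadlag_on_diff[of T "\<lambda>t. Y \<gamma> t \<omega>" "\<lambda>t. Z t \<omega>"]) (use elim Z_cad in auto)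
      with elim show ?case by blast
    qed
  next
    fix \<epsilon> :: real assume \<epsilon>: "\<epsilon> > 0"
    \<comment> \<open>chosen so that \<open>20 \<eta> < \<epsilon>\<close> in \<open>dist_M1_prod_relaxes_le\<close>\<close>
    define \<eta> where "\<eta> = \<epsilon> / 40"
    have \<eta>: "\<eta> > 0" using \<epsilon> by (simp add: \<eta>_def)
    define E where "E = (\<lambda>n. {\<omega>\<in>space M. regular_path T (inverse (real (Suc n))) \<eta> (real n) (\<lambda>t. Z t \<omega>)})"
    have E_sets: "E n \<in> sets M" for n unfolding E_def by (rule sets_regular_path[OF T Z_meas Z_cad])
    have E_lim: "(\<lambda>n. emeasure M (space M - E n)) \<longlonglongrightarrow> 0"
      unfolding E_def by (rule regular_path_prob_limit[OF T \<eta> Z_meas Z_cad Z_left])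
    let ?D = "\<lambda>\<gamma>. {\<omega> \<in> space M. dist_M1_prod T e (\<lambda>t. AX \<gamma> t \<omega>) (\<lambda>t. - G (L t \<omega>)) \<ge> \<epsilon>}"
    obtain l where l: "l > 0" "\<And>k. l \<le> lam k" using positive_sequence_bounded_below[OF lam] by blast
    have bound: "eventually (\<lambda>\<gamma>. outer_measure_of M (?D \<gamma>) \<le> emeasure M (space M - E n)) at_top"
      if n: "inverse (real (Suc n)) \<le> T" "2 * inverse (real (Suc n)) < \<epsilon>" for n
    proof -
      define \<delta> where "\<delta> = inverse (real (Suc n))"
      have \<delta>: "\<delta> > 0" "\<delta> \<le> T" "2 * \<delta> < \<epsilon>" using n by (auto simp: \<delta>_def)
      \<comment> \<open>From \<open>\<gamma>0\<close> on, even the slowest coordinate forgets a jump of size \<open>2 n\<close> within time \<open>\<delta> / 6\<close>,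
        up to \<open>4 \<eta>\<close>.\<close>
      define \<gamma>0 where "\<gamma>0 = max 1 (2 * real n / (4 * \<eta>) / (l * (\<delta> / 6)))"
      have small: "exp (- (\<gamma> * lam k) * (\<delta> / 6)) * (2 * real n) \<le> 4 * \<eta>" if "\<gamma> \<ge> \<gamma>0" for \<gamma> k
      proof -
        have "l * (\<delta> / 6) > 0" using l(1) \<delta>(1) by simp
        moreover have "2 * real n / (4 * \<eta>) / (l * (\<delta> / 6)) \<le> \<gamma>" using that by (simp add: \<gamma>0_def)
        ultimately have "\<gamma> * (l * (\<delta> / 6)) \<ge> 2 * real n / (4 * \<eta>)"
          by (simp only: pos_divide_le_eq)
        moreover have "\<gamma> * (l * (\<delta> / 6)) \<le> \<gamma> * (lam k * (\<delta> / 6))"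
          using that l \<delta> by (intro mult_left_mono mult_right_mono) (auto simp: \<gamma>0_def)
        ultimately have "\<gamma> * lam k * (\<delta> / 6) \<ge> 2 * real n / (4 * \<eta>)" by (simp add: mult.assoc)
        from exp_minus_mult_le[OF _ this] show ?thesis using \<eta> by simp
      qed
      have "outer_measure_of M (?D \<gamma>) \<le> emeasure M (space M - E n)" if \<gamma>: "\<gamma> \<ge> \<gamma>0" for \<gamma>
      proof -
        have "\<gamma> > 0" using \<gamma> by (simp add: \<gamma>0_def)
        from path[OF this] have "AE \<omega> in M. Z 0 \<omega> = 0 \<and>
            (\<forall>k. relaxes T (\<gamma> * lam k) (\<lambda>t. - Z t \<omega> \<bullet> e k) (\<lambda>t. AX \<gamma> t \<omega> \<bullet> e k))"
          by eventually_elim blast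
        then obtain N where N_null: "N \<in> null_sets M" and N: "{\<omega>\<in>space M. \<not> (Z 0 \<omega> = 0 \<and>
            (\<forall>k. relaxes T (\<gamma> * lam k) (\<lambda>t. - Z t \<omega> \<bullet> e k) (\<lambda>t. AX \<gamma> t \<omega> \<bullet> e k)))} \<subseteq> N"
          unfolding eventually_ae_filter by blast
        have "?D \<gamma> \<subseteq> (space M - E n) \<union> N"
        proof
          fix \<omega> assume \<omega>: "\<omega> \<in> ?D \<gamma>"
          show "\<omega> \<in> (space M - E n) \<union> N"
          proof (rule ccontr)
            assume "\<not> ?thesis"
            then have \<omega>': "\<omega> \<in> E n" "\<omega> \<in> space M" "\<omega> \<notin> N" using \<omega> by auto
            then have good: "Z 0 \<omega> = 0"
              "\<And>k. relaxes T (\<gamma> * lam k) (\<lambda>t. - Z t \<omega> \<bullet> e k) (\<lambda>t. AX \<gamma> t \<omega> \<bullet> e k)"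
              using N by blast+
            have "dist_M1_prod T e (\<lambda>t. AX \<gamma> t \<omega>) (\<lambda>t. - Z t \<omega>) \<le> max (2 * \<delta>) (20 * \<eta>)"
            proof (rule dist_M1_prod_relaxes_le[where K = "real n" and c = "\<lambda>k. \<gamma> * lam k"])
              show "cadlag_on T (\<lambda>t. Z t \<omega>)" by (rule Z_cad[OF \<omega>'(2)])
              show "regular_path T \<delta> \<eta> (real n) (\<lambda>t. Z t \<omega>)" using \<omega>'(1) by (simp only: E_def \<delta>_def mem_Collect_eq)
              show "\<gamma> * lam k > 0" for k using \<open>\<gamma> > 0\<close> lam(1) by simp
              show "exp (- (\<gamma> * lam k) * (\<delta> / 6)) * (2 * real n) \<le> 4 * \<eta>" for k by (rule small[OF \<gamma>])
            qed (use good \<delta> \<eta> norm_e in simp_all)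
            also have "\<dots> < \<epsilon>" using \<delta> \<epsilon> by (simp add: \<eta>_def)
            finally show False using \<omega> by (simp add: Z_def)
          qed
        qed
        then have "outer_measure_of M (?D \<gamma>) \<le> outer_measure_of M ((space M - E n) \<union> N)"
          by (rule outer_measure_of_mono)
        also have "\<dots> = emeasure M ((space M - E n) \<union> N)"
          using E_sets N_null by (intro outer_measure_of_eq) auto
        also have "\<dots> = emeasure M (space M - E n)"
          using E_sets N_null by (intro emeasure_Un_null_set) auto
        finally show ?thesis .
      qed
      then show ?thesis unfolding eventually_at_top_linorder by blast
    qed
    have "(\<lambda>n. inverse (real (Suc n))) \<longlonglongrightarrow> 0" by (rule LIMSEQ_inverse_real_of_nat)
    then have ev_n: "eventually (\<lambda>n. inverse (real (Suc n)) < min T (\<epsilon> / 2)) sequentially"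
      using T \<epsilon> by (intro order_tendstoD(2)) auto
    show "((\<lambda>\<gamma>. outer_measure_of M (?D \<gamma>)) \<longlongrightarrow> 0) at_top"
    proof (rule order_tendstoI)
      fix \<rho> :: ennreal assume "0 < \<rho>"
      then have "eventually (\<lambda>n. emeasure M (space M - E n) < \<rho>) sequentially"
        using E_lim by (rule order_tendstoD(2)[rotated])
      with ev_n have "eventually (\<lambda>n. inverse (real (Suc n)) < min T (\<epsilon> / 2) \<and>
          emeasure M (space M - E n) < \<rho>) sequentially" by (rule eventually_conj)
      then obtain n where n: "inverse (real (Suc n)) < min T (\<epsilon> / 2)" "emeasure M (space M - E n) < \<rho>"
        using eventually_happens'[OF sequentially_bot] by blast
      have "eventually (\<lambda>\<gamma>. outer_measure_of M (?D \<gamma>) \<le> emeasure M (space M - E n)) at_top"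
        by (rule bound) (use n(1) in auto)
      then show "eventually (\<lambda>\<gamma>. outer_measure_of M (?D \<gamma>) < \<rho>) at_top"
        by eventually_elim (erule le_less_trans[OF _ n(2)])
    qed simp
  qed
qed

end
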